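(* Let $n,k\ge1$, $m\ge0$, and let $\Omega\subseteq\mathbb C^{n+m}$ be a domain which is $n$-star-shaped Hartogs in the first $n$ variables $z=(z_1,\dots,z_n)$; write points as $(z,z')$, $z'\in\mathbb C^m$. Let $\alpha_j>0$ ($1\le j\le n$) and $$U^\alpha=\{(z,z',w)\in\mathbb C^{n+m}\times\mathbb C^k:(f_\alpha(z,w),z')\in\Omega,\ \|w\|<1\},\quad f_\alpha(z,w)=\Big(\frac{z_1}{(1-\|w\|^2)^{\alpha_1/2}},\dots,\frac{z_n}{(1-\|w\|^2)^{\alpha_n/2}}\Big).$$ For $\|\eta\|<1$ let $U^\alpha_\eta=\{(z,z'):(z,z',\eta)\in U^\alpha\}$ with Bergman kernel $K_{U^\alpha_\eta}$. Define $$h(z,w,\eta)=\Big(z_1\Big(\frac{1-\|\eta\|^2}{1-\langle w,\eta\rangle}\Big)^{\alpha_1},\dots,z_n\Big(\frac{1-\|\eta\|^2}{1-\langle w,\eta\rangle}\Big)^{\alpha_n}\Big)$$ and $$D_{U^\alpha}=\frac{(1-\|\eta\|^2)^{\alpha\cdot\mathbf 1}}{\pi^k(1-\langle w,\eta\rangle)^{k+1+\alpha\cdot\mathbf 1}}\prod_{j=1}^k\Big(jI+\sum_{l=1}^n\alpha_l\Big(I+z_l\frac{\partial}{\partial z_l}\Big)\Big).$$ Then for all $(z,z',w;\zeta,\zeta',\eta)\in U^\alpha\times U^\alpha$, $$K_{U^\alpha}(z,z',w;\bar\zeta,\bar\zeta',\bar\eta)=D_{U^\alpha}\Big[K_{U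^\alpha_\eta}\big(h(z,w,\eta),z';\bar\zeta,\bar\zeta'\big)\Big].$$
   Context: A domain $\Omega\subseteq\mathbb C^{n+m}$ is $n$-star-shaped Hartogs in $(z_1,\dots,z_n)$ if $(z_1,\dots,z_n,\zeta)\in\Omega$ implies $(\lambda_1z_1,\dots,\lambda_nz_n,\zeta)\in\Omega$ for all $|\lambda_j|\le1$. $\langle w,\eta\rangle=\sum_{i=1}^k w_i\bar\eta_i$, $\alpha\cdot\mathbf 1=\sum_j\alpha_j$, $I$ is the identity operator; powers of $1-\langle w,\eta\rangle$ (positive real part) use the principal branch. The Bergman kernel is the reproducing kernel of the space of square-integrable holomorphic functions. The operator acts on the function $(z,z',w)\mapsto K_{U^\alpha_\eta}(h(z,w,\eta),z';\bar\zeta,\bar\zeta')$, with $\partial/\partial z_l$ differentiating in $z_l$. *)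

theory Defs
  imports "HOL-Analysis.Analysis"
begin

definition holo_on :: "(complex^'N) set \<Rightarrow> (complex^'N \<Rightarrow> complex) \<Rightarrow> bool" where
  "holo_on S f \<longleftrightarrow> (\<forall>x\<in>S. \<exists>D. (f has_derivative D) (at x) \<and>
                       (\<forall>c v. D (c *s v) = c * D v))"

definition is_domain :: "(complex^'N) set \<Rightarrow> bool" where
  "is_domain S \<longleftrightarrow> open S \<and> connected S \<and> S \<noteq> {}"

definition bergman_space :: "(complex^'N) set \<Rightarrow> (complex^'N \<Rightarrow> complex) set" where
  "bergman_space D = {f. holo_on D f \<and> set_integrable lborel D (\<lambda>z. (cmod (f z))^2)}"

text \<open>K is the reproducing kernel of the Bergman space of D, K z w = K(z; conj w):
  K(.,w) is in the Bergman space and f(w) = integral over D of f(z) * conj(K(z,w)).\<close>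
definition is_bergman_kernel ::
  "(complex^'N) set \<Rightarrow> (complex^'N \<Rightarrow> complex^'N \<Rightarrow> complex) \<Rightarrow> bool" where
  "is_bergman_kernel D K \<longleftrightarrow>
     (\<forall>w\<in>D. (\<lambda>z. K z w) \<in> bergman_space D \<and>
        (\<forall>f\<in>bergman_space D. f w = (LINT z:D|lborel. f z * cnj (K z w))))"

text \<open>Coordinates of complex^'d: the indices in Z are the Hartogs variables z, the
  remaining ones are z'.\<close>
definition hartogs_star :: "'d set \<Rightarrow> (complex^'d) set \<Rightarrow> bool" where
  "hartogs_star Z \<Omega> \<longleftrightarrow> (\<forall>p\<in>\<Omega>. \<forall>lam::'d \<Rightarrow> complex. (\<forall>j\<in>Z. cmod (lam j) \<le> 1) \<longrightarrow>
       (\<chi> i. if i \<in> Z then lam i * p$i else p$i) \<in> \<Omega>)"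

definition cinner :: "complex^'k \<Rightarrow> complex^'k \<Rightarrow> complex" where
  "cinner w \<eta> = (\<Sum>i\<in>UNIV. w$i * cnj (\<eta>$i))"

definition pt :: "complex^'d \<Rightarrow> complex^'k \<Rightarrow> complex^('d::finite + 'k::finite)" where
  "pt u w = (\<chi> i. case i of Inl j \<Rightarrow> u$j | Inr j \<Rightarrow> w$j)"

definition zpart :: "complex^('d::finite + 'k::finite) \<Rightarrow> complex^'d" where
  "zpart p = (\<chi> j. p $ Inl j)"

definition wpart :: "complex^('d::finite + 'k::finite) \<Rightarrow> complex^'k" where
  "wpart p = (\<chi> j. p $ Inr j)"

definition falpha :: "('d \<Rightarrow> real) \<Rightarrow> 'd set \<Rightarrow> complex^'d \<Rightarrow> complex^'k \<Rightarrow> complex^'d" where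
  "falpha \<alpha> Z u w = (\<chi> i. if i \<in> Z then u$i / complex_of_real ((1 - (norm w)^2) powr (\<alpha> i / 2))
                            else u$i)"

definition Ualpha :: "('d \<Rightarrow> real) \<Rightarrow> 'd set \<Rightarrow> (complex^'d) set \<Rightarrow> (complex^('d::finite + 'k::finite)) set" where
  "Ualpha \<alpha> Z \<Omega> = {p. falpha \<alpha> Z (zpart p) (wpart p) \<in> \<Omega> \<and> norm (wpart p) < 1}"

definition Ueta :: "('d \<Rightarrow> real) \<Rightarrow> 'd set \<Rightarrow> (complex^'d) set \<Rightarrow> complex^'k \<Rightarrow> (complex^'d) set" where
  "Ueta \<alpha> Z \<Omega> \<eta> = {u. pt u \<eta> \<in> Ualpha \<alpha> Z \<Omega>}"

text \<open>h(z,w,eta) (acting on the z-coordinates, z' unchanged); principal branch powers.\<close>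
definition hmap :: "('d \<Rightarrow> real) \<Rightarrow> 'd set \<Rightarrow> complex^'d \<Rightarrow> complex^'k \<Rightarrow> complex^'k \<Rightarrow> complex^'d" where
  "hmap \<alpha> Z u w \<eta> = (\<chi> i. if i \<in> Z then
       u$i * ((complex_of_real (1 - (norm \<eta>)^2) / (1 - cinner w \<eta>)) powr complex_of_real (\<alpha> i))
     else u$i)"

definition pdz :: "(complex^('d::finite + 'k::finite) \<Rightarrow> complex) \<Rightarrow> 'd \<Rightarrow> complex^('d::finite + 'k::finite) \<Rightarrow> complex" where
  "pdz g l p = deriv (\<lambda>t. g (\<chi> i. if i = Inl l then t else p$i)) (p $ Inl l)"

definition Eop :: "('d \<Rightarrow> real) \<Rightarrow> 'd set \<Rightarrow> (complex^('d::finite + 'k::finite) \<Rightarrow> complex) \<Rightarrow> complex^('d::finite + 'k::finite) \<Rightarrow> complex" where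
  "Eop \<alpha> Z g p = (\<Sum>l\<in>Z. complex_of_real (\<alpha> l) * (g p + p $ Inl l * pdz g l p))"

primrec Pop :: "('d \<Rightarrow> real) \<Rightarrow> 'd set \<Rightarrow> nat \<Rightarrow> (complex^('d::finite + 'k::finite) \<Rightarrow> complex) \<Rightarrow> complex^('d::finite + 'k::finite) \<Rightarrow> complex" where
  "Pop \<alpha> Z 0 g = g"
| "Pop \<alpha> Z (Suc j) g = (\<lambda>p. of_nat (Suc j) * Pop \<alpha> Z j g p + Eop \<alpha> Z (Pop \<alpha> Z j g) p)"

end

theory Submission
  imports Defs "HOL-Complex_Analysis.Complex_Analysis"
begin

text \<open>
  Write s for 1 - |w|^2 and T_r for the dilation z_l \<mapsto> r^(\<alpha>_l) z_l. Rotating w fixes (v,0), so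
  K_U((z,w),(v,0)) = k(z) does not depend on w. The kernel of \<Omega> satisfies
  K_\<Omega>(T_r z, v) = K_\<Omega>(z, T_r v): both sides are holomorphic in log r and agree on the imaginary axis
  by rotation invariance. Applying the reproducing property of K_U to K_\<Omega>(.,x), and then that of
  K_\<Omega> in each slice of U, gives that K_\<Omega>(x,v) is the integral over the unit ball of
  s^(\<Sum>\<alpha>_l) k(T_s x). In polar coordinates this is a Beta-type integral in s, which the product of
  the operators j + \<Sum>\<alpha>_l (1 + z_l \<partial>_l) inverts, because along the orbit of T the sum acts as
  t d/dt. A general second point (v,\<eta>) is moved to (v',0) by Moebius automorphisms of the ball
  along one coordinate axis at a time; they lift to U, and a change of variables is needed in one
  complex variable only.
\<close>

subsection \<open>Change of variables for Lebesgue measure on complex vectors\<close>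

text \<open>The exponents \<open>\<alpha>\<close> are arbitrary positive reals and no kernel is
  constructed, so nothing is expanded in monomials: all computations run along the orbits of T and
  use only the reproducing properties. These express the known K_\<Omega> through the unknown k, so
  the formula arises by inverting an integral equation. T_s, not T_(sqrt s), occurs in it because
  the slice of U over w is T_(sqrt s) \<Omega> and the symmetry of K_\<Omega> moves a second T_(sqrt
  s) onto x. Volumes of balls give the equation the density pi^k (1-s)^(k-1)/(k-1)!. The factor with
  index j turns s^(j-1) (1-s)^(k-j)/(k-j)! into s^j (1-s)^(k-j-1)/(k-j-1)! as long as j < k, and the
  factor with j = k turns the remaining s^(k-1) into evaluation at s = 1: hence exactly k factors
  and the constant pi^k. The power of 1-|\<eta>|^2 in the formula is a Jacobian, because U_\<eta> is
  itself a dilate of \<Omega>, by sqrt(1-|\<eta>|^2).\<close>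

abbreviation complex_of_vec2 :: "real^2 \<Rightarrow> complex" where
  "complex_of_vec2 x \<equiv> Complex (x$1) (x$2)"

abbreviation vec2_of_complex :: "complex \<Rightarrow> real^2" where
  "vec2_of_complex z \<equiv> vector [Re z, Im z]"

section \<open>The area formula for injective holomorphic maps of the plane\<close>

lemma bounded_linear_complex_of_vec2: "bounded_linear complex_of_vec2"
  by (rule linear_conv_bounded_linear[THEN iffD1], rule linearI) (auto simp: complex_eq_iff)

lemma bounded_linear_vec2_of_complex: "bounded_linear vec2_of_complex"
  by (rule linear_conv_bounded_linear[THEN iffD1], rule linearI) (auto simp: vec_eq_iff forall_2)

lemma measurable_bounded_linear:
  fixes f :: "'a::real_normed_vector \<Rightarrow> 'b::real_normed_vector"
  shows "bounded_linear f \<Longrightarrow> f \<in> borel_measurable borel"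
  by (intro borel_measurable_continuous_onI linear_continuous_on)

lemma prod_Basis_vec:
  fixes f :: "'a::euclidean_space ^ 'n \<Rightarrow> 'c::comm_monoid_mult"
  shows "(\<Prod>b\<in>Basis. f b) = (\<Prod>i\<in>UNIV. \<Prod>b\<in>Basis. f (axis i b))"
proof -
  have "(\<Prod>b\<in>Basis. f b) = (\<Prod>b\<in>(\<lambda>(i,b). axis i b) ` (UNIV \<times> Basis). f b)"
    by (rule prod.cong) (auto simp: Basis_vec_def)
  also have "\<dots> = (\<Prod>(i,b)\<in>UNIV \<times> Basis. f (axis i b))"
    by (subst prod.reindex)
      (auto simp: inj_on_def axis_eq_axis case_prod_unfold intro!: prod.cong)
  also have "\<dots> = (\<Prod>i\<in>UNIV. \<Prod>b\<in>Basis. f (axis i b))"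
    by (rule prod.cartesian_product[symmetric])
  finally show ?thesis .
qed

text \<open>The change-of-variables theorem invoked below is phrased with determinants on
  \<open>real^'n\<close>, so the plane is identified with \<open>real^2\<close>. The measure is
  preserved because boxes correspond to boxes of equal volume.\<close>

lemma lborel_complex_eq_distr: "(lborel :: complex measure) = distr lborel borel complex_of_vec2"
proof (rule lborel_eqI)
  fix l u :: complex
  assume le: "\<And>b. b \<in> Basis \<Longrightarrow> l \<bullet> b \<le> u \<bullet> b"
  have [measurable]: "complex_of_vec2 \<in> borel_measurable borel"
    by (rule measurable_bounded_linear[OF bounded_linear_complex_of_vec2])
  have eq: "complex_of_vec2 -` box l u = box (vec2_of_complex l) (vec2_of_complex u)"
    by (auto simp: box_def Basis_complex_def Basis_vec_def inner_axis forall_2)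
  have "emeasure (distr lborel borel complex_of_vec2) (box l u)
        = emeasure lborel (box (vec2_of_complex l) (vec2_of_complex u))"
    by (subst emeasure_distr) (auto simp: eq)
  also have "\<dots> = (\<Prod>b\<in>Basis. (vec2_of_complex u - vec2_of_complex l) \<bullet> b)"
    using le[of 1] le[of \<i>]
    by (subst emeasure_lborel_box) (auto simp: Basis_vec_def inner_axis Basis_complex_def UNIV_2)
  also have "(\<Prod>b\<in>Basis. (vec2_of_complex u - vec2_of_complex l) \<bullet> b) = (\<Prod>b\<in>Basis. (u - l) \<bullet> b)"
    by (simp add: prod_Basis_vec UNIV_2 inner_axis Basis_complex_def complex_eq_iff)
  finally show "emeasure (distr lborel borel complex_of_vec2) (box l u) = ennreal (\<Prod>b\<in>Basis. (u - l) \<bullet> b)" .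
qed simp

text \<open>The real Jacobian of a holomorphic map is the squared modulus of its derivative.
  \<open>A\<close> is a general Borel set so that the lemma can be applied to preimages when two
  measures are compared.\<close>

lemma complex_emeasure_image:
  fixes f f' :: "complex \<Rightarrow> complex"
  assumes A: "A \<in> sets borel" and fA: "f ` A \<in> sets borel"
    and der: "\<And>z. z \<in> A \<Longrightarrow> (f has_field_derivative f' z) (at z)"
    and inj: "inj_on f A"
    and meas: "(\<lambda>z. indicator A z * (cmod (f' z))\<^sup>2) \<in> borel_measurable borel"
  shows "(\<integral>\<^sup>+z. indicator A z * ennreal ((cmod (f' z))\<^sup>2) \<partial>lborel) = emeasure lborel (f ` A)"
proof -
  let ?e = complex_of_vec2
  define d where "d = vec2_of_complex"
  let ?d = d
  have [measurable]: "?e \<in> borel_measurable borel" "?d \<in> borel_measurable borel"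
    unfolding d_def
    by (rule measurable_bounded_linear[OF bounded_linear_complex_of_vec2]
        measurable_bounded_linear[OF bounded_linear_vec2_of_complex])+
  have de: "?d (?e x) = x" for x by (simp add: d_def vec_eq_iff forall_2)
  have ed: "?e (?d z) = z" for z by (simp add: d_def)
  define A' where "A' = ?e -` A"
  define g where "g x = ?d (f (?e x))" for x
  have A'm [measurable]: "A' \<in> sets borel"
    using A measurable_sets[of ?e borel borel A] by (simp add: A'_def)
  have gA': "g ` A' = ?e -` (f ` A)"
  proof (intro set_eqI iffI)
    fix y assume "y \<in> ?e -` (f ` A)"
    then obtain z where "z \<in> A" "?e y = f z" by auto
    then have "y = g (?d z)" using de[of y] unfolding g_def ed by simp
    moreover have "?d z \<in> A'" using \<open>z \<in> A\<close> unfolding A'_def vimage_eq ed .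
    ultimately show "y \<in> g ` A'" by blast
  next
    fix y assume "y \<in> g ` A'"
    then obtain x where "?e x \<in> A" "y = g x" by (auto simp: A'_def)
    moreover from this have "?e y = f (?e x)" using ed by (simp add: g_def)
    ultimately show "y \<in> ?e -` (f ` A)" by auto
  qed
  have gm: "g ` A' \<in> sets borel"
    unfolding gA' using fA measurable_sets[of ?e borel borel "f ` A"] by simp
  have derg: "(g has_derivative (\<lambda>h. ?d (f' (?e x) * ?e h))) (at x within A')" if "x \<in> A'" for x
  proof -
    have "(f has_derivative (\<lambda>h. f' (?e x) * h)) (at (?e x))"
      using der[of "?e x"] that by (simp add: A'_def has_field_derivative_def)
    moreover have "(?e has_derivative ?e) (at x)"
      using bounded_linear_complex_of_vec2 by (rule bounded_linear_imp_has_derivative)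
    moreover have "(?d has_derivative ?d) (at (f (?e x)))"
      unfolding d_def using bounded_linear_vec2_of_complex by (rule bounded_linear_imp_has_derivative)
    ultimately have "(?d \<circ> (f \<circ> ?e) has_derivative ?d \<circ> ((\<lambda>h. f' (?e x) * h) \<circ> ?e)) (at x)"
      by (intro diff_chain_at) auto
    then show ?thesis
      by (simp add: g_def[abs_def] o_def has_derivative_at_withinI)
  qed
  have injg: "inj_on g A'"
  proof (rule inj_onI)
    fix x y assume "x \<in> A'" "y \<in> A'" "g x = g y"
    then have "?e (g x) = ?e (g y)" and in_A: "?e x \<in> A" "?e y \<in> A"
      by (simp_all add: A'_def)
    then have "f (?e x) = f (?e y)"
      unfolding g_def ed by simp
    then have "?e x = ?e y" using inj_onD[OF inj _ in_A] by blast
    then have "?d (?e x) = ?d (?e y)" by (rule arg_cong)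
    then show "x = y" unfolding de .
  qed
  \<comment> \<open>In real coordinates multiplication by a + ib is the matrix with rows (a,-b) and
    (b,a), of determinant a^2 + b^2.\<close>
  have dt: "\<bar>det (matrix (\<lambda>h. ?d (f' (?e x) * ?e h)))\<bar> = (cmod (f' (?e x)))\<^sup>2" for x
    by (simp add: d_def det_2 matrix_def axis_def cmod_power2) (simp add: power2_eq_square)
  note key = has_measure_differentiable_image[OF _ derg injg, unfolded dt]
  have A'l: "A' \<in> sets lebesgue" using A'm by simp
  have mm: "(\<lambda>x. indicator A' x * (cmod (f' (?e x)))\<^sup>2) \<in> borel_measurable borel"
    using measurable_compose[OF \<open>?e \<in> borel_measurable borel\<close> meas] by (simp add: A'_def indicator_def)
  have "(\<integral>\<^sup>+x. indicator A' x * ennreal ((cmod (f' (?e x)))\<^sup>2) \<partial>lborel) = emeasure lborel (g ` A')"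
  proof (cases "emeasure lborel (g ` A') = \<infinity>")
    case False
    then have lm: "g ` A' \<in> lmeasurable" using gm
      by (auto simp: fmeasurable_def less_top)
    then have "((\<lambda>x. (cmod (f' (?e x)))\<^sup>2) has_integral measure lebesgue (g ` A')) A'"
      using key[OF A'l, of "measure lebesgue (g ` A')"] by auto
    from nn_integral_has_integral_lebesgue[OF _ this]
    have "(\<integral>\<^sup>+x. indicator A' x * ennreal ((cmod (f' (?e x)))\<^sup>2) \<partial>lborel) = measure lebesgue (g ` A')"
      by (simp add: ennreal_mult' ennreal_indicator)
    also have "\<dots> = emeasure lborel (g ` A')"
      using emeasure_eq_measure2[OF lm] gm by simp
    finally show ?thesis .
  next
    \<comment> \<open>\<open>key\<close> speaks only of images of finite measure. A finite integral
      would, by \<open>key\<close>, make the image one of them.\<close>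
    case True
    show ?thesis
    proof (rule ccontr)
      assume "\<not> ?thesis"
      then have "(\<integral>\<^sup>+x. ennreal (indicator A' x * (cmod (f' (?e x)))\<^sup>2) \<partial>lborel) < \<infinity>"
        using True by (simp add: ennreal_mult' ennreal_indicator less_top)
      from nn_integral_integrable_on[OF mm _ this]
      have "(\<lambda>x. indicat_real A' x * (cmod (f' (?e x)))\<^sup>2) integrable_on UNIV" by simp
      also have "(\<lambda>x. indicat_real A' x * (cmod (f' (?e x)))\<^sup>2) =
          (\<lambda>x. if x \<in> A' then (cmod (f' (?e x)))\<^sup>2 else 0)"
        by (auto simp: fun_eq_iff)
      finally have "(\<lambda>x. (cmod (f' (?e x)))\<^sup>2) integrable_on A'"
        by (simp only: integrable_restrict_UNIV)
      then have "g ` A' \<in> lmeasurable"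
        using key[OF A'l] by blast
      then show False using True gm by (simp add: fmeasurable_def)
    qed
  qed
  moreover have "(\<integral>\<^sup>+z. indicator A z * ennreal ((cmod (f' z))\<^sup>2) \<partial>lborel) =
      (\<integral>\<^sup>+x. indicator A' x * ennreal ((cmod (f' (?e x)))\<^sup>2) \<partial>lborel)"
  proof -
    have m: "(\<lambda>z. indicator A z * ennreal ((cmod (f' z))\<^sup>2)) \<in> borel_measurable borel"
      using measurable_compose[OF meas measurable_ennreal] by (simp add: ennreal_mult' ennreal_indicator)
    show ?thesis
      by (subst lborel_complex_eq_distr, subst nn_integral_distr) (use m in \<open>auto simp: A'_def indicator_def\<close>)
  qed
  moreover have "emeasure lborel (g ` A') = emeasure lborel (f ` A)"
    by (subst lborel_complex_eq_distr, subst emeasure_distr) (use fA in \<open>auto simp: gA'\<close>)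
  ultimately show ?thesis by simp
qed

text \<open>Proved as an identity of measures: the pushforward under f of |f'|^2 times Lebesgue
  measure on S is Lebesgue measure on T. Borel sets are covered by the preceding lemma, and every
  nonnegative F follows.\<close>

lemma complex_change_of_variables:
  fixes f f' :: "complex \<Rightarrow> complex" and F :: "complex \<Rightarrow> ennreal"
  assumes S: "open S" and T: "open T" and fS: "f ` S = T" and inj: "inj_on f S"
    and der: "\<And>z. z \<in> S \<Longrightarrow> (f has_field_derivative f' z) (at z)"
    and cont: "continuous_on S f'"
    and F: "F \<in> borel_measurable borel"
  shows "(\<integral>\<^sup>+z. indicator S z * ennreal ((cmod (f' z))\<^sup>2) * F (f z) \<partial>lborel)
       = (\<integral>\<^sup>+z. indicator T z * F z \<partial>lborel)"
proof -
  have Sm [measurable]: "S \<in> sets borel" and Tm [measurable]: "T \<in> sets borel"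
    using S T by auto
  have contf: "continuous_on S f"
    using der by (meson DERIV_isCont continuous_at_imp_continuous_on)
  \<comment> \<open>Extension by zero makes f and f' Borel functions on the whole plane, as
    pushforwards and densities require.\<close>
  define g where "g z = (if z \<in> S then f z else 0)" for z
  define d where "d z = (if z \<in> S then f' z else 0)" for z
  have gm [measurable]: "g \<in> borel_measurable borel" 
    unfolding g_def using borel_measurable_continuous_on_if[OF Sm contf, of "\<lambda>_. 0"] by simp
  have dm [measurable]: "d \<in> borel_measurable borel"
    unfolding d_def using borel_measurable_continuous_on_if[OF Sm cont, of "\<lambda>_. 0"] by simp
  have "distr (density lborel (\<lambda>z. indicator S z * ennreal ((cmod (d z))\<^sup>2))) borel g
      = density lborel (indicator T)"
  proof (rule measure_eqI)
    fix B assume "B \<in> sets (distr (density lborel (\<lambda>z. indicator S z * ennreal ((cmod (d z))\<^sup>2))) borel g)"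
    then have B [measurable]: "B \<in> sets borel" by simp
    define A where "A = S \<inter> g -` B"
    have Am [measurable]: "A \<in> sets borel"
      unfolding A_def using measurable_sets[OF gm B] by simp
    have fA: "f ` A = T \<inter> B"
      using fS by (auto simp: A_def g_def)
    have "emeasure (distr (density lborel (\<lambda>z. indicator S z * ennreal ((cmod (d z))\<^sup>2))) borel g) B
       = (\<integral>\<^sup>+z. indicator S z * ennreal ((cmod (d z))\<^sup>2) * indicator (g -` B) z \<partial>lborel)"
      using measurable_sets[OF gm B] by (subst emeasure_distr) (auto simp: emeasure_density)
    also have "\<dots> = (\<integral>\<^sup>+z. indicator A z * ennreal ((cmod (f' z))\<^sup>2) \<partial>lborel)"
      by (rule nn_integral_cong) (auto simp: A_def d_def indicator_def)
    also have "\<dots> = emeasure lborel (f ` A)"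
    proof (rule complex_emeasure_image)
      have "(\<lambda>z. indicator A z * (cmod (d z))\<^sup>2) \<in> borel_measurable borel" by measurable
      then show "(\<lambda>z. indicator A z * (cmod (f' z))\<^sup>2) \<in> borel_measurable borel"
        by (rule measurable_cong[THEN iffD1, rotated]) (auto simp: A_def d_def indicator_def)
    qed (use der inj Am in \<open>auto simp: fA inj_on_def, auto simp: A_def\<close>)
    also have "\<dots> = emeasure (density lborel (indicator T)) B"
    proof -
      have "emeasure lborel (T \<inter> B) = (\<integral>\<^sup>+z. indicator (T \<inter> B) z \<partial>lborel)"
        by simp
      then show ?thesis
        unfolding fA by (simp add: emeasure_density indicator_inter_arith)
    qed
    finally show "emeasure (distr (density lborel (\<lambda>z. indicator S z * ennreal ((cmod (d z))\<^sup>2))) borel g) B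
        = emeasure (density lborel (indicator T)) B" .
  qed simp
  then have "(\<integral>\<^sup>+z. F z \<partial>distr (density lborel (\<lambda>z. indicator S z * ennreal ((cmod (d z))\<^sup>2))) borel g)
      = (\<integral>\<^sup>+z. F z \<partial>density lborel (indicator T))" by simp
  then have "(\<integral>\<^sup>+z. indicator S z * ennreal ((cmod (d z))\<^sup>2) * F (g z) \<partial>lborel)
       = (\<integral>\<^sup>+z. indicator T z * F z \<partial>lborel)"
    using F by (subst (asm) nn_integral_distr; simp add: nn_integral_density)
  moreover have "(\<integral>\<^sup>+z. indicator S z * ennreal ((cmod (d z))\<^sup>2) * F (g z) \<partial>lborel) =
     (\<integral>\<^sup>+z. indicator S z * ennreal ((cmod (f' z))\<^sup>2) * F (f z) \<partial>lborel)"
    by (rule nn_integral_cong) (auto simp: g_def d_def indicator_def)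
  ultimately show ?thesis by simp
qed

section \<open>Lebesgue measure on complex vectors as a product measure\<close>

lemma measurable_vec_lambda_PiM [measurable]:
  "vec_lambda \<in> borel_measurable (\<Pi>\<^sub>M i\<in>UNIV. (lborel :: 'a::euclidean_space measure))"
proof (rule borel_measurable_euclidean_space[THEN iffD2], rule ballI)
  fix b :: "'a^'b" assume "b \<in> Basis"
  then obtain i c where "b = axis i c" by (auto simp: Basis_vec_def)
  then show "(\<lambda>x. vec_lambda x \<bullet> b) \<in> borel_measurable (\<Pi>\<^sub>M i\<in>UNIV. lborel)"
    by (simp add: inner_axis)
qed

lemma measurable_vec_nth [measurable]: "(\<lambda>x::'a::euclidean_space^'n. x $ i) \<in> borel_measurable borel"
  by (rule measurable_bounded_linear[OF bounded_linear_vec_nth])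

lemma measurable_vec_lambda [measurable (raw)]:
  fixes f :: "'n::finite \<Rightarrow> 'b \<Rightarrow> 'a::euclidean_space"
  assumes "\<And>i. f i \<in> borel_measurable M"
  shows "(\<lambda>x. \<chi> i. f i x) \<in> borel_measurable M"
proof (rule borel_measurable_euclidean_space[THEN iffD2], rule ballI)
  fix b :: "'a^'n" assume "b \<in> Basis"
  then obtain i c where "b = axis i c" by (auto simp: Basis_vec_def)
  then show "(\<lambda>x. (\<chi> i. f i x) \<bullet> b) \<in> borel_measurable M"
    using assms[of i] by (simp add: inner_axis)
qed

lemma emeasure_lborel_box_vec:
  fixes l u :: "'a::euclidean_space^'n"
  shows "emeasure lborel (box l u) = (\<Prod>i\<in>UNIV. emeasure lborel (box (l$i) (u$i)))"
proof (cases "\<forall>i. \<forall>b\<in>Basis. l$i \<bullet> b \<le> u$i \<bullet> b")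
  case True
  then have "emeasure lborel (box l u) = (\<Prod>b\<in>Basis. (u - l) \<bullet> b)"
    by (subst emeasure_lborel_box) (auto simp: Basis_vec_def inner_axis)
  also have "\<dots> = (\<Prod>i\<in>UNIV. ennreal (\<Prod>b\<in>Basis. (u$i - l$i) \<bullet> b))"
    using True by (subst prod_Basis_vec)
      (simp add: prod_ennreal inner_axis prod_nonneg inner_diff_left)
  also have "\<dots> = (\<Prod>i\<in>UNIV. emeasure lborel (box (l$i) (u$i)))"
    using True by (intro prod.cong refl) (subst emeasure_lborel_box, auto)
  finally show ?thesis .
next
  case False
  then obtain i b where ib: "b \<in> Basis" "u$i \<bullet> b < l$i \<bullet> b" by (auto simp: not_le)
  then have "box (l$i) (u$i) = {}" by (auto simp: box_eq_empty intro!: bexI[of _ b])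
  moreover have "box l u = {}"
    using ib by (auto simp: box_eq_empty inner_axis Basis_vec_def intro!: exI[of _ i] bexI[of _ b])
  ultimately show ?thesis
    by (auto intro!: prod_zero[symmetric] exI[of _ i] bexI[of _ i])
qed

text \<open>Turns integrals over vectors into integrals over a finite product measure, where Fubini
  and the uniqueness of product measures apply coordinate by coordinate.\<close>

lemma lborel_vec_eq_distr:
  "(lborel :: ('a::euclidean_space^'n) measure) = distr (\<Pi>\<^sub>M i\<in>UNIV. lborel) borel vec_lambda"
proof (rule lborel_eqI)
  fix l u :: "'a^'n"
  assume le: "\<And>b. b \<in> Basis \<Longrightarrow> l \<bullet> b \<le> u \<bullet> b"
  interpret product_sigma_finite "\<lambda>_::'n. lborel :: 'a measure" by standard
  have eq: "vec_lambda -` box l u \<inter> space (\<Pi>\<^sub>M i\<in>UNIV. lborel) = Pi\<^sub>E UNIV (\<lambda>i. box (l$i) (u$i))"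
    by (auto simp: box_def Basis_vec_def inner_axis space_PiM)
  have "emeasure (distr (\<Pi>\<^sub>M i\<in>UNIV. lborel) borel vec_lambda) (box l u)
        = (\<Prod>i\<in>UNIV. emeasure lborel (box (l$i) (u$i)))"
    by (subst emeasure_distr) (auto simp: eq emeasure_PiM)
  also have "\<dots> = emeasure lborel (box l u)" by (rule emeasure_lborel_box_vec[symmetric])
  also have "\<dots> = (\<Prod>b\<in>Basis. (u - l) \<bullet> b)"
    using le by (rule emeasure_lborel_box)
  finally show "emeasure (distr (\<Pi>\<^sub>M i\<in>UNIV. lborel) borel vec_lambda) (box l u) = ennreal (\<Prod>b\<in>Basis. (u - l) \<bullet> b)" .
qed simp

lemma emeasure_lborel_complex_mult:
  fixes c :: complex
  assumes "c \<noteq> 0" and A [measurable]: "A \<in> sets borel"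
  shows "ennreal ((cmod c)\<^sup>2) * emeasure lborel ((\<lambda>t. c * t) -` A) = emeasure lborel A"
proof -
  have m [measurable]: "(\<lambda>t. c * t) -` A \<in> sets borel"
    using measurable_sets[of "\<lambda>t. c * t" borel borel A] by simp
  have "(\<integral>\<^sup>+z. indicator UNIV z * ennreal ((cmod c)\<^sup>2) * indicator A (c * z) \<partial>lborel)
       = (\<integral>\<^sup>+z. indicator UNIV z * indicator A z \<partial>lborel)"
  proof (rule complex_change_of_variables)
    show "range ((*) c) = UNIV"
      using \<open>c \<noteq> 0\<close> by (auto intro!: image_eqI[of _ _ "_ / c"])
  qed (use \<open>c \<noteq> 0\<close> in \<open>auto simp: inj_on_def intro!: derivative_eq_intros\<close>)
  then show ?thesis
    by (simp add: nn_integral_cmult indicator_vimage[symmetric])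
qed

text \<open>The scaled pushforward agrees with the product measure on rectangles by the one-variable
  scaling law, and rectangles determine a product measure.\<close>

lemma nn_integral_PiM_scale:
  fixes c :: "'i \<Rightarrow> complex"
  assumes I: "finite I" and c: "\<And>i. i \<in> I \<Longrightarrow> c i \<noteq> 0"
    and F [measurable]: "F \<in> borel_measurable (\<Pi>\<^sub>M i\<in>I. lborel)"
  shows "ennreal (\<Prod>i\<in>I. (cmod (c i))\<^sup>2) * (\<integral>\<^sup>+x. F (\<lambda>i\<in>I. c i * x i) \<partial>(\<Pi>\<^sub>M i\<in>I. lborel))
       = (\<integral>\<^sup>+x. F x \<partial>(\<Pi>\<^sub>M i\<in>I. lborel))"
proof -
  interpret product_sigma_finite "\<lambda>_::'i. lborel :: complex measure" by standard
  let ?P = "\<Pi>\<^sub>M i\<in>I. (lborel :: complex measure)"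
  let ?s = "\<lambda>x. \<lambda>i\<in>I. c i * x i"
  have sm [measurable]: "?s \<in> ?P \<rightarrow>\<^sub>M ?P" by measurable
  have "scale_measure (ennreal (\<Prod>i\<in>I. (cmod (c i))\<^sup>2)) (distr ?P ?P ?s) = ?P"
  proof (rule PiM_eqI)
    fix A :: "'i \<Rightarrow> complex set"
    assume A: "\<And>i. i \<in> I \<Longrightarrow> A i \<in> sets lborel"
    have vm: "(\<lambda>t. c i * t) -` A i \<in> sets borel" if "i \<in> I" for i
      using measurable_sets[of "\<lambda>t. c i * t" borel borel "A i"] A[OF that] by simp
    have eq: "?s -` Pi\<^sub>E I A \<inter> space ?P = Pi\<^sub>E I (\<lambda>i. (\<lambda>t. c i * t) -` A i)"
      by (auto simp: space_PiM PiE_def Pi_def extensional_def)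
    have "emeasure (distr ?P ?P ?s) (Pi\<^sub>E I A) = (\<Prod>i\<in>I. emeasure lborel ((\<lambda>t. c i * t) -` A i))"
      using A vm I by (subst emeasure_distr) (auto simp: eq emeasure_PiM intro!: sets_PiM_I_finite)
    then show "emeasure (scale_measure (ennreal (\<Prod>i\<in>I. (cmod (c i))\<^sup>2)) (distr ?P ?P ?s)) (Pi\<^sub>E I A)
        = (\<Prod>i\<in>I. emeasure lborel (A i))"
      using A c by (simp add: prod_ennreal[symmetric] prod.distrib[symmetric] emeasure_lborel_complex_mult
          cong: prod.cong)
  qed (use I in simp_all)
  then have "(\<integral>\<^sup>+x. F x \<partial>?P) =
     (\<integral>\<^sup>+x. F x \<partial>scale_measure (ennreal (\<Prod>i\<in>I. (cmod (c i))\<^sup>2)) (distr ?P ?P ?s))" by simp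
  also have "\<dots> = ennreal (\<Prod>i\<in>I. (cmod (c i))\<^sup>2) * (\<integral>\<^sup>+x. F (?s x) \<partial>?P)"
    by (simp add: nn_integral_scale_measure nn_integral_distr)
  finally show ?thesis by simp
qed

lemma nn_integral_vec_scale:
  fixes c :: "'n::finite \<Rightarrow> complex" and F :: "complex^'n \<Rightarrow> ennreal"
  assumes c: "\<And>i. c i \<noteq> 0" and F [measurable]: "F \<in> borel_measurable borel"
  shows "(\<integral>\<^sup>+x. ennreal (\<Prod>i\<in>UNIV. (cmod (c i))\<^sup>2) * F (\<chi> i. c i * x$i) \<partial>lborel) = (\<integral>\<^sup>+x. F x \<partial>lborel)"
proof -
  have "(\<integral>\<^sup>+x. ennreal (\<Prod>i\<in>UNIV. (cmod (c i))\<^sup>2) * F (\<chi> i. c i * x$i) \<partial>lborel)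
     = ennreal (\<Prod>i\<in>UNIV. (cmod (c i))\<^sup>2) * (\<integral>\<^sup>+x. F (\<chi> i. c i * x$i) \<partial>lborel)"
    by (rule nn_integral_cmult) measurable
  also have "(\<integral>\<^sup>+x. F (\<chi> i. c i * x$i) \<partial>lborel)
     = (\<integral>\<^sup>+x. F (vec_lambda (\<lambda>i\<in>UNIV. c i * x i)) \<partial>(\<Pi>\<^sub>M i\<in>UNIV. lborel))"
    by (subst lborel_vec_eq_distr, subst nn_integral_distr) (auto simp: restrict_def)
  also have "ennreal (\<Prod>i\<in>UNIV. (cmod (c i))\<^sup>2) * \<dots> = (\<integral>\<^sup>+x. F (vec_lambda x) \<partial>(\<Pi>\<^sub>M i\<in>UNIV. lborel))"
    by (rule nn_integral_PiM_scale[where F="\<lambda>x. F (vec_lambda x)"]) (use c in auto)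
  also have "\<dots> = (\<integral>\<^sup>+x. F x \<partial>lborel)"
    by (subst lborel_vec_eq_distr, subst nn_integral_distr) auto
  finally show ?thesis .
qed

text \<open>The shape of the lifted automorphisms: coordinate i moves by m alone, and every other
  coordinate is multiplied by a number depending only on coordinate i. The Jacobian is triangular:
  with coordinate i frozen the rest is a diagonal scaling, and what remains is the one-variable
  change of variables.\<close>

lemma nn_integral_fibred_map:
  fixes i :: "'n::finite" and m m' :: "complex \<Rightarrow> complex" and c :: "'n \<Rightarrow> complex \<Rightarrow> complex"
    and F :: "complex^'n \<Rightarrow> ennreal"
  assumes S: "open S" and T: "open T" and mS: "m ` S = T" and inj: "inj_on m S"
    and der: "\<And>z. z \<in> S \<Longrightarrow> (m has_field_derivative m' z) (at z)"
    and cont: "continuous_on S m'"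
    and c: "\<And>l t. t \<in> S \<Longrightarrow> c l t \<noteq> 0"
    and [measurable]: "m \<in> borel_measurable borel" "m' \<in> borel_measurable borel"
      "\<And>l. c l \<in> borel_measurable borel"
    and F [measurable]: "F \<in> borel_measurable borel"
  shows "(\<integral>\<^sup>+p. indicator S (p$i) * ennreal ((cmod (m' (p$i)))\<^sup>2 * (\<Prod>l\<in>UNIV - {i}. (cmod (c l (p$i)))\<^sup>2)) *
            F (\<chi> l. if l = i then m (p$i) else c l (p$i) * p$l) \<partial>lborel)
       = (\<integral>\<^sup>+p. indicator T (p$i) * F p \<partial>lborel)"
proof -
  interpret product_sigma_finite "\<lambda>_::'n. lborel :: complex measure" by standard
  let ?I = "UNIV - {i}"
  let ?P = "\<Pi>\<^sub>M i\<in>?I. (lborel :: complex measure)"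
  have UN: "UNIV = insert i ?I" by auto
  have [measurable]: "S \<in> sets borel" "T \<in> sets borel" using S T by auto
  have split: "(\<integral>\<^sup>+p. G p \<partial>lborel) = (\<integral>\<^sup>+y. (\<integral>\<^sup>+x. G (vec_lambda (x(i := y))) \<partial>?P) \<partial>lborel)"
    if G [measurable]: "G \<in> borel_measurable borel" for G :: "complex^'n \<Rightarrow> ennreal"
  proof -
    have "(\<integral>\<^sup>+p. G p \<partial>lborel) = (\<integral>\<^sup>+x. G (vec_lambda x) \<partial>(\<Pi>\<^sub>M i\<in>UNIV. lborel))"
      by (subst lborel_vec_eq_distr, subst nn_integral_distr) auto
    also have "\<dots> = (\<integral>\<^sup>+x. G (vec_lambda x) \<partial>(\<Pi>\<^sub>M i\<in>insert i ?I. lborel))"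
      using UN by simp
    also have "\<dots> = (\<integral>\<^sup>+y. (\<integral>\<^sup>+x. G (vec_lambda (x(i := y))) \<partial>?P) \<partial>lborel)"
    proof (rule product_nn_integral_insert_rev)
      have "(\<lambda>x. G (vec_lambda x)) \<in> borel_measurable (\<Pi>\<^sub>M i\<in>UNIV. lborel)" by measurable
      then show "(\<lambda>x. G (vec_lambda x)) \<in> borel_measurable (\<Pi>\<^sub>M i\<in>insert i ?I. lborel)"
        using UN by simp
    qed auto
    finally show ?thesis .
  qed
  have upd: "(\<lambda>x. vec_lambda (x(i := y))) \<in> borel_measurable ?P" for y :: complex
  proof (rule borel_measurable_euclidean_space[THEN iffD2], rule ballI)
    fix b :: "complex^'n" assume "b \<in> Basis"
    then obtain j d where "b = axis j d" by (auto simp: Basis_vec_def)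
    then show "(\<lambda>x. vec_lambda (x(i := y)) \<bullet> b) \<in> borel_measurable ?P"
      by (cases "j = i") (auto simp: inner_axis)
  qed
  \<comment> \<open>The other coordinates are integrated out with coordinate i frozen at y. The
    one-variable theorem is applied to H, which must therefore be shown measurable.\<close>
  define H where "H y = (\<integral>\<^sup>+x. F (vec_lambda (x(i := y))) \<partial>?P)" for y
  have Hm: "H \<in> borel_measurable borel"
  proof -
    have "(\<lambda>(y, x). vec_lambda (x(i := y))) \<in> borel_measurable (lborel \<Otimes>\<^sub>M ?P)"
    proof (rule borel_measurable_euclidean_space[THEN iffD2], rule ballI)
      fix b :: "complex^'n" assume "b \<in> Basis"
      then obtain j d where "b = axis j d" by (auto simp: Basis_vec_def)
      then show "(\<lambda>yx. (case yx of (y, x) \<Rightarrow> vec_lambda (x(i := y))) \<bullet> b) \<in> borel_measurable (lborel \<Otimes>\<^sub>M ?P)"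
        by (cases "j = i") (auto simp: inner_axis case_prod_unfold)
    qed
    from measurable_compose[OF this F]
    have "(\<lambda>(y, x). F (vec_lambda (x(i := y)))) \<in> borel_measurable (lborel \<Otimes>\<^sub>M ?P)"
      by (simp add: case_prod_unfold)
    then have "H \<in> borel_measurable lborel"
      unfolding H_def
      by (rule sigma_finite_measure.borel_measurable_nn_integral[rotated])
        (auto intro: sigma_finite)
    then show ?thesis by simp
  qed
  have inner: "(\<integral>\<^sup>+x. indicator S y * ennreal ((cmod (m' y))\<^sup>2 * (\<Prod>l\<in>?I. (cmod (c l y))\<^sup>2)) *
      F (\<chi> l. if l = i then m y else c l y * x l) \<partial>?P)
     = indicator S y * ennreal ((cmod (m' y))\<^sup>2) * H (m y)" for y
  proof (cases "y \<in> S")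
    case True
    have upm: "(\<lambda>x. F (vec_lambda (x(i := m y)))) \<in> borel_measurable ?P"
      by (rule measurable_compose[OF upd F])
    have eq: "(\<chi> l. if l = i then m y else c l y * x l) = vec_lambda ((\<lambda>l\<in>?I. c l y * x l)(i := m y))" for x
      by (auto simp: vec_eq_iff)
    have sm: "(\<lambda>x. \<lambda>l\<in>?I. c l y * x l) \<in> ?P \<rightarrow>\<^sub>M ?P" by measurable
    have "(\<integral>\<^sup>+x. ennreal ((cmod (m' y))\<^sup>2 * (\<Prod>l\<in>?I. (cmod (c l y))\<^sup>2)) *
      F (vec_lambda ((\<lambda>l\<in>?I. c l y * x l)(i := m y))) \<partial>?P)
      = ennreal ((cmod (m' y))\<^sup>2) * (ennreal (\<Prod>l\<in>?I. (cmod (c l y))\<^sup>2) *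
        (\<integral>\<^sup>+x. F (vec_lambda ((\<lambda>l\<in>?I. c l y * x l)(i := m y))) \<partial>?P))"
      using measurable_compose[OF sm upm]
      by (subst nn_integral_cmult) (simp_all add: ennreal_mult prod_nonneg mult.assoc)
    also have "\<dots> = ennreal ((cmod (m' y))\<^sup>2) * H (m y)"
      unfolding H_def using c True
      by (subst nn_integral_PiM_scale[where F="\<lambda>x. F (vec_lambda (x(i := m y)))", OF _ _ upm]) auto
    finally show ?thesis using True by (simp add: eq)
  qed simp
  have "(\<integral>\<^sup>+p. indicator S (p$i) * ennreal ((cmod (m' (p$i)))\<^sup>2 * (\<Prod>l\<in>?I. (cmod (c l (p$i)))\<^sup>2)) *
            F (\<chi> l. if l = i then m (p$i) else c l (p$i) * p$l) \<partial>lborel)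
    = (\<integral>\<^sup>+y. indicator S y * ennreal ((cmod (m' y))\<^sup>2) * H (m y) \<partial>lborel)"
  proof (subst split)
    have "(\<chi> l. if l = i then m (vec_lambda (x(i := y)) $ i)
            else c l (vec_lambda (x(i := y)) $ i) * vec_lambda (x(i := y)) $ l)
        = (\<chi> l. if l = i then m y else c l y * x l)" for x and y :: complex
      by (simp add: vec_eq_iff)
    then show "(\<integral>\<^sup>+y. \<integral>\<^sup>+x. indicator S (vec_lambda (x(i := y)) $ i) *
        ennreal ((cmod (m' (vec_lambda (x(i := y)) $ i)))\<^sup>2 *
          (\<Prod>l\<in>?I. (cmod (c l (vec_lambda (x(i := y)) $ i)))\<^sup>2)) *
        F (\<chi> l. if l = i then m (vec_lambda (x(i := y)) $ i)
            else c l (vec_lambda (x(i := y)) $ i) * vec_lambda (x(i := y)) $ l) \<partial>?P \<partial>lborel)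
      = (\<integral>\<^sup>+y. indicator S y * ennreal ((cmod (m' y))\<^sup>2) * H (m y) \<partial>lborel)"
      unfolding inner[symmetric] by simp
  qed measurable
  also have "\<dots> = (\<integral>\<^sup>+y. indicator T y * H y \<partial>lborel)"
    by (rule complex_change_of_variables[OF S T mS inj der cont Hm])
  also have "\<dots> = (\<integral>\<^sup>+p. indicator T (p$i) * F p \<partial>lborel)"
  proof (subst split)
    have "(\<lambda>x. F (vec_lambda (x(i := y)))) \<in> borel_measurable ?P" for y
      by (rule measurable_compose[OF upd F])
    then show "(\<integral>\<^sup>+y. indicator T y * H y \<partial>lborel) =
        (\<integral>\<^sup>+y. \<integral>\<^sup>+x. indicator T (vec_lambda (x(i := y)) $ i) * F (vec_lambda (x(i := y))) \<partial>?P \<partial>lborel)"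
      by (simp add: H_def nn_integral_cmult)
  qed measurable
  finally show ?thesis .
qed

lemma pt_nth [simp]: "pt u w $ Inl j = u $ j" "pt u w $ Inr l = w $ l"
  by (simp_all add: pt_def)

lemma zpart_pt [simp]: "zpart (pt u w) = u" and wpart_pt [simp]: "wpart (pt u w) = w"
  by (simp_all add: zpart_def wpart_def vec_eq_iff)

lemma pt_zpart_wpart [simp]: "pt (zpart p) (wpart p) = p"
  by (simp add: pt_def zpart_def wpart_def vec_eq_iff split: sum.split)

lemma measurable_pt [measurable (raw)]:
  assumes [measurable]: "f \<in> borel_measurable M" "g \<in> borel_measurable M"
  shows "(\<lambda>x. pt (f x) (g x)) \<in> borel_measurable M"
  unfolding pt_def by (rule measurable_vec_lambda, rename_tac i, case_tac i) auto

text \<open>Gives Fubini for the splitting into base variables and ball variables.\<close>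

lemma lborel_pt_eq_distr:
  "(lborel :: (complex^('d::finite + 'k::finite)) measure)
     = distr (lborel \<Otimes>\<^sub>M lborel) borel (\<lambda>(u, w). pt u w)"
proof (rule lborel_eqI)
  fix l u :: "complex^('d + 'k)"
  assume le: "\<And>b. b \<in> Basis \<Longrightarrow> l \<bullet> b \<le> u \<bullet> b"
  have eq: "(\<lambda>(u, w). pt u w) -` box l u = box (zpart l) (zpart u) \<times> box (wpart l) (wpart u)"
    by (auto simp: box_def Basis_vec_def inner_axis zpart_def wpart_def pt_def split: sum.splits)
  have "emeasure (distr (lborel \<Otimes>\<^sub>M lborel) borel (\<lambda>(u, w). pt u w)) (box l u)
      = emeasure lborel (box (zpart l) (zpart u)) * emeasure lborel (box (wpart l) (wpart u))"
    using eq unfolding case_prod_beta' by (subst emeasure_distr)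
      (simp_all add: eq space_pair_measure lborel.emeasure_pair_measure_Times case_prod_beta')
  also have "\<dots> = (\<Prod>i\<in>UNIV. emeasure lborel (box (l$i) (u$i)))"
    by (simp add: emeasure_lborel_box_vec zpart_def wpart_def prod.Plus flip: UNIV_Plus_UNIV)
  also have "\<dots> = emeasure lborel (box l u)" by (rule emeasure_lborel_box_vec[symmetric])
  also have "\<dots> = (\<Prod>b\<in>Basis. (u - l) \<bullet> b)"
    using le by (rule emeasure_lborel_box)
  finally show "emeasure (distr (lborel \<Otimes>\<^sub>M lborel) borel (\<lambda>(u, w). pt u w)) (box l u)
      = ennreal (\<Prod>b\<in>Basis. (u - l) \<bullet> b)" .
qed simp

subsection \<open>Holomorphic functions and the transformation law of Bergman kernels\<close>

lemma holo_onE: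
  assumes "holo_on S f" "x \<in> S"
  obtains D where "(f has_derivative D) (at x)" "\<And>c v. D (c *s v) = c * D v"
  using assms unfolding holo_on_def by blast

lemma holo_on_imp_continuous_on: "holo_on S f \<Longrightarrow> continuous_on S f"
  by (meson continuous_at_imp_continuous_on has_derivative_continuous holo_onE)

lemma holo_on_const: "holo_on S (\<lambda>p. c)"
  unfolding holo_on_def by (auto intro!: exI[of _ "\<lambda>_. 0"] derivative_eq_intros)

lemma holo_on_nth: "holo_on S (\<lambda>p. p $ i)"
  unfolding holo_on_def
  by (intro ballI exI[of _ "\<lambda>h. h $ i"])
     (auto intro!: bounded_linear_imp_has_derivative bounded_linear_vec_nth)

lemma holo_on_mult:
  assumes "holo_on S f" "holo_on S g"
  shows "holo_on S (\<lambda>p. f p * g p)"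
  unfolding holo_on_def
proof
  fix x assume "x \<in> S"
  then obtain D E where D: "(f has_derivative D) (at x)" "\<And>c v. D (c *s v) = c * D v"
    and E: "(g has_derivative E) (at x)" "\<And>c v. E (c *s v) = c * E v"
    using holo_onE assms by metis
  show "\<exists>D. ((\<lambda>p. f p * g p) has_derivative D) (at x) \<and> (\<forall>c v. D (c *s v) = c * D v)"
    using has_derivative_mult[OF D(1) E(1)] D(2) E(2)
    by (intro exI conjI) (assumption, simp add: algebra_simps)
qed

lemma holo_on_compose_holomorphic:
  assumes f: "holo_on S f" and g: "g holomorphic_on T" "open T" and fS: "\<And>x. x \<in> S \<Longrightarrow> f x \<in> T"
  shows "holo_on S (\<lambda>p. g (f p))"
  unfolding holo_on_def
proof
  fix x assume x: "x \<in> S"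
  then obtain D where D: "(f has_derivative D) (at x)" "\<And>c v. D (c *s v) = c * D v"
    using holo_onE f by metis
  have "(g has_derivative (\<lambda>h. deriv g (f x) * h)) (at (f x))"
    using holomorphic_derivI[OF g fS[OF x]] by (simp add: has_field_derivative_def)
  from has_derivative_compose[OF D(1) this]
  show "\<exists>D. ((\<lambda>p. g (f p)) has_derivative D) (at x) \<and> (\<forall>c v. D (c *s v) = c * D v)"
    by (intro exI conjI) (assumption, simp add: D(2))
qed

lemma has_derivative_vecI:
  fixes f :: "'a::real_normed_vector \<Rightarrow> 'b::euclidean_space^'n"
  assumes "\<And>i. ((\<lambda>x. f x $ i) has_derivative (\<lambda>h. f' h $ i)) (at x)"
  shows "(f has_derivative f') (at x)"
proof (subst has_derivative_componentwise_within, rule ballI)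
  fix b :: "'b^'n" assume "b \<in> Basis"
  then obtain i c where "b = axis i c" by (auto simp: Basis_vec_def)
  then show "((\<lambda>x. f x \<bullet> b) has_derivative (\<lambda>h. f' h \<bullet> b)) (at x)"
    using has_derivative_inner_left[OF assms[of i], of c] by (simp add: inner_axis)
qed

lemma holo_on_compose_vec:
  fixes \<Phi> :: "complex^'n \<Rightarrow> complex^'m"
  assumes \<Phi>: "\<And>l. holo_on S (\<lambda>p. \<Phi> p $ l)" and f: "holo_on T f" and \<Phi>S: "\<And>x. x \<in> S \<Longrightarrow> \<Phi> x \<in> T"
  shows "holo_on S (\<lambda>p. f (\<Phi> p))"
  unfolding holo_on_def
proof
  fix x assume x: "x \<in> S"
  obtain D where D: "(f has_derivative D) (at (\<Phi> x))" "\<And>c v. D (c *s v) = c * D v"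
    using holo_onE[OF f \<Phi>S[OF x]] by metis
  have "\<exists>E. \<forall>l. ((\<lambda>p. \<Phi> p $ l) has_derivative E l) (at x) \<and> (\<forall>c v. E l (c *s v) = c * E l v)"
    by (rule choice) (use \<Phi> x in \<open>auto simp: holo_on_def\<close>)
  then obtain E where E: "\<And>l. ((\<lambda>p. \<Phi> p $ l) has_derivative E l) (at x)"
     "\<And>l c v. E l (c *s v) = c * E l v" by blast
  have "(\<Phi> has_derivative (\<lambda>h. \<chi> l. E l h)) (at x)"
    by (rule has_derivative_vecI) (simp add: E(1))
  from has_derivative_compose[OF this D(1)]
  have "((\<lambda>p. f (\<Phi> p)) has_derivative (\<lambda>h. D (\<chi> l. E l h))) (at x)" .
  moreover have "D (\<chi> l. E l (c *s v)) = c * D (\<chi> l. E l v)" for c v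
  proof -
    have "(\<chi> l. E l (c *s v)) = c *s (\<chi> l. E l v)" by (simp add: vec_eq_iff E(2))
    then show ?thesis by (simp add: D(2))
  qed
  ultimately show "\<exists>D. ((\<lambda>p. f (\<Phi> p)) has_derivative D) (at x) \<and> (\<forall>c v. D (c *s v) = c * D v)"
    by blast
qed

text \<open>Complex linearity turns \<open>D (h *s v)\<close> from the chain rule into
  \<open>h * D v\<close>, which is a complex derivative in one variable.\<close>

lemma holo_curve_derivative:
  fixes \<gamma> :: "complex \<Rightarrow> complex^'n"
  assumes D: "(f has_derivative D) (at (\<gamma> t))" "\<And>c v. D (c *s v) = c * D v"
    and \<gamma>: "\<And>l. ((\<lambda>s. \<gamma> s $ l) has_field_derivative v $ l) (at t)"
  shows "((\<lambda>s. f (\<gamma> s)) has_field_derivative D v) (at t)"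
proof -
  have "(\<gamma> has_derivative (\<lambda>h. h *s v)) (at t)"
    by (rule has_derivative_vecI) (use \<gamma> in \<open>simp add: has_field_derivative_def mult_commute_abs\<close>)
  from has_derivative_compose[OF this D(1)] show ?thesis
    by (simp add: has_field_derivative_def D(2) mult_commute_abs)
qed

text \<open>Brings one-variable theory, namely the identity theorem and Cauchy's estimates, to bear
  on functions of several variables.\<close>

lemma holo_on_curve:
  fixes \<gamma> :: "complex \<Rightarrow> complex^'n"
  assumes f: "holo_on S f" and A: "open A" and \<gamma>: "\<And>l. (\<lambda>s. \<gamma> s $ l) holomorphic_on A"
    and \<gamma>A: "\<And>t. t \<in> A \<Longrightarrow> \<gamma> t \<in> S"
  shows "(\<lambda>s. f (\<gamma> s)) holomorphic_on A"
  unfolding holomorphic_on_open[OF A]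
proof
  fix t assume t: "t \<in> A"
  obtain D where D: "(f has_derivative D) (at (\<gamma> t))" "\<And>c v. D (c *s v) = c * D v"
    using holo_onE[OF f \<gamma>A[OF t]] by metis
  have "((\<lambda>s. \<gamma> s $ l) has_field_derivative (\<chi> l. deriv (\<lambda>s. \<gamma> s $ l) t) $ l) (at t)" for l
    using holomorphic_derivI[OF \<gamma> A t] by simp
  from holo_curve_derivative[OF D this]
  show "\<exists>f'. ((\<lambda>s. f (\<gamma> s)) has_field_derivative f') (at t)" by blast
qed

lemma continuous_on_imp_set_borel_measurable:
  fixes f :: "'a::topological_space \<Rightarrow> 'b::real_normed_vector"
  assumes "open S" "continuous_on S f"
  shows "set_borel_measurable borel S f"
  unfolding set_borel_measurable_def
  by (rule borel_measurable_continuous_on_indicator) (use assms in auto)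

section \<open>The reproducing property and its transport under biholomorphic maps\<close>

lemma set_integrable_mult_cnj:
  fixes f g :: "complex^'n \<Rightarrow> complex"
  assumes "open S" "f \<in> bergman_space S" "g \<in> bergman_space S"
  shows "set_integrable lborel S (\<lambda>z. f z * cnj (g z))"
proof -
  have int: "set_integrable lborel S (\<lambda>z. (cmod (f z))\<^sup>2 + (cmod (g z))\<^sup>2)"
    using assms by (auto simp: bergman_space_def intro: set_integral_add)
  have "continuous_on S (\<lambda>z. f z * cnj (g z))"
    using assms holo_on_imp_continuous_on[of S f] holo_on_imp_continuous_on[of S g]
    by (intro continuous_intros) (auto simp: bergman_space_def)
  then have m: "(\<lambda>x. indicator S x *\<^sub>R (f x * cnj (g x))) \<in> borel_measurable lborel"
    using borel_measurable_continuous_on_indicator[of S] assms(1) by auto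
  show ?thesis
    unfolding set_integrable_def
  proof (rule Bochner_Integration.integrable_bound[OF int[unfolded set_integrable_def] m], rule AE_I2)
    fix x
    have "0 \<le> (cmod (f x) - cmod (g x))\<^sup>2" by simp
    then have "2 * (cmod (f x) * cmod (g x)) \<le> (cmod (f x))\<^sup>2 + (cmod (g x))\<^sup>2"
      unfolding power2_diff by linarith
    moreover have "0 \<le> cmod (f x) * cmod (g x)" by simp
    ultimately show "norm (indicator S x *\<^sub>R (f x * cnj (g x)))
        \<le> norm (indicator S x *\<^sub>R ((cmod (f x))\<^sup>2 + (cmod (g x))\<^sup>2))"
      by (simp add: indicator_def norm_mult del: mult_nonneg_nonneg)
  qed
qed

text \<open>Pair \<open>L\<close> with K(.,z): the reproducing property of \<open>K\<close> at z
  yields \<open>L z\<close>, and that of \<open>L\<close> at w yields the conjugate of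
  \<open>K w z\<close>.\<close>

lemma bergman_kernel_unique:
  assumes K: "is_bergman_kernel D K" and w: "w \<in> D" and z: "z \<in> D"
    and L: "L \<in> bergman_space D"
    and rep: "\<And>f. f \<in> bergman_space D \<Longrightarrow> f w = (LINT x:D|lborel. f x * cnj (L x))"
  shows "L z = cnj (K w z)"
proof -
  have "L z = (LINT x:D|lborel. L x * cnj (K x z))"
    using K z L by (auto simp: is_bergman_kernel_def)
  also have "\<dots> = cnj (LINT x:D|lborel. K x z * cnj (L x))"
    by (simp add: set_lebesgue_integral_def flip: Bochner_Integration.integral_cnj) (simp add: mult.commute)
  also have "(LINT x:D|lborel. K x z * cnj (L x)) = K w z"
    using rep[of "\<lambda>x. K x z"] K z by (auto simp: is_bergman_kernel_def)
  finally show ?thesis .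
qed

lemma bergman_kernel_hermitian:
  assumes K: "is_bergman_kernel D K" and w: "w \<in> D" and z: "z \<in> D"
  shows "K z w = cnj (K w z)"
  by (rule bergman_kernel_unique[OF K w z]) (use K w in \<open>auto simp: is_bergman_kernel_def\<close>)

text \<open>The hypothesis \<open>meas\<close> concerns nonnegative functions only. Read as the
  equality of two measures, it also transports integrability and integrals of vector-valued
  functions.\<close>

lemma change_of_variables_set_integral:
  fixes \<Phi> :: "complex^'n \<Rightarrow> complex^'m" and j :: "complex^'n \<Rightarrow> complex"
    and g :: "complex^'m \<Rightarrow> 'b::{banach, second_countable_topology}"
  assumes D1: "open D1" and D2: "open D2"
    and \<Phi>: "continuous_on D1 \<Phi>" and j: "continuous_on D1 j" and D12: "\<And>p. p \<in> D1 \<Longrightarrow> \<Phi> p \<in> D2"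
    and meas: "\<And>F :: complex^'m \<Rightarrow> ennreal. F \<in> borel_measurable borel \<Longrightarrow>
      (\<integral>\<^sup>+p. indicator D1 p * ennreal ((cmod (j p))\<^sup>2) * F (\<Phi> p) \<partial>lborel) = (\<integral>\<^sup>+p. indicator D2 p * F p \<partial>lborel)"
    and g: "set_borel_measurable borel D2 g"
  shows "set_integrable lborel D2 g \<longleftrightarrow> set_integrable lborel D1 (\<lambda>p. (cmod (j p))\<^sup>2 *\<^sub>R g (\<Phi> p))"
    and "(LINT p:D2|lborel. g p) = (LINT p:D1|lborel. (cmod (j p))\<^sup>2 *\<^sub>R g (\<Phi> p))"
proof -
  have [measurable]: "D1 \<in> sets borel" "D2 \<in> sets borel" using D1 D2 by auto
  define \<phi> where "\<phi> p = (if p \<in> D1 then \<Phi> p else 0)" for p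
  define i where "i p = (if p \<in> D1 then j p else 0)" for p
  define h where "h p = indicator D2 p *\<^sub>R g p" for p
  have \<phi>m [measurable]: "\<phi> \<in> borel_measurable borel"
    unfolding \<phi>_def using borel_measurable_continuous_on_if[of D1 \<Phi> "\<lambda>_. 0"] \<Phi> by auto
  have im [measurable]: "i \<in> borel_measurable borel"
    unfolding i_def using borel_measurable_continuous_on_if[of D1 j "\<lambda>_. 0"] j by auto
  have hm [measurable]: "h \<in> borel_measurable borel"
    using g unfolding h_def set_borel_measurable_def .
  have eq: "distr (density lborel (\<lambda>p. ennreal (indicator D1 p * (cmod (i p))\<^sup>2))) borel \<phi>
      = density lborel (\<lambda>p. ennreal (indicator D2 p))"
  proof (rule measure_eqI)
    fix B assume "B \<in> sets (distr (density lborel (\<lambda>p. ennreal (indicator D1 p * (cmod (i p))\<^sup>2))) borel \<phi>)"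
    then have B [measurable]: "B \<in> sets borel" by simp
    have "emeasure (distr (density lborel (\<lambda>p. ennreal (indicator D1 p * (cmod (i p))\<^sup>2))) borel \<phi>) B
      = (\<integral>\<^sup>+p. ennreal (indicator D1 p * (cmod (i p))\<^sup>2) * indicator (\<phi> -` B) p \<partial>lborel)"
      using measurable_sets[OF \<phi>m B] by (subst emeasure_distr) (auto simp: emeasure_density)
    also have "\<dots> = (\<integral>\<^sup>+p. indicator D1 p * ennreal ((cmod (j p))\<^sup>2) * indicator B (\<Phi> p) \<partial>lborel)"
      by (rule nn_integral_cong) (auto simp: i_def \<phi>_def indicator_def)
    also have "\<dots> = (\<integral>\<^sup>+p. indicator D2 p * indicator B p \<partial>lborel)"
      by (rule meas) measurable
    also have "\<dots> = emeasure (density lborel (\<lambda>p. ennreal (indicator D2 p))) B"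
      by (simp add: emeasure_density ennreal_indicator)
    finally show "emeasure (distr (density lborel (\<lambda>p. ennreal (indicator D1 p * (cmod (i p))\<^sup>2))) borel \<phi>) B
      = emeasure (density lborel (\<lambda>p. ennreal (indicator D2 p))) B" .
  qed simp
  have e1: "(indicator D1 p * (cmod (i p))\<^sup>2) *\<^sub>R h (\<phi> p) = indicator D1 p *\<^sub>R (cmod (j p))\<^sup>2 *\<^sub>R g (\<Phi> p)" for p
    using D12[of p] by (auto simp: i_def \<phi>_def h_def indicator_def)
  have e2: "indicat_real D2 p *\<^sub>R h p = indicator D2 p *\<^sub>R g p" for p
    by (simp add: h_def indicator_def)
  have "integrable (distr (density lborel (\<lambda>p. ennreal (indicator D1 p * (cmod (i p))\<^sup>2))) borel \<phi>) h
      \<longleftrightarrow> integrable (density lborel (\<lambda>p. ennreal (indicator D2 p))) h"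
    unfolding eq ..
  then show "set_integrable lborel D2 g \<longleftrightarrow> set_integrable lborel D1 (\<lambda>p. (cmod (j p))\<^sup>2 *\<^sub>R g (\<Phi> p))"
    unfolding set_integrable_def
    by (subst (asm) integrable_distr_eq; (subst (asm) integrable_density)?;
        (subst (asm) integrable_density)?; simp add: e1 e2)
  have "integral\<^sup>L (distr (density lborel (\<lambda>p. ennreal (indicator D1 p * (cmod (i p))\<^sup>2))) borel \<phi>) h
      = integral\<^sup>L (density lborel (\<lambda>p. ennreal (indicator D2 p))) h"
    unfolding eq ..
  then show "(LINT p:D2|lborel. g p) = (LINT p:D1|lborel. (cmod (j p))\<^sup>2 *\<^sub>R g (\<Phi> p))"
    unfolding set_lebesgue_integral_def
    by (subst (asm) integral_distr; (subst (asm) integral_density)?;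
        (subst (asm) integral_density)?; simp add: e1 e2)
qed

text \<open>Multiplying f o \<Phi> by j is a unitary map from the Bergman space of \<open>D2\<close>
  to that of \<open>D1\<close>, and unitary maps carry reproducing elements to reproducing elements.
  The data \<open>j\<close>, \<open>j'\<close> and \<open>meas\<close> stay abstract so that both
  diagonal maps and ball automorphisms fit.\<close>

lemma bergman_kernel_transform:
  fixes \<Phi> :: "complex^'n \<Rightarrow> complex^'m" and \<Psi> :: "complex^'m \<Rightarrow> complex^'n" and j :: "complex^'n \<Rightarrow> complex"
  assumes D1: "open D1" and D2: "open D2"
    and \<Phi>: "\<And>l. holo_on D1 (\<lambda>p. \<Phi> p $ l)" and j: "holo_on D1 j" and D12: "\<And>p. p \<in> D1 \<Longrightarrow> \<Phi> p \<in> D2"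
    and \<Psi>: "\<And>l. holo_on D2 (\<lambda>p. \<Psi> p $ l)" and j': "holo_on D2 j'" and D21: "\<And>p. p \<in> D2 \<Longrightarrow> \<Psi> p \<in> D1"
    and inv: "\<And>p. p \<in> D1 \<Longrightarrow> \<Psi> (\<Phi> p) = p" and jj': "\<And>p. p \<in> D1 \<Longrightarrow> j p * j' (\<Phi> p) = 1"
    and meas: "\<And>F :: complex^'m \<Rightarrow> ennreal. F \<in> borel_measurable borel \<Longrightarrow>
      (\<integral>\<^sup>+p. indicator D1 p * ennreal ((cmod (j p))\<^sup>2) * F (\<Phi> p) \<partial>lborel) = (\<integral>\<^sup>+p. indicator D2 p * F p \<partial>lborel)"
    and K1: "is_bergman_kernel D1 K1" and K2: "is_bergman_kernel D2 K2"
    and p: "p \<in> D1" and q: "q \<in> D1"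
  shows "K1 p q = j p * K2 (\<Phi> p) (\<Phi> q) * cnj (j q)"
proof -
  have contPhi: "continuous_on D1 \<Phi>"
  proof -
    have "continuous_on D1 (\<lambda>p. \<chi> l. \<Phi> p $ l)"
      by (intro continuous_on_vec_lambda holo_on_imp_continuous_on \<Phi>)
    then show ?thesis by simp
  qed
  note cov = change_of_variables_set_integral[OF D1 D2 contPhi holo_on_imp_continuous_on[OF j] D12 meas]
  have sq: "set_integrable lborel D2 (\<lambda>z. (cmod (g z))\<^sup>2)
      \<longleftrightarrow> set_integrable lborel D1 (\<lambda>p. (cmod (j p * g (\<Phi> p)))\<^sup>2)" if "holo_on D2 g" for g
  proof -
    have "continuous_on D2 (\<lambda>z. (cmod (g z))\<^sup>2)"
      using holo_on_imp_continuous_on[OF that] by (intro continuous_intros)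
    then have "set_borel_measurable borel D2 (\<lambda>z. (cmod (g z))\<^sup>2)"
      by (rule continuous_on_imp_set_borel_measurable[OF D2])
    from cov(1)[OF _ _ this] show ?thesis by (simp add: norm_mult power_mult_distrib)
  qed
  \<comment> \<open>The image of the reproducing element at \<open>\<Phi> q\<close>. The constant
    \<open>cnj (j q)\<close> is there because evaluating a transported function at q gives
    \<open>j q\<close> times its value at \<open>\<Phi> q\<close>.\<close>
  define L where "L x = j x * K2 (\<Phi> x) (\<Phi> q) * cnj (j q)" for x
  have K2q: "(\<lambda>z. K2 z (\<Phi> q)) \<in> bergman_space D2"
    using K2 D12[OF q] by (auto simp: is_bergman_kernel_def)
  then have hK2: "holo_on D2 (\<lambda>z. K2 z (\<Phi> q))" by (simp add: bergman_space_def)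
  have "holo_on D1 (\<lambda>x. j x * K2 (\<Phi> x) (\<Phi> q))"
    by (intro holo_on_mult j holo_on_compose_vec[OF \<Phi> hK2 D12])
  moreover have "set_integrable lborel D1 (\<lambda>x. (cmod (j x * K2 (\<Phi> x) (\<Phi> q)))\<^sup>2)"
    using sq[OF hK2] K2q by (simp add: bergman_space_def)
  ultimately have L: "L \<in> bergman_space D1"
    unfolding bergman_space_def L_def mem_Collect_eq norm_mult[of "_ * _" "cnj (j q)"] power_mult_distrib[of _ "cmod (cnj (j q))"]
    by (intro conjI holo_on_mult[OF _ holo_on_const] set_integrable_mult_left)
  have rep: "f q = (LINT x:D1|lborel. f x * cnj (L x))" if f: "f \<in> bergman_space D1" for f
  proof -
    \<comment> \<open>The preimage of f under the unitary map, as \<open>j'\<close> is the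
      reciprocal of \<open>j\<close> carried over to \<open>D2\<close>.\<close>
    define f' where "f' y = j' y * f (\<Psi> y)" for y
    have f': "j x * f' (\<Phi> x) = f x" if "x \<in> D1" for x
      using inv[OF that] jj'[OF that] unfolding f'_def by (simp add: mult.assoc[symmetric])
    have hf: "holo_on D1 f" using f by (simp add: bergman_space_def)
    have hf': "holo_on D2 f'"
      unfolding f'_def by (intro holo_on_mult j' holo_on_compose_vec[OF \<Psi> hf D21])
    have "set_integrable lborel D1 (\<lambda>x. (cmod (f x))\<^sup>2)" using f by (simp add: bergman_space_def)
    also have "set_integrable lborel D1 (\<lambda>x. (cmod (f x))\<^sup>2) \<longleftrightarrow>
        set_integrable lborel D1 (\<lambda>x. (cmod (j x * f' (\<Phi> x)))\<^sup>2)"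
      by (intro set_integrable_cong) (auto simp: f')
    finally have bf': "f' \<in> bergman_space D2"
      using sq[OF hf'] hf' by (simp add: bergman_space_def)
    have "f q = j q * f' (\<Phi> q)" using f'[OF q] by simp
    also have "f' (\<Phi> q) = (LINT y:D2|lborel. f' y * cnj (K2 y (\<Phi> q)))"
      using K2 D12[OF q] bf' by (auto simp: is_bergman_kernel_def)
    also have "\<dots> = (LINT x:D1|lborel. (cmod (j x))\<^sup>2 *\<^sub>R (f' (\<Phi> x) * cnj (K2 (\<Phi> x) (\<Phi> q))))"
    proof (rule cov(2))
      have "continuous_on D2 (\<lambda>y. f' y * cnj (K2 y (\<Phi> q)))"
        using holo_on_imp_continuous_on[OF hf'] holo_on_imp_continuous_on[OF hK2] by (intro continuous_intros)
      then show "set_borel_measurable borel D2 (\<lambda>y. f' y * cnj (K2 y (\<Phi> q)))"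
        by (rule continuous_on_imp_set_borel_measurable[OF D2])
    qed
    also have "j q * \<dots> = (LINT x:D1|lborel. j q * ((cmod (j x))\<^sup>2 *\<^sub>R (f' (\<Phi> x) * cnj (K2 (\<Phi> x) (\<Phi> q)))))"
      by (simp only: set_integral_mult_right)
    also have "\<dots> = (LINT x:D1|lborel. f x * cnj (L x))"
    proof (rule set_lebesgue_integral_cong)
      show "\<forall>x. x \<in> D1 \<longrightarrow> j q * ((cmod (j x))\<^sup>2 *\<^sub>R (f' (\<Phi> x) * cnj (K2 (\<Phi> x) (\<Phi> q)))) = f x * cnj (L x)"
      proof (intro allI impI)
        fix x assume "x \<in> D1"
        have "complex_of_real ((cmod (j x))\<^sup>2) = j x * cnj (j x)" by (rule complex_norm_square)
        then show "j q * ((cmod (j x))\<^sup>2 *\<^sub>R (f' (\<Phi> x) * cnj (K2 (\<Phi> x) (\<Phi> q)))) = f x * cnj (L x)"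
          using f'[OF \<open>x \<in> D1\<close>, symmetric] by (simp add: L_def scaleR_conv_of_real mult_ac)
      qed
    qed (use D1 in auto)
    finally show ?thesis .
  qed
  have "L p = cnj (K1 q p)" by (rule bergman_kernel_unique[OF K1 q p L rep])
  also have "\<dots> = K1 p q" by (rule bergman_kernel_hermitian[OF K1 q p, symmetric])
  finally show ?thesis by (simp add: L_def)
qed

lemma nn_integral_diagonal_domain:
  fixes c :: "'n::finite \<Rightarrow> complex" and F :: "complex^'n \<Rightarrow> ennreal"
  assumes D2: "open D2" and c: "\<And>i. c i \<noteq> 0"
    and D12: "\<And>p. p \<in> D1 \<longleftrightarrow> (\<chi> i. c i * p$i) \<in> D2"
    and [measurable]: "F \<in> borel_measurable borel"
  shows "(\<integral>\<^sup>+p. indicator D1 p * ennreal ((cmod (\<Prod>i\<in>UNIV. c i))\<^sup>2) * F (\<chi> i. c i * p$i) \<partial>lborel)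
       = (\<integral>\<^sup>+p. indicator D2 p * F p \<partial>lborel)"
proof -
  have [measurable]: "D2 \<in> sets borel" using D2 by auto
  have pn: "(cmod (\<Prod>i\<in>UNIV. c i))\<^sup>2 = (\<Prod>i\<in>UNIV. (cmod (c i))\<^sup>2)"
    by (simp add: prod_norm[symmetric] prod_power_distrib)
  have "(\<integral>\<^sup>+p. indicator D1 p * ennreal ((cmod (\<Prod>i\<in>UNIV. c i))\<^sup>2) * F (\<chi> i. c i * p$i) \<partial>lborel) =
     (\<integral>\<^sup>+p. ennreal (\<Prod>i\<in>UNIV. (cmod (c i))\<^sup>2) * (indicator D2 (\<chi> i. c i * p$i) * F (\<chi> i. c i * p$i)) \<partial>lborel)"
    using D12 by (intro nn_integral_cong) (auto simp: indicator_def pn)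
  also have "\<dots> = (\<integral>\<^sup>+p. indicator D2 p * F p \<partial>lborel)"
    by (rule nn_integral_vec_scale[where F="\<lambda>p. indicator D2 p * F p"]) (use c in auto)
  finally show ?thesis .
qed

text \<open>Used with unimodular \<open>c\<close>, where the constant is 1, for rotations in w and
  in z, and with real \<open>c\<close> for the dilation of \<open>Ueta\<close> onto
  \<open>\<Omega>\<close>.\<close>

lemma bergman_kernel_diagonal:
  fixes c :: "'n::finite \<Rightarrow> complex"
  assumes D1: "open D1" and D2: "open D2" and c: "\<And>i. c i \<noteq> 0"
    and D12: "\<And>p. p \<in> D1 \<longleftrightarrow> (\<chi> i. c i * p$i) \<in> D2"
    and K1: "is_bergman_kernel D1 K1" and K2: "is_bergman_kernel D2 K2"
    and p: "p \<in> D1" and q: "q \<in> D1"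
  shows "K1 p q = of_real ((cmod (\<Prod>i\<in>UNIV. c i))\<^sup>2) * K2 (\<chi> i. c i * p$i) (\<chi> i. c i * q$i)"
proof -
  let ?c = "\<Prod>i\<in>UNIV. c i"
  have c0: "?c \<noteq> 0" using c by simp
  have "K1 p q = ?c * K2 (\<chi> i. c i * p$i) (\<chi> i. c i * q$i) * cnj ?c"
  proof (rule bergman_kernel_transform[OF D1 D2 _ holo_on_const _ _ holo_on_const _ _ _ _ K1 K2 p q])
    show "(\<integral>\<^sup>+p. indicator D1 p * ennreal ((cmod ?c)\<^sup>2) * F (\<chi> i. c i * p$i) \<partial>lborel)
       = (\<integral>\<^sup>+p. indicator D2 p * F p \<partial>lborel)" if "F \<in> borel_measurable borel" for F
      by (rule nn_integral_diagonal_domain[OF D2 c D12 that])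
  next
    show "?c * inverse ?c = 1" using c0 by simp
  next
    show "(\<chi> i. inverse (c i) * p$i) \<in> D1" if "p \<in> D2" for p
      using that c D12 by (simp add: mult.assoc[symmetric])
  next
    show "(\<chi> i. inverse (c i) * (\<chi> i. c i * p$i) $ i) = p" for p
      using c by (simp add: vec_eq_iff mult.assoc[symmetric])
  qed (use D12 in \<open>auto intro!: holo_on_mult holo_on_const holo_on_nth\<close>)
  then show ?thesis unfolding complex_norm_square by (simp only: mult_ac)
qed

subsection \<open>Hartogs domains and dilations\<close>

text \<open>A common form for \<open>falpha\<close>, \<open>hmap\<close>, the dilations and the
  z-part of the automorphisms. Compositions then reduce to multiplying factors, and these need to be
  compared on \<open>Z\<close> only.\<close>

definition zscale :: "'d set \<Rightarrow> ('d \<Rightarrow> complex) \<Rightarrow> complex^'d \<Rightarrow> complex^'d" where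
  "zscale Z \<sigma> u = (\<chi> i. if i \<in> Z then \<sigma> i * u$i else u$i)"

lemma zscale_nth: "zscale Z \<sigma> u $ i = (if i \<in> Z then \<sigma> i else 1) * u$i"
  by (simp add: zscale_def)

lemma zscale_eq: "zscale Z \<sigma> u = (\<chi> i. (if i \<in> Z then \<sigma> i else 1) * u$i)"
  by (simp add: vec_eq_iff zscale_nth)

lemma zscale_zscale: "zscale Z \<sigma> (zscale Z \<tau> u) = zscale Z (\<lambda>i. \<sigma> i * \<tau> i) u"
  by (simp add: vec_eq_iff zscale_nth)

lemma zscale_cong: "(\<And>i. i \<in> Z \<Longrightarrow> \<sigma> i = \<tau> i) \<Longrightarrow> zscale Z \<sigma> u = zscale Z \<tau> u"
  by (simp add: vec_eq_iff zscale_nth)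

lemma zscale_1: "(\<And>i. i \<in> Z \<Longrightarrow> \<sigma> i = 1) \<Longrightarrow> zscale Z \<sigma> u = u"
  by (simp add: vec_eq_iff zscale_nth)

lemma continuous_on_zscale [continuous_intros]:
  assumes "\<And>i. i \<in> Z \<Longrightarrow> continuous_on S (\<lambda>x. \<sigma> x i)" "continuous_on S u"
  shows "continuous_on S (\<lambda>x. zscale Z (\<sigma> x) (u x))"
  unfolding zscale_def
  by (rule continuous_on_vec_lambda, rename_tac i, case_tac "i \<in> Z")
     (auto intro!: continuous_intros assms)

lemma norm_vec_scalar_mult: "norm (t *s w) = cmod t * norm (w :: complex^'n)"
  by (simp add: norm_vec_def norm_mult L2_set_right_distrib)

lemma falpha_eq_zscale:
  "norm w < 1 \<Longrightarrow> falpha \<alpha> Z u w = zscale Z (\<lambda>i. complex_of_real ((1 - (norm w)\<^sup>2) powr (- (\<alpha> i / 2)))) u"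
  by (simp add: falpha_def zscale_def vec_eq_iff powr_minus_divide)

lemma hmap_eq_zscale:
  "hmap \<alpha> Z u w \<eta> = zscale Z (\<lambda>i. (complex_of_real (1 - (norm \<eta>)\<^sup>2) / (1 - cinner w \<eta>)) powr complex_of_real (\<alpha> i)) u"
  by (simp add: hmap_def zscale_def vec_eq_iff mult.commute)

lemma norm_less_1_square: "norm w < 1 \<Longrightarrow> 0 < 1 - (norm w)\<^sup>2"
  by (simp add: power_less_one_iff abs_square_less_1)

lemma continuous_on_zpart [continuous_intros]:
  "continuous_on S f \<Longrightarrow> continuous_on S (\<lambda>x. zpart (f x))"
  unfolding zpart_def by (intro continuous_intros)

lemma continuous_on_wpart [continuous_intros]:
  "continuous_on S f \<Longrightarrow> continuous_on S (\<lambda>x. wpart (f x))"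
  unfolding wpart_def by (intro continuous_intros)

lemma continuous_on_pt [continuous_intros]:
  "continuous_on S f \<Longrightarrow> continuous_on S g \<Longrightarrow> continuous_on S (\<lambda>x. pt (f x) (g x))"
  unfolding pt_def by (rule continuous_on_vec_lambda, rename_tac i, case_tac i) (auto intro!: continuous_intros)

locale hartogs_domain =
  fixes Z :: "'d::finite set" and \<Omega> :: "(complex^'d) set" and \<alpha> :: "'d \<Rightarrow> real"
  assumes open_\<Omega>: "open \<Omega>"
    and star: "hartogs_star Z \<Omega>"
    and alpha_pos: "\<And>j. j \<in> Z \<Longrightarrow> \<alpha> j > 0"
begin

lemma zscale_in: "u \<in> \<Omega> \<Longrightarrow> (\<And>i. i \<in> Z \<Longrightarrow> cmod (\<sigma> i) \<le> 1) \<Longrightarrow> zscale Z \<sigma> u \<in> \<Omega>"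
  using star unfolding hartogs_star_def zscale_def by blast

text \<open>Star-shapedness relative to a scaled point already known to lie in
  \<open>\<Omega>\<close>: dividing the factors gives numbers in the closed unit disc.\<close>

lemma zscale_mono:
  assumes "zscale Z \<tau> u \<in> \<Omega>" "\<And>i. i \<in> Z \<Longrightarrow> cmod (\<sigma> i) \<le> cmod (\<tau> i)"
  shows "zscale Z \<sigma> u \<in> \<Omega>"
proof -
  have "zscale Z \<sigma> u = zscale Z (\<lambda>i. \<sigma> i / \<tau> i) (zscale Z \<tau> u)"
    unfolding zscale_zscale
  proof (rule zscale_cong)
    fix i assume "i \<in> Z"
    \<comment> \<open>If \<open>\<tau> i\<close> is 0, the bound forces
      \<open>\<sigma> i = 0\<close>, and the equation survives because division by 0 gives
      0.\<close>
    then show "\<sigma> i = \<sigma> i / \<tau> i * \<tau> i" using assms(2)[of i] by (cases "\<tau> i = 0") auto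
  qed
  also have "\<dots> \<in> \<Omega>"
  proof (rule zscale_in[OF assms(1)])
    fix i assume "i \<in> Z"
    then show "cmod (\<sigma> i / \<tau> i) \<le> 1"
      using assms(2)[of i] by (cases "\<tau> i = 0") (auto simp: norm_divide)
  qed
  finally show ?thesis .
qed

lemma mem_Ualpha:
  "pt u w \<in> Ualpha \<alpha> Z \<Omega> \<longleftrightarrow> norm w < 1 \<and> zscale Z (\<lambda>i. of_real ((1 - (norm w)\<^sup>2) powr (- (\<alpha> i / 2)))) u \<in> \<Omega>"
  by (auto simp: Ualpha_def falpha_eq_zscale)

lemma mem_Ueta: "norm \<eta> < 1 \<Longrightarrow>
    u \<in> Ueta \<alpha> Z \<Omega> \<eta> \<longleftrightarrow> zscale Z (\<lambda>i. of_real ((1 - (norm \<eta>)\<^sup>2) powr (- (\<alpha> i / 2)))) u \<in> \<Omega>"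
  by (simp add: Ueta_def mem_Ualpha)

lemma open_Ualpha: "open (Ualpha \<alpha> Z \<Omega> :: (complex^('d + 'k::finite)) set)"
proof -
  let ?B = "{p :: complex^('d + 'k). norm (wpart p) < 1}"
  let ?f = "\<lambda>p :: complex^('d + 'k). zscale Z (\<lambda>i. of_real ((1 - (norm (wpart p))\<^sup>2) powr (- (\<alpha> i / 2)))) (zpart p)"
  have B: "open ?B" by (intro open_Collect_less continuous_intros)
  have "continuous_on ?B ?f"
    using norm_less_1_square by (intro continuous_intros) (auto, force)
  then have "open (?B \<inter> ?f -` \<Omega>)"
    by (rule continuous_open_preimage[OF _ B open_\<Omega>])
  also have "?B \<inter> ?f -` \<Omega> = Ualpha \<alpha> Z \<Omega>"
    by (auto simp: Ualpha_def falpha_eq_zscale)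
  finally show ?thesis .
qed

text \<open>Stated for general factors and a general new ball point because it serves two purposes:
  shrinking, and the automorphisms, for which the two sides of the last hypothesis coincide.\<close>

lemma Ualpha_mono:
  assumes "pt u w \<in> Ualpha \<alpha> Z \<Omega>" "norm w' < 1"
    "\<And>i. i \<in> Z \<Longrightarrow> cmod (\<sigma> i) * (1 - (norm w)\<^sup>2) powr (\<alpha> i / 2) \<le> (1 - (norm w')\<^sup>2) powr (\<alpha> i / 2)"
  shows "pt (zscale Z \<sigma> u) w' \<in> Ualpha \<alpha> Z \<Omega>"
proof -
  have w: "norm w < 1" "zscale Z (\<lambda>i. of_real ((1 - (norm w)\<^sup>2) powr (- (\<alpha> i / 2)))) u \<in> \<Omega>"
    using assms(1) by (auto simp: mem_Ualpha)
  have "zscale Z (\<lambda>i. of_real ((1 - (norm w')\<^sup>2) powr (- (\<alpha> i / 2))) * \<sigma> i) u \<in> \<Omega>"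
  proof (rule zscale_mono[OF w(2)])
    fix i assume "i \<in> Z"
    then show "cmod (of_real ((1 - (norm w')\<^sup>2) powr (- (\<alpha> i / 2))) * \<sigma> i)
        \<le> cmod (of_real ((1 - (norm w)\<^sup>2) powr (- (\<alpha> i / 2))))"
      using assms(3)[of i] norm_less_1_square[OF w(1)] norm_less_1_square[OF assms(2)]
      by (simp add: norm_mult norm_inverse powr_minus) (simp add: field_simps)
  qed
  then show ?thesis using assms(2) by (simp add: mem_Ualpha zscale_zscale)
qed

lemma Ualpha_shrink:
  assumes "pt u w \<in> Ualpha \<alpha> Z \<Omega>" "norm w' \<le> norm w" "\<And>i. i \<in> Z \<Longrightarrow> cmod (\<sigma> i) \<le> 1"
  shows "pt (zscale Z \<sigma> u) w' \<in> Ualpha \<alpha> Z \<Omega>"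
proof (rule Ualpha_mono[OF assms(1)])
  have w: "norm w < 1" using assms(1) by (auto simp: mem_Ualpha)
  show "norm w' < 1" using w assms(2) by simp
  fix i assume i: "i \<in> Z"
  have "cmod (\<sigma> i) * (1 - (norm w)\<^sup>2) powr (\<alpha> i / 2) \<le> 1 * (1 - (norm w)\<^sup>2) powr (\<alpha> i / 2)"
    using assms(3)[OF i] by (intro mult_right_mono) auto
  also have "\<dots> \<le> (1 - (norm w')\<^sup>2) powr (\<alpha> i / 2)"
    using alpha_pos[OF i] norm_less_1_square[OF w] assms(2) power_mono[OF assms(2)]
    by (simp add: powr_mono2)
  finally show "cmod (\<sigma> i) * (1 - (norm w)\<^sup>2) powr (\<alpha> i / 2) \<le> (1 - (norm w')\<^sup>2) powr (\<alpha> i / 2)" .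
qed

lemma Ualpha_shrink_w:
  "pt u w \<in> Ualpha \<alpha> Z \<Omega> \<Longrightarrow> norm w' \<le> norm w \<Longrightarrow> pt u w' \<in> Ualpha \<alpha> Z \<Omega>"
  using Ualpha_shrink[of u w w' "\<lambda>_. 1"] by (simp add: zscale_1)

lemma mem_Ualpha_0: "pt u 0 \<in> Ualpha \<alpha> Z \<Omega> \<longleftrightarrow> u \<in> \<Omega>"
  by (simp add: mem_Ualpha zscale_1)

lemma Ueta_0: "Ueta \<alpha> Z \<Omega> 0 = \<Omega>"
  by (auto simp: Ueta_def mem_Ualpha_0)

text \<open>Rotating w fixes the points with w-part 0, so the kernel is constant on circles around 0.\<close>

lemma kernel_independent_of_w:
  fixes w :: "complex^'k::finite"
  assumes K: "is_bergman_kernel (Ualpha \<alpha> Z \<Omega>) K"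
    and z: "pt z w \<in> Ualpha \<alpha> Z \<Omega>" and v: "v \<in> \<Omega>"
  shows "K (pt z w) (pt v 0) = K (pt z 0) (pt v 0)"
proof -
  let ?U = "Ualpha \<alpha> Z \<Omega> :: (complex^('d + 'k)) set"
  \<comment> \<open>With a number t the set contains every number of at most the same modulus. Being
    open and containing 1, it is a disc about 0 or the plane, and it contains the closed unit
    disc.\<close>
  define A where "A = {t. pt z (t *s w) \<in> ?U}"
  have v': "pt v 0 \<in> ?U" using v by (simp add: mem_Ualpha_0)
  have shrink: "s \<in> A" if "t \<in> A" "cmod s \<le> cmod t" for s t
    using that unfolding A_def mem_Collect_eq
    by (elim Ualpha_shrink_w) (simp add: norm_vec_scalar_mult mult_right_mono)
  have 1: "1 \<in> A" using z by (simp add: A_def)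
  have opA: "open A"
  proof -
    have "continuous_on UNIV (\<lambda>t. pt z (t *s w))"
      unfolding vector_scalar_mult_def by (intro continuous_intros)
    then have "open ((\<lambda>t. pt z (t *s w)) -` ?U)"
      using open_Ualpha by (rule open_vimage[rotated])
    then show ?thesis by (simp add: A_def vimage_def)
  qed
  have conA: "connected A"
  proof (rule starlike_imp_connected)
    have "closed_segment 0 x \<subseteq> A" if "x \<in> A" for x
    proof
      fix y assume "y \<in> closed_segment 0 x"
      then obtain s where "0 \<le> s" "s \<le> 1" "y = s *\<^sub>R x" by (auto simp: in_segment)
      then show "y \<in> A" by (intro shrink[OF that]) (simp add: mult_left_le_one_le)
    qed
    then show "starlike A"
      unfolding starlike_def using shrink[OF 1, of 0] by auto
  qed
  have sphere: "sphere 0 1 \<subseteq> A" using shrink[OF 1] by auto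
  \<comment> \<open>The reference value is the one at t = 1. The difference vanishes on the unit
    circle, which accumulates at 1, and hence also at t = 0.\<close>
  have "K (pt z (0 *s w)) (pt v 0) - K (pt z w) (pt v 0) = 0"
  proof (rule analytic_continuation[where f="\<lambda>t. K (pt z (t *s w)) (pt v 0) - K (pt z w) (pt v 0)"
        and S=A and U="sphere 0 1" and \<xi>=1])
    have "holo_on ?U (\<lambda>p. K p (pt v 0))"
      using K v' by (auto simp: is_bergman_kernel_def bergman_space_def)
    then have "(\<lambda>t. K (pt z (t *s w)) (pt v 0)) holomorphic_on A"
    proof (rule holo_on_curve[OF _ opA])
      show "(\<lambda>s. pt z (s *s w) $ l) holomorphic_on A" for l
        by (cases l) (auto intro!: holomorphic_intros)
    qed (simp add: A_def)
    then show "(\<lambda>t. K (pt z (t *s w)) (pt v 0) - K (pt z w) (pt v 0)) holomorphic_on A"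
      by (intro holomorphic_intros)
    show "1 islimpt sphere (0::complex) 1"
    proof (rule connected_imp_perfect)
      show "connected (sphere (0::complex) 1)" by (rule connected_sphere) simp
      show "sphere (0::complex) 1 \<noteq> {x}" for x
      proof
        assume "sphere (0::complex) 1 = {x}"
        moreover have "1 \<in> sphere (0::complex) 1" "-1 \<in> sphere (0::complex) 1" by auto
        ultimately have "-1 = x" "1 = x" by (metis singletonD)+
        then show False by simp
      qed
    qed auto
    show "K (pt z (t *s w)) (pt v 0) - K (pt z w) (pt v 0) = 0" if t: "t \<in> sphere 0 1" for t
    proof -
      define c where "c i = (case i of Inl (_::'d) \<Rightarrow> 1 | Inr (_::'k) \<Rightarrow> t)" for i
      have nt: "cmod t = 1" using t by simp
      have c: "cmod (c i) = 1" for i using nt by (simp add: c_def split: sum.split)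
      then have c0: "c i \<noteq> 0" for i by (metis norm_zero zero_neq_one)
      have cpt: "(\<chi> i. c i * pt a b $ i) = pt a (t *s b)" for a b
        by (simp add: vec_eq_iff c_def pt_def split: sum.split)
      have nw: "norm (t *s b) = norm b" for b :: "complex^'k"
        using nt by (simp add: norm_vec_def norm_mult)
      have cU: "p \<in> ?U \<longleftrightarrow> (\<chi> i. c i * p$i) \<in> ?U" for p
        using cpt[of "zpart p" "wpart p"] nw mem_Ualpha[of "zpart p" "wpart p"] mem_Ualpha[of "zpart p" "t *s wpart p"] by simp
      have "cmod (\<Prod>i\<in>UNIV. c i) = 1" using c by (simp add: prod_norm[symmetric])
      then have "K (pt z w) (pt v 0) = K (pt z (t *s w)) (pt v (t *s 0))"
        using bergman_kernel_diagonal[OF open_Ualpha open_Ualpha c0 cU K K z v'] by (simp add: cpt)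
      then show ?thesis by simp
    qed
  qed (use 1 opA conA sphere shrink[OF 1, of 0] in auto)
  then show ?thesis by simp
qed

text \<open>At r = 0 the convention \<open>0 powr a = 0\<close> sets the coordinates in
  \<open>Z\<close> to 0, which is the limit as r decreases to 0 since the exponents are positive.
  The orbit is therefore continuous on the closed interval [0,1].\<close>

definition dilate :: "real \<Rightarrow> complex^'d \<Rightarrow> complex^'d" where
  "dilate r = zscale Z (\<lambda>i. of_real (r powr \<alpha> i))"

lemma dilate_in: "u \<in> \<Omega> \<Longrightarrow> 0 \<le> r \<Longrightarrow> r \<le> 1 \<Longrightarrow> dilate r u \<in> \<Omega>"
  unfolding dilate_def using alpha_pos by (rule_tac zscale_in) (auto simp: powr_le1 less_imp_le)

lemma kernel_dilate_symmetric:
  assumes K: "is_bergman_kernel \<Omega> K" and z: "z \<in> \<Omega>" and v: "v \<in> \<Omega>" and r: "0 < r" "r \<le> 1"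
  shows "K (dilate r z) v = K z (dilate r v)"
proof -
  \<comment> \<open>The dilation by exp \<zeta>. As the exponents need not be integers, the orbit is
    parametrised by the logarithm, in which all its coordinates are entire.\<close>
  define E where "E \<zeta> = zscale Z (\<lambda>i. exp (of_real (\<alpha> i) * \<zeta>))" for \<zeta>
  define A where "A u = {\<zeta>. E \<zeta> u \<in> \<Omega>}" for u
  \<comment> \<open>\<open>A u\<close> is closed under moving to the left, so it is a left
    half-plane, the whole plane or empty. Convexity and invariance under conjugation follow.\<close>
  have down: "\<xi> \<in> A u" if "\<zeta> \<in> A u" "Re \<xi> \<le> Re \<zeta>" for \<xi> \<zeta> u
    using that unfolding A_def mem_Collect_eq E_def
    by (elim zscale_mono) (use alpha_pos in \<open>auto simp: less_imp_le mult_left_mono\<close>)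
  have in_A: "\<zeta> \<in> A u" if "u \<in> \<Omega>" "Re \<zeta> \<le> 0" for u \<zeta>
    by (rule down[of 0]) (use that in \<open>auto simp: A_def E_def zscale_1\<close>)
  have opA: "open (A u)" for u
  proof -
    have "continuous_on UNIV (\<lambda>\<zeta>. E \<zeta> u)" unfolding E_def by (intro continuous_intros)
    then have "open ((\<lambda>\<zeta>. E \<zeta> u) -` \<Omega>)" using open_\<Omega> by (rule open_vimage[rotated])
    then show ?thesis by (simp add: A_def vimage_def)
  qed
  have cnjA: "cnj \<zeta> \<in> A u \<longleftrightarrow> \<zeta> \<in> A u" for \<zeta> u
    using down[of \<zeta> u "cnj \<zeta>"] down[of "cnj \<zeta>" u \<zeta>] by auto
  have convA: "convex (A u)" for u
  proof (rule convexI)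
    fix x y :: complex and a b :: real
    assume *: "x \<in> A u" "y \<in> A u" "0 \<le> a" "0 \<le> b" "a + b = 1"
    then have "Re (a *\<^sub>R x + b *\<^sub>R y) \<le> max (Re x) (Re y)"
      using convex_bound_le[of "Re x" "max (Re x) (Re y)" "Re y" a b] by simp
    then show "a *\<^sub>R x + b *\<^sub>R y \<in> A u"
      using *(1,2) by (cases "Re x \<le> Re y") (auto intro: down)
  qed
  have hol: "(\<lambda>\<zeta>. K (E \<zeta> a) b) holomorphic_on A a" if "b \<in> \<Omega>" for a b
  proof (rule holo_on_curve[OF _ opA])
    show "holo_on \<Omega> (\<lambda>p. K p b)"
      using K that by (auto simp: is_bergman_kernel_def bergman_space_def)
    show "(\<lambda>s. E s a $ l) holomorphic_on A a" for l
      by (cases "l \<in> Z") (auto simp: E_def zscale_nth intro!: holomorphic_intros)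
  qed (simp add: A_def)
  have rot: "K (E (\<i> * of_real \<theta>) p) (E (\<i> * of_real \<theta>) q) = K p q" if "p \<in> \<Omega>" "q \<in> \<Omega>" for p q \<theta>
  proof -
    let ?c = "\<lambda>i. if i \<in> Z then exp (of_real (\<alpha> i) * (\<i> * of_real \<theta>)) else 1"
    have n: "cmod (?c i) = 1" for i by simp
    have "p \<in> \<Omega> \<longleftrightarrow> (\<chi> i. ?c i * p$i) \<in> \<Omega>" for p
    proof -
      have "E (- \<i> * of_real \<theta>) (E (\<i> * of_real \<theta>) p) = p"
        unfolding E_def zscale_zscale by (rule zscale_1) (simp flip: exp_add)
      moreover have "E (\<i> * of_real \<theta>) p = (\<chi> i. ?c i * p$i)" by (simp add: E_def zscale_eq)
      ultimately show ?thesis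
        using in_A[of p "\<i> * of_real \<theta>"] in_A[of "E (\<i> * of_real \<theta>) p" "- \<i> * of_real \<theta>"]
        by (auto simp: A_def)
    qed
    from bergman_kernel_diagonal[OF open_\<Omega> open_\<Omega> _ this K K that]
    have "K p q = of_real ((cmod (\<Prod>i\<in>UNIV. ?c i))\<^sup>2) * K (\<chi> i. ?c i * p$i) (\<chi> i. ?c i * q$i)"
      by simp
    moreover have "cmod (\<Prod>i\<in>UNIV. ?c i) = 1" by (simp only: prod_norm[symmetric] n) simp
    ultimately show ?thesis by (simp add: E_def zscale_eq)
  qed
  \<comment> \<open>The second term is \<open>K z (E (cnj \<zeta>) v)\<close> rewritten by Hermitian
    symmetry. The kernel is antiholomorphic in its second argument, and conjugating the parameter
    makes the term holomorphic.\<close>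
  let ?\<phi> = "\<lambda>\<zeta>. K (E \<zeta> z) v - cnj (K (E (cnj \<zeta>) v) z)"
  have "?\<phi> (of_real (ln r)) = 0"
  proof (rule analytic_continuation[where f="?\<phi>" and S="A z \<inter> A v" and U="{\<zeta>. Re \<zeta> = 0}" and \<xi>=0])
    have "cnj ` A v = A v" using cnjA by (force simp: image_iff)
    then have "(\<lambda>\<zeta>. cnj (K (E (cnj \<zeta>) v) z)) holomorphic_on A v"
      using holomorphic_on_compose_cnj_cnj[of "\<lambda>\<zeta>. K (E \<zeta> v) z" "A v"] hol[OF z, of v] opA
      by (simp add: o_def)
    then show "?\<phi> holomorphic_on A z \<inter> A v"
      using hol[OF v, of z] by (intro holomorphic_intros) (auto elim: holomorphic_on_subset)
    show "0 islimpt {\<zeta>. Re \<zeta> = 0}"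
    proof (rule connected_imp_perfect)
      have "convex {\<zeta>. Re \<zeta> = 0}" by (rule convexI) auto
      then show "connected {\<zeta>. Re \<zeta> = 0}" by (rule convex_connected)
      show "{\<zeta>. Re \<zeta> = 0} \<noteq> {x}" for x
      proof
        assume "{\<zeta>. Re \<zeta> = 0} = {x}"
        moreover have "0 \<in> {\<zeta>. Re \<zeta> = 0}" "\<i> \<in> {\<zeta>. Re \<zeta> = 0}" by auto
        ultimately have "\<i> = x" "0 = x" by (metis singletonD)+
        then show False by simp
      qed
    qed auto
    show "connected (A z \<inter> A v)" by (intro convex_connected convex_Int convA)
    show "?\<phi> \<zeta> = 0" if "\<zeta> \<in> {\<zeta>. Re \<zeta> = 0}" for \<zeta>
    proof -
      have \<zeta>: "\<zeta> = \<i> * of_real (Im \<zeta>)" "cnj \<zeta> = - \<zeta>"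
        using that by (auto simp: complex_eq_iff)
      have ev: "E (- \<zeta>) v \<in> \<Omega>" using in_A[OF v, of "- \<zeta>"] that by (simp add: A_def)
      \<comment> \<open>On the imaginary axis \<open>cnj \<zeta> = - \<zeta>\<close>, and rotation
        invariance moves a rotation to the other argument as its inverse.\<close>
      have "E \<zeta> (E (- \<zeta>) v) = v"
        unfolding E_def zscale_zscale by (rule zscale_1) (simp flip: exp_add)
      then have "K z (E (- \<zeta>) v) = K (E \<zeta> z) v"
        using rot[OF z ev, of "Im \<zeta>"] \<zeta>(1) by simp
      then show ?thesis
        using bergman_kernel_hermitian[OF K ev z] \<zeta>(2) by simp
    qed
    show "{\<zeta>. Re \<zeta> = 0} \<subseteq> A z \<inter> A v" using in_A z v by auto
    show "complex_of_real (ln r) \<in> A z \<inter> A v" "0 \<in> A z \<inter> A v" using in_A z v r by auto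
  qed (use opA in auto)
  moreover have "E (of_real (ln r)) = dilate r"
    using r by (auto simp: E_def dilate_def fun_eq_iff powr_def mult.commute exp_of_real simp flip: of_real_mult intro!: zscale_cong)
  moreover have "dilate r v \<in> \<Omega>" using dilate_in[OF v] r by simp
  ultimately show ?thesis
    using bergman_kernel_hermitian[OF K _ z, of "dilate r v"] by simp
qed

end

subsection \<open>The kernel at the centre of the ball\<close>

lemma bergman_kernel_in_space: "is_bergman_kernel D K \<Longrightarrow> w \<in> D \<Longrightarrow> (\<lambda>z. K z w) \<in> bergman_space D"
  by (simp add: is_bergman_kernel_def)

lemma bergman_kernel_reproduces:
  "is_bergman_kernel D K \<Longrightarrow> w \<in> D \<Longrightarrow> f \<in> bergman_space D \<Longrightarrow>
    f w = (LINT z:D|lborel. f z * cnj (K z w))"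
  by (simp add: is_bergman_kernel_def)

lemma holo_on_zpart: "holo_on S f \<Longrightarrow> (\<And>p. p \<in> T \<Longrightarrow> zpart p \<in> S) \<Longrightarrow> holo_on T (\<lambda>p. f (zpart p))"
  by (rule holo_on_compose_vec) (auto simp: zpart_def holo_on_nth)

lemma holo_on_pt: 
  fixes f :: "complex^('d::finite + 'k::finite) \<Rightarrow> complex"
  assumes "holo_on S f" "\<And>u. u \<in> T \<Longrightarrow> pt u w \<in> S"
  shows "holo_on T (\<lambda>u. f (pt u w))"
proof (rule holo_on_compose_vec[OF _ assms])
  show "holo_on T (\<lambda>p. pt p w $ l)" for l
    by (cases l) (auto intro: holo_on_nth holo_on_const)
qed

lemma holo_on_zscale:
  assumes "holo_on S f" "\<And>u. u \<in> T \<Longrightarrow> zscale Z \<sigma> u \<in> S"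
  shows "holo_on T (\<lambda>u. f (zscale Z \<sigma> u))"
  by (rule holo_on_compose_vec[OF _ assms]) (auto simp: zscale_nth intro!: holo_on_mult holo_on_const holo_on_nth)

lemma measurable_zpart: "zpart \<in> borel_measurable borel"
  unfolding zpart_def by measurable

lemma measurable_wpart: "wpart \<in> borel_measurable borel"
  unfolding wpart_def by measurable

lemma
  fixes f :: "complex^('d::finite + 'k::finite) \<Rightarrow> 'b::{banach, second_countable_topology}"
  assumes f: "f \<in> borel_measurable borel"
  shows integrable_lborel_pt: "integrable lborel f \<longleftrightarrow> integrable (lborel \<Otimes>\<^sub>M lborel) (\<lambda>(u, w). f (pt u w))"
    and integral_lborel_pt: "integral\<^sup>L lborel f = integral\<^sup>L (lborel \<Otimes>\<^sub>M lborel) (\<lambda>(u, w). f (pt u w))"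
proof -
  have m: "(\<lambda>(u, w). pt u w) \<in> borel_measurable (lborel \<Otimes>\<^sub>M lborel)"
    by (simp add: case_prod_unfold)
  show "integrable lborel f \<longleftrightarrow> integrable (lborel \<Otimes>\<^sub>M lborel) (\<lambda>(u, w). f (pt u w))"
    unfolding lborel_pt_eq_distr using integrable_distr_eq[OF m f] by (simp add: case_prod_unfold)
  show "integral\<^sup>L lborel f = integral\<^sup>L (lborel \<Otimes>\<^sub>M lborel) (\<lambda>(u, w). f (pt u w))"
    unfolding lborel_pt_eq_distr using integral_distr[OF m f] by (simp add: case_prod_unfold)
qed

text \<open>U lies in the product of \<open>\<Omega>\<close> with the unit ball, which has finite
  volume. This is what puts K_\<Omega>(.,x), extended constantly in w, into the Bergman space of
  U.\<close>

lemma set_integrable_zpart: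
  fixes g :: "complex^'d \<Rightarrow> real" and U :: "(complex^('d::finite + 'k::finite)) set"
  assumes g: "set_integrable lborel \<Omega> g" and U: "U \<in> sets borel" and \<Omega>: "\<Omega> \<in> sets borel"
    and sub: "\<And>p. p \<in> U \<Longrightarrow> zpart p \<in> \<Omega> \<and> norm (wpart p) < 1"
  shows "set_integrable lborel U (\<lambda>p. g (zpart p))"
proof -
  define h where "h u = indicator \<Omega> u *\<^sub>R g u" for u
  have h: "integrable lborel h" using g unfolding set_integrable_def h_def .
  then have hm [measurable]: "h \<in> borel_measurable borel" by simp
  let ?f = "\<lambda>q :: (complex^'d) \<times> (complex^'k). h (fst q) * indicator (ball 0 1) (snd q)"
  have ib: "integrable lborel (indicator (ball 0 1) :: complex^'k \<Rightarrow> real)"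
    using emeasure_lborel_ball_finite by (intro integrable_real_indicator) auto
  have "integrable (lborel \<Otimes>\<^sub>M lborel) ?f"
  proof (rule lborel_pair.Fubini_integrable)
    have "(\<lambda>q. indicator (ball 0 1) (snd q) :: real) \<in> borel_measurable (lborel \<Otimes>\<^sub>M (lborel :: (complex^'k) measure))"
      by (rule measurable_compose[OF measurable_snd borel_measurable_indicator]) simp
    moreover have "(\<lambda>q. h (fst q)) \<in> borel_measurable (lborel \<Otimes>\<^sub>M (lborel :: (complex^'k) measure))"
      by (rule measurable_compose[OF measurable_fst]) simp
    ultimately show "?f \<in> borel_measurable (lborel \<Otimes>\<^sub>M lborel)" by (intro borel_measurable_times)
    show "integrable lborel (\<lambda>x. LINT y|lborel. norm (?f (x, y)))"
      using h by (simp add: abs_mult)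
    show "AE x in lborel. integrable lborel (\<lambda>y. ?f (x, y))"
      using ib by (auto intro!: AE_I2 Bochner_Integration.integrable_mult_right)
  qed
  moreover have m: "(\<lambda>p :: complex^('d+'k). h (zpart p) * indicator (ball 0 1) (wpart p)) \<in> borel_measurable borel"
    by (intro borel_measurable_times measurable_compose[OF measurable_zpart hm]
        measurable_compose[OF measurable_wpart borel_measurable_indicator]) simp
  ultimately have int: "integrable lborel (\<lambda>p :: complex^('d+'k). h (zpart p) * indicator (ball 0 1) (wpart p))"
    by (simp add: integrable_lborel_pt[OF m] case_prod_unfold)
  have e: "indicator U p *\<^sub>R g (zpart p) = indicator U p * h (zpart p)" for p
    using sub[of p] by (auto simp: h_def indicator_def)
  show ?thesis
    unfolding set_integrable_def e
  proof (rule Bochner_Integration.integrable_bound[OF int])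
    show "(\<lambda>p. indicator U p * h (zpart p)) \<in> borel_measurable lborel"
      using U measurable_compose[OF measurable_zpart hm] by (intro borel_measurable_times) auto
    show "AE p in lborel. norm (indicator U p * h (zpart p)) \<le> norm (h (zpart p) * indicator (ball 0 1) (wpart p))"
      using sub by (auto intro!: AE_I2 simp: indicator_def)
  qed
qed

section \<open>The integral equation between the kernel of U and that of its base\<close>

context hartogs_domain begin

lemma dilate_dilate: "0 \<le> r \<Longrightarrow> 0 \<le> s \<Longrightarrow> dilate r (dilate s u) = dilate (r * s) u"
  by (auto simp: dilate_def zscale_zscale powr_mult intro!: zscale_cong)

lemma dilate_1 [simp]: "dilate 1 u = u"
  by (simp add: dilate_def zscale_1)

lemma mem_Ualpha_dilate:
  assumes "norm w < 1"
  shows "pt (dilate (sqrt (1 - (norm w)\<^sup>2)) u) w \<in> Ualpha \<alpha> Z \<Omega> \<longleftrightarrow> u \<in> \<Omega>"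
proof -
  have s: "0 < 1 - (norm w)\<^sup>2" by (rule norm_less_1_square[OF assms])
  have "zscale Z (\<lambda>i. of_real ((1 - (norm w)\<^sup>2) powr (- (\<alpha> i / 2)))) (dilate (sqrt (1 - (norm w)\<^sup>2)) u) = u"
    unfolding dilate_def zscale_zscale
    using s by (intro zscale_1) (simp add: powr_half_sqrt[symmetric] powr_powr flip: of_real_mult powr_add)
  then show ?thesis using assms by (simp add: mem_Ualpha)
qed

lemma Ualpha_zpart: "pt u w \<in> Ualpha \<alpha> Z \<Omega> \<Longrightarrow> u \<in> \<Omega>"
  using Ualpha_shrink_w[of u w 0] by (simp add: mem_Ualpha_0)

text \<open>Rescaling the slice over w to \<open>\<Omega>\<close> composes both factors of the
  integrand with T_(sqrt s). \<open>kernel_dilate_symmetric\<close> shifts this dilation inside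
  K_\<Omega> onto x, so the reproducing property evaluates the other factor, already composed with
  T_(sqrt s), at T_(sqrt s) x. Together this is T_s x.\<close>

lemma kernel_base_integral:
  fixes KU :: "complex^('d + 'k::finite) \<Rightarrow> complex^('d + 'k) \<Rightarrow> complex"
  assumes KU: "is_bergman_kernel (Ualpha \<alpha> Z \<Omega>) KU" and K0: "is_bergman_kernel \<Omega> K0"
    and x: "x \<in> \<Omega>" and v: "v \<in> \<Omega>"
  shows "K0 x v = (LINT w:ball 0 1|(lborel :: (complex^'k) measure).
     (1 - (norm w)\<^sup>2) powr (\<Sum>j\<in>Z. \<alpha> j) *\<^sub>R KU (pt (dilate (1 - (norm w)\<^sup>2) x) 0) (pt v 0))"
proof -
  let ?U = "Ualpha \<alpha> Z \<Omega> :: (complex^('d + 'k)) set"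
  define k where "k p = KU p (pt v 0)" for p
  define \<kappa> where "\<kappa> u = k (pt u 0)" for u
  define F where "F p = K0 (zpart p) x" for p :: "complex^('d + 'k)"
  have opU: "open ?U" by (rule open_Ualpha)
  have [measurable]: "?U \<in> sets borel" "\<Omega> \<in> sets borel" using opU open_\<Omega> by auto
  have v0: "pt v 0 \<in> ?U" using v by (simp add: mem_Ualpha_0)
  have k: "k \<in> bergman_space ?U"
    unfolding k_def by (rule bergman_kernel_in_space[OF KU v0])
  have kh: "holo_on ?U k" and kint: "set_integrable lborel ?U (\<lambda>p. (cmod (k p))\<^sup>2)"
    using k by (auto simp: bergman_space_def)
  have k_eq: "k (pt u w) = \<kappa> u" if "pt u w \<in> ?U" for u w
    using kernel_independent_of_w[OF KU that v] by (simp add: k_def \<kappa>_def)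
  have \<kappa>h: "holo_on \<Omega> \<kappa>"
    unfolding \<kappa>_def by (rule holo_on_pt[OF kh]) (simp add: mem_Ualpha_0)
  have K0x: "(\<lambda>u. K0 u y) \<in> bergman_space \<Omega>" if "y \<in> \<Omega>" for y
    by (rule bergman_kernel_in_space[OF K0 that])
  then have K0h: "holo_on \<Omega> (\<lambda>u. K0 u y)" if "y \<in> \<Omega>" for y
    using that by (auto simp: bergman_space_def)
  have zU: "zpart p \<in> \<Omega>" "norm (wpart p) < 1" if "p \<in> ?U" for p
    using that Ualpha_zpart[of "zpart p" "wpart p"] mem_Ualpha[of "zpart p" "wpart p"] by auto
  have "set_integrable lborel ?U (\<lambda>p. (\<lambda>u. (cmod (K0 u x))\<^sup>2) (zpart p))"
    by (rule set_integrable_zpart[where \<Omega>=\<Omega>]) (use K0x[OF x] zU in \<open>auto simp: bergman_space_def\<close>)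
  then have F: "F \<in> bergman_space ?U"
    using holo_on_zpart[OF K0h[OF x] zU(1), of ?U] unfolding bergman_space_def F_def by simp
  define G where "G p = indicator ?U p *\<^sub>R (F p * cnj (k p))" for p
  have G: "integrable lborel G"
    using set_integrable_mult_cnj[OF opU F k] unfolding G_def set_integrable_def .
  then have Gm [measurable]: "G \<in> borel_measurable borel" by simp
  have G2: "integrable (lborel \<Otimes>\<^sub>M lborel) (\<lambda>(u, w). G (pt u w))"
    using G integrable_lborel_pt[OF Gm] by simp
  have kint2: "integrable (lborel \<Otimes>\<^sub>M lborel) (\<lambda>(u, w). indicator ?U (pt u w) *\<^sub>R (cmod (k (pt u w)))\<^sup>2)"
  proof -
    have i: "integrable lborel (\<lambda>p. indicator ?U p *\<^sub>R (cmod (k p))\<^sup>2)" using kint unfolding set_integrable_def .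
    then have "(\<lambda>p. indicator ?U p *\<^sub>R (cmod (k p))\<^sup>2) \<in> borel_measurable borel" by simp
    from integrable_lborel_pt[OF this] i show ?thesis by blast
  qed
  \<comment> \<open>Fubini grants a square-integrable slice of k for almost every w only. Hence this
    is a hypothesis here, discharged when the integrals over w are compared almost
    everywhere.\<close>
  have inner: "(LINT u|lborel. G (pt u w)) =
       indicator (ball 0 1) w *\<^sub>R ((1 - (norm w)\<^sup>2) powr (\<Sum>j\<in>Z. \<alpha> j) *\<^sub>R cnj (\<kappa> (dilate (1 - (norm w)\<^sup>2) x)))"
    if int: "integrable lborel (\<lambda>u. indicator ?U (pt u w) *\<^sub>R (cmod (k (pt u w)))\<^sup>2)" for w :: "complex^'k"
  proof (cases "norm w < 1")
    case False
    then have "G (pt u w) = 0" for u by (auto simp: G_def indicator_def mem_Ualpha)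
    then show ?thesis using False by simp
  next
    case True
    define s where "s = 1 - (norm w)\<^sup>2"
    define r where "r = sqrt s"
    have s: "0 < s" "s \<le> 1" using norm_less_1_square[OF True] by (auto simp: s_def)
    have r: "0 < r" "r \<le> 1" "r * r = s" using s by (auto simp: r_def)
    define D where "D = {u. pt u w \<in> ?U}"
    have D: "open D"
    proof -
      have "continuous_on UNIV (\<lambda>u. pt u w)" by (intro continuous_intros)
      then have "open ((\<lambda>u. pt u w) -` ?U)" using opU by (rule open_vimage[rotated])
      then show ?thesis by (simp add: D_def vimage_def)
    qed
    define c where "c i = (if i \<in> Z then complex_of_real (r powr \<alpha> i) else 1)" for i
    have c0: "c i \<noteq> 0" for i using r by (simp add: c_def)
    have cd: "(\<chi> i. c i * u$i) = dilate r u" for u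
      by (auto simp: c_def dilate_def zscale_nth vec_eq_iff)
    have memD: "u \<in> \<Omega> \<longleftrightarrow> dilate r u \<in> D" for u
      using mem_Ualpha_dilate[OF True, of u] by (simp add: D_def r_def s_def)
    \<comment> \<open>The real Jacobian is the squared modulus of the complex one, and r^2 = s, so
      the exponent of s is the plain sum.\<close>
    have cc: "(cmod (\<Prod>i\<in>UNIV. c i))\<^sup>2 = s powr (\<Sum>j\<in>Z. \<alpha> j)"
    proof -
      have "cmod (\<Prod>i\<in>UNIV. c i) = (\<Prod>i\<in>UNIV. if i \<in> Z then r powr \<alpha> i else 1)"
        using r by (simp add: prod_norm[symmetric] c_def if_distrib cong: if_cong)
      also have "\<dots> = (\<Prod>i\<in>Z. r powr \<alpha> i)" by (simp add: prod.If_cases)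
      also have "\<dots> = r powr (\<Sum>j\<in>Z. \<alpha> j)" using r by (simp add: powr_sum)
      finally show ?thesis using r s
        by (simp add: power2_eq_square powr_mult[symmetric])
    qed
    note cov = change_of_variables_set_integral[OF open_\<Omega> D, of "\<lambda>u. (\<chi> i. c i * u$i)" "\<lambda>_. \<Prod>i\<in>UNIV. c i",
        OF _ continuous_on_const _ nn_integral_diagonal_domain[OF D c0], unfolded cd, OF _ _ memD, unfolded cc]
    have cont_dilate: "continuous_on S (dilate r)" for S
      unfolding dilate_def by (intro continuous_intros)
    have h: "set_borel_measurable borel D g" if "continuous_on D g" for g :: "complex^'d \<Rightarrow> 'z::real_normed_vector"
      by (rule continuous_on_imp_set_borel_measurable[OF D that])
    have k\<kappa>: "k (pt u w) = \<kappa> u" if "u \<in> D" for u using k_eq that by (simp add: D_def)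
    have D\<Omega>: "D \<subseteq> \<Omega>" using Ualpha_zpart by (auto simp: D_def)
    have \<kappa>cont: "continuous_on D \<kappa>" using holo_on_imp_continuous_on[OF \<kappa>h] D\<Omega> by (rule continuous_on_subset)
    have K0cont: "continuous_on D (\<lambda>u. K0 u x)" using holo_on_imp_continuous_on[OF K0h[OF x]] D\<Omega> by (rule continuous_on_subset)
    have "set_integrable lborel D (\<lambda>u. (cmod (\<kappa> u))\<^sup>2)"
      using int unfolding set_integrable_def
      by (rule Bochner_Integration.integrable_cong[THEN iffD1, rotated 2]) (auto simp: D_def indicator_def k\<kappa>)
    moreover have "continuous_on D (\<lambda>u. (cmod (\<kappa> u))\<^sup>2)" using \<kappa>cont by (intro continuous_intros)
    ultimately have "set_integrable lborel \<Omega> (\<lambda>u. (s powr (\<Sum>j\<in>Z. \<alpha> j)) *\<^sub>R (cmod (\<kappa> (dilate r u)))\<^sup>2)"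
      using cov(1)[OF cont_dilate _ _ h, of "\<lambda>u. (cmod (\<kappa> u))\<^sup>2"] memD by auto
    then have "set_integrable lborel \<Omega> (\<lambda>u. (cmod (\<kappa> (dilate r u)))\<^sup>2)"
      using s by simp
    moreover have "holo_on \<Omega> (\<lambda>u. \<kappa> (dilate r u))"
      unfolding dilate_def by (rule holo_on_zscale[OF \<kappa>h]) (use dilate_in[OF _ less_imp_le[OF r(1)] r(2)] in \<open>simp add: dilate_def\<close>)
    ultimately have "(\<lambda>u. \<kappa> (dilate r u)) \<in> bergman_space \<Omega>" by (simp add: bergman_space_def)
    from bergman_kernel_reproduces[OF K0 dilate_in[OF x less_imp_le[OF r(1)] r(2)] this]
    have rep: "\<kappa> (dilate r (dilate r x)) = (LINT u:\<Omega>|lborel. \<kappa> (dilate r u) * cnj (K0 u (dilate r x)))" .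
    have "(LINT u|lborel. G (pt u w)) = (LINT u:D|lborel. K0 u x * cnj (\<kappa> u))"
      unfolding set_lebesgue_integral_def
      by (rule Bochner_Integration.integral_cong) (auto simp: G_def D_def indicator_def F_def k_eq)
    also have "\<dots> = (LINT u:\<Omega>|lborel. (s powr (\<Sum>j\<in>Z. \<alpha> j)) *\<^sub>R (K0 (dilate r u) x * cnj (\<kappa> (dilate r u))))"
      by (rule cov(2)[OF cont_dilate _ _ h]) (use memD \<kappa>cont K0cont in \<open>auto intro!: continuous_intros\<close>)
    also have "\<dots> = (LINT u:\<Omega>|lborel. (s powr (\<Sum>j\<in>Z. \<alpha> j)) *\<^sub>R cnj (\<kappa> (dilate r u) * cnj (K0 u (dilate r x))))"
      by (rule set_lebesgue_integral_cong) (use kernel_dilate_symmetric[OF K0 _ x r(1,2)] in \<open>auto simp: mult.commute\<close>)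
    also have "\<dots> = (s powr (\<Sum>j\<in>Z. \<alpha> j)) *\<^sub>R cnj (LINT u:\<Omega>|lborel. \<kappa> (dilate r u) * cnj (K0 u (dilate r x)))"
    proof -
      have "cnj (LINT u:\<Omega>|lborel. \<kappa> (dilate r u) * cnj (K0 u (dilate r x))) = (LINT u:\<Omega>|lborel. cnj (\<kappa> (dilate r u) * cnj (K0 u (dilate r x))))"
        unfolding set_lebesgue_integral_def Bochner_Integration.integral_cnj[symmetric] by simp
      then show ?thesis by (simp only: set_integral_scaleR_right)
    qed
    also have "\<dots> = (s powr (\<Sum>j\<in>Z. \<alpha> j)) *\<^sub>R cnj (\<kappa> (dilate s x))"
      unfolding rep[symmetric] using r by (simp add: dilate_dilate)
    finally show ?thesis using True by (simp add: s_def)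
  qed
  \<comment> \<open>The computation yields the kernel with its arguments exchanged, as the conjugate
    of the integral. Hermitian symmetry restores the order at the end.\<close>
  have "K0 v x = F (pt v 0)" by (simp add: F_def)
  also have "\<dots> = (LINT p:?U|lborel. F p * cnj (k p))"
    unfolding k_def by (rule bergman_kernel_reproduces[OF KU v0 F])
  also have "\<dots> = (LINT p|lborel. G p)" by (simp add: G_def set_lebesgue_integral_def)
  also have "\<dots> = integral\<^sup>L (lborel \<Otimes>\<^sub>M lborel) (\<lambda>(u, w). G (pt u w))"
    using integral_lborel_pt[OF Gm] by simp
  also have "\<dots> = (LINT w|lborel. LINT u|lborel. G (pt u w))"
    using lborel_pair.integral_snd[OF G2] by simp
  also have "\<dots> = (LINT w|(lborel :: (complex^'k) measure). indicator (ball 0 1) w *\<^sub>R ((1 - (norm w)\<^sup>2) powr (\<Sum>j\<in>Z. \<alpha> j) *\<^sub>R cnj (\<kappa> (dilate (1 - (norm w)\<^sup>2) x))))"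
  proof (rule Bochner_Integration.integral_cong_AE)
    show "AE w in (lborel :: (complex^'k) measure). (LINT u|lborel. G (pt u w)) =
       indicator (ball 0 1) w *\<^sub>R ((1 - (norm w)\<^sup>2) powr (\<Sum>j\<in>Z. \<alpha> j) *\<^sub>R cnj (\<kappa> (dilate (1 - (norm w)\<^sup>2) x)))"
      using lborel_pair.AE_integrable_snd[OF kint2] by eventually_elim (rule inner)
    show "(\<lambda>w :: complex^'k. LINT u|lborel. G (pt u w)) \<in> borel_measurable lborel"
      using lborel_pair.integrable_snd[OF G2] by (rule borel_measurable_integrable)
    have "continuous_on (ball 0 1) (\<lambda>w :: complex^'k. (1 - (norm w)\<^sup>2) powr (\<Sum>j\<in>Z. \<alpha> j) *\<^sub>R cnj (\<kappa> (dilate (1 - (norm w)\<^sup>2) x)))"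
    proof (intro continuous_intros continuous_on_compose2[OF holo_on_imp_continuous_on[OF \<kappa>h]])
      show "continuous_on (ball 0 1) (\<lambda>w :: complex^'k. dilate (1 - (norm w)\<^sup>2) x)"
        unfolding dilate_def using norm_less_1_square by (intro continuous_intros) (auto, force)
      show "(\<lambda>w :: complex^'k. dilate (1 - (norm w)\<^sup>2) x) ` ball 0 1 \<subseteq> \<Omega>"
      proof (rule image_subsetI)
        fix w :: "complex^'k" assume "w \<in> ball 0 1"
        then show "dilate (1 - (norm w)\<^sup>2) x \<in> \<Omega>"
          using norm_less_1_square[of w] by (intro dilate_in[OF x]) auto
      qed
    qed (use norm_less_1_square in force)
    from continuous_on_imp_set_borel_measurable[OF open_ball this]
    show "(\<lambda>w :: complex^'k. indicator (ball 0 1) w *\<^sub>R ((1 - (norm w)\<^sup>2) powr (\<Sum>j\<in>Z. \<alpha> j) *\<^sub>R cnj (\<kappa> (dilate (1 - (norm w)\<^sup>2) x)))) \<in> borel_measurable lborel"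
      unfolding set_borel_measurable_def measurable_lborel2 .
  qed
  also have "\<dots> = cnj (LINT w:ball 0 1|(lborel :: (complex^'k) measure). (1 - (norm w)\<^sup>2) powr (\<Sum>j\<in>Z. \<alpha> j) *\<^sub>R \<kappa> (dilate (1 - (norm w)\<^sup>2) x))"
    unfolding set_lebesgue_integral_def Bochner_Integration.integral_cnj[symmetric] by simp
  finally show ?thesis
    using bergman_kernel_hermitian[OF K0 v x] by (simp add: \<kappa>_def k_def)
qed

end

subsection \<open>Radial integrals and inversion of the Euler operator\<close>

text \<open>For x in [0,1] the set where 1 - |w|^2 > x is a ball of radius sqrt(1-x) in real
  dimension 2k, of volume pi^k (1-x)^k / k!. The density is minus the derivative of this
  volume.\<close>

lemma distr_ball_radial:
  fixes k :: nat
  defines "k \<equiv> CARD('k::finite)"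
  shows "distr (density lborel (\<lambda>w. ennreal (indicator (ball 0 1) w))) borel (\<lambda>w :: complex^'k. 1 - (norm w)\<^sup>2)
    = density lborel (\<lambda>s. ennreal (pi ^ k / fact (k - 1) * (1 - s) ^ (k - 1) * indicator {0..1} s))" (is "?M = ?N")
proof (rule measure_eqI_lessThan)
  have k: "k > 0" "Suc (k - 1) = k" by (auto simp: k_def)
  have nm [measurable]: "(\<lambda>w :: complex^'k. 1 - (norm w)\<^sup>2) \<in> borel_measurable borel" by measurable
  have M: "emeasure ?M {x<..} = ennreal (pi ^ k / fact k * (1 - min 1 (max 0 x)) ^ k)" for x
  proof -
    \<comment> \<open>Clipping x to [0,1] lets one formula cover all half-lines: below 0 the whole
      ball, above 1 the empty set.\<close>
    let ?y = "min 1 (max 0 x)"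
    have eq: "ball 0 1 \<inter> (\<lambda>w :: complex^'k. 1 - (norm w)\<^sup>2) -` {x<..} = ball 0 (sqrt (1 - ?y))"
    proof (rule set_eqI)
      fix w :: "complex^'k"
      define n where "n = (norm w)\<^sup>2"
      have "norm w < sqrt (1 - ?y) \<longleftrightarrow> n < 1 - ?y"
        using real_sqrt_less_iff[of "(norm w)\<^sup>2" "1 - ?y"] by (simp add: n_def)
      moreover have "norm w < 1 \<longleftrightarrow> n < 1"
        using real_sqrt_less_iff[of "(norm w)\<^sup>2" 1] by (simp add: n_def)
      moreover have "0 \<le> n" by (simp add: n_def)
      ultimately show "w \<in> ball 0 1 \<inter> (\<lambda>w :: complex^'k. 1 - (norm w)\<^sup>2) -` {x<..} \<longleftrightarrow> w \<in> ball 0 (sqrt (1 - ?y))"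
        by (auto simp: min_def max_def n_def[symmetric] split: if_splits)
    qed
    have "emeasure ?M {x<..} = (\<integral>\<^sup>+w. indicator (ball 0 1) w * indicator ((\<lambda>w :: complex^'k. 1 - (norm w)\<^sup>2) -` {x<..}) w \<partial>lborel)"
      using measurable_sets[OF nm, of "{x<..}"]
      by (subst emeasure_distr; (subst emeasure_density)?)
         (auto simp: ennreal_indicator intro!: borel_measurable_indicator)
    also have "\<dots> = (\<integral>\<^sup>+w. indicator (ball 0 (sqrt (1 - ?y)) :: (complex^'k) set) w \<partial>lborel)"
      unfolding eq[symmetric] indicator_inter_arith ..
    also have "\<dots> = emeasure lborel (ball 0 (sqrt (1 - ?y)) :: (complex^'k) set)"
      by simp
    also have "\<dots> = ennreal (unit_ball_vol (real (2 * k)) * sqrt (1 - ?y) ^ (2 * k))"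
      by (subst emeasure_ball) (simp_all add: k_def mult.commute)
    also have "sqrt (1 - ?y) ^ (2 * k) = (1 - ?y) ^ k"
      by (subst power_mult) simp
    finally show ?thesis by (simp only: unit_ball_vol_even)
  qed
  show "emeasure ?M {x<..} < \<infinity>" for x unfolding M by simp
  show "emeasure ?M {x<..} = emeasure ?N {x<..}" for x
  proof -
    let ?y = "min 1 (max 0 x)"
    have y: "0 \<le> ?y" "?y \<le> 1" by auto
    have "emeasure ?N {x<..} = (\<integral>\<^sup>+s. ennreal (pi ^ k / fact (k - 1) * (1 - s) ^ (k - 1) * indicator {0..1} s) * indicator {x<..} s \<partial>lborel)"
      by (subst emeasure_density) auto
    also have "\<dots> = (\<integral>\<^sup>+s. ennreal (pi ^ k / fact (k - 1) * (1 - s) ^ (k - 1)) * indicator {?y..1} s \<partial>lborel)"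
    proof (rule nn_integral_cong_AE)
      have "AE s in lborel. s \<noteq> x" "AE s in lborel. s \<noteq> 1" by (rule AE_lborel_singleton)+
      then show "AE s in lborel. ennreal (pi ^ k / fact (k - 1) * (1 - s) ^ (k - 1) * indicator {0..1} s) * indicator {x<..} s
         = ennreal (pi ^ k / fact (k - 1) * (1 - s) ^ (k - 1)) * indicator {?y..1} s"
        by eventually_elim (auto simp: indicator_def min_def max_def split: if_splits)
    qed
    also have "\<dots> = ennreal (- (pi ^ k / fact k * (1 - 1) ^ k) - (- (pi ^ k / fact k * (1 - ?y) ^ k)))"
    proof (rule nn_integral_FTC_Icc)
      have f: "fact k = real k * fact (k - 1)" using fact_reduce[OF k(1)] by simp
      show "((\<lambda>s. - (pi ^ k / fact k * (1 - s) ^ k)) has_real_derivative pi ^ k / fact (k - 1) * (1 - s) ^ (k - 1)) (at s)" for s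
      proof -
        have "((\<lambda>s. - (pi ^ k / fact k * (1 - s) ^ k)) has_real_derivative pi ^ k / fact k * (real k * (1 - s) ^ (k - 1))) (at s)"
          by (auto intro!: derivative_eq_intros)
        also have "pi ^ k / fact k * (real k * (1 - s) ^ (k - 1)) = pi ^ k / fact (k - 1) * (1 - s) ^ (k - 1)"
          using k(1) unfolding f by (simp add: field_simps)
        finally show ?thesis .
      qed
    qed (use y in auto)
    finally show ?thesis unfolding M using k(1) by (simp add: zero_power)
  qed
qed auto

lemma set_integral_ball_radial:
  fixes \<phi> :: "real \<Rightarrow> complex"
  assumes \<phi>: "continuous_on {0..1} \<phi>"
  shows "(LINT w:ball 0 1|(lborel :: (complex^'k::finite) measure). \<phi> (1 - (norm w)\<^sup>2))
     = (pi ^ CARD('k) / fact (CARD('k) - 1)) *\<^sub>R integral {0..1} (\<lambda>s. (1 - s) ^ (CARD('k) - 1) *\<^sub>R \<phi> s)"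
proof -
  let ?k = "CARD('k)"
  define g where "g s = indicator {0..1} s *\<^sub>R \<phi> s" for s
  have gm: "g \<in> borel_measurable borel"
    unfolding g_def by (rule borel_measurable_continuous_on_indicator) (use \<phi> in auto)
  have nm: "(\<lambda>w :: complex^'k. 1 - (norm w)\<^sup>2) \<in> density lborel (\<lambda>w. ennreal (indicator (ball 0 1) w)) \<rightarrow>\<^sub>M borel"
    by measurable
  have nm': "(\<lambda>w :: complex^'k. 1 - (norm w)\<^sup>2) \<in> lborel \<rightarrow>\<^sub>M borel"
    by measurable
  have "(LINT w:ball 0 1|(lborel :: (complex^'k::finite) measure). \<phi> (1 - (norm w)\<^sup>2))
      = (LINT w|(lborel :: (complex^'k::finite) measure). indicator (ball 0 1) w *\<^sub>R g (1 - (norm w)\<^sup>2))"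
    unfolding set_lebesgue_integral_def
    by (rule Bochner_Integration.integral_cong) (use norm_less_1_square in \<open>force simp: indicator_def g_def\<close>)+
  also have "\<dots> = integral\<^sup>L (density lborel (\<lambda>w. ennreal (indicator (ball 0 1) w))) (\<lambda>w :: complex^'k. g (1 - (norm w)\<^sup>2))"
    by (rule integral_density[symmetric], rule measurable_compose[OF nm' gm]) (auto intro!: borel_measurable_indicator)
  also have "\<dots> = integral\<^sup>L (distr (density lborel (\<lambda>w. ennreal (indicator (ball 0 1) w))) borel (\<lambda>w :: complex^'k. 1 - (norm w)\<^sup>2)) g"
    by (rule integral_distr[OF nm gm, symmetric])
  also have "\<dots> = integral\<^sup>L (density lborel (\<lambda>s. ennreal (pi ^ ?k / fact (?k - 1) * (1 - s) ^ (?k - 1) * indicator {0..1} s))) g"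
    unfolding distr_ball_radial ..
  also have "\<dots> = (LINT s|lborel. (pi ^ ?k / fact (?k - 1) * (1 - s) ^ (?k - 1) * indicator {0..1} s) *\<^sub>R g s)"
    by (rule integral_density) (use gm in \<open>auto simp: indicator_def\<close>)
  also have "\<dots> = (LINT s:{0..1}|lborel. (pi ^ ?k / fact (?k - 1)) *\<^sub>R ((1 - s) ^ (?k - 1) *\<^sub>R \<phi> s))"
    unfolding set_lebesgue_integral_def
    by (rule Bochner_Integration.integral_cong) (auto simp: indicator_def g_def)
  also have "\<dots> = integral {0..1} (\<lambda>s. (pi ^ ?k / fact (?k - 1)) *\<^sub>R ((1 - s) ^ (?k - 1) *\<^sub>R \<phi> s))"
    by (rule set_borel_integral_eq_integral(2), rule borel_integrable_atLeastAtMost')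
       (intro continuous_intros \<phi>)
  also have "\<dots> = (pi ^ ?k / fact (?k - 1)) *\<^sub>R integral {0..1} (\<lambda>s. (1 - s) ^ (?k - 1) *\<^sub>R \<phi> s)"
    by (rule integral_cmul)
  finally show ?thesis .
qed

text \<open>Here t sits both in the limit and in the integrand. Splitting one factor t - x off the
  power takes t out of the integral, which lowers the exponent but also replaces \<phi>(x) by x
  \<phi>(x); therefore the induction generalises over \<open>\<phi>\<close>.\<close>

lemma has_vector_derivative_convolution_power:
  fixes \<phi> :: "real \<Rightarrow> complex"
  assumes \<phi>: "continuous_on {0..1} \<phi>" and t: "t \<in> {0..1}"
  shows "((\<lambda>t. integral {0..t} (\<lambda>x. (t - x) ^ Suc m *\<^sub>R \<phi> x)) has_vector_derivative
     real (Suc m) *\<^sub>R integral {0..t} (\<lambda>x. (t - x) ^ m *\<^sub>R \<phi> x)) (at t within {0..1})"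
  using \<phi>
proof (induction m arbitrary: \<phi>)
  have int: "(\<lambda>x. (t - x) ^ m *\<^sub>R \<phi> x) integrable_on {0..t}" "(\<lambda>x. (t - x) ^ m *\<^sub>R (x *\<^sub>R \<phi> x)) integrable_on {0..t}"
    if "continuous_on {0..1} \<phi>" "t \<in> {0..1}" for m t and \<phi> :: "real \<Rightarrow> complex"
    using that by (auto intro!: integrable_continuous_real continuous_intros elim: continuous_on_subset)
  have rec: "integral {0..t} (\<lambda>x. (t - x) ^ Suc m *\<^sub>R \<phi> x) =
      t *\<^sub>R integral {0..t} (\<lambda>x. (t - x) ^ m *\<^sub>R \<phi> x) - integral {0..t} (\<lambda>x. (t - x) ^ m *\<^sub>R (x *\<^sub>R \<phi> x))"
    if "continuous_on {0..1} \<phi>" "t \<in> {0..1}" for m t and \<phi> :: "real \<Rightarrow> complex"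
  proof -
    have "t *\<^sub>R integral {0..t} (\<lambda>x. (t - x) ^ m *\<^sub>R \<phi> x) - integral {0..t} (\<lambda>x. (t - x) ^ m *\<^sub>R (x *\<^sub>R \<phi> x))
       = integral {0..t} (\<lambda>x. t *\<^sub>R ((t - x) ^ m *\<^sub>R \<phi> x) - (t - x) ^ m *\<^sub>R (x *\<^sub>R \<phi> x))"
      unfolding integral_diff[OF integrable_cmul[OF int(1)[OF that, of m]] int(2)[OF that, of m]] integral_cmul ..
    also have "\<dots> = integral {0..t} (\<lambda>x. (t - x) ^ Suc m *\<^sub>R \<phi> x)"
      by (rule integral_cong) (simp add: scaleR_conv_of_real algebra_simps)
    finally show ?thesis by simp
  qed
  {
    case 0
    have c1: "continuous_on {0..1} (\<lambda>x. x *\<^sub>R \<phi> x)" using 0 by (intro continuous_intros)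
    have "((\<lambda>t. t *\<^sub>R integral {0..t} \<phi> - integral {0..t} (\<lambda>x. x *\<^sub>R \<phi> x)) has_vector_derivative
        (t *\<^sub>R \<phi> t + 1 *\<^sub>R integral {0..t} \<phi>) - t *\<^sub>R \<phi> t) (at t within {0..1})"
      by (intro has_vector_derivative_diff has_vector_derivative_scaleR integral_has_vector_derivative 0 c1 t)
         (auto intro!: derivative_eq_intros)
    then have "((\<lambda>t. t *\<^sub>R integral {0..t} \<phi> - integral {0..t} (\<lambda>x. x *\<^sub>R \<phi> x)) has_vector_derivative
        integral {0..t} \<phi>) (at t within {0..1})" by simp
    from has_vector_derivative_transform[OF t _ this, of "\<lambda>t. integral {0..t} (\<lambda>x. (t - x) ^ Suc 0 *\<^sub>R \<phi> x)"]
    show ?case using rec[OF 0, of _ 0] by simp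
  next
    case (Suc m)
    have c1: "continuous_on {0..1} (\<lambda>x. x *\<^sub>R \<phi> x)" using Suc.prems by (intro continuous_intros)
    let ?F = "\<lambda>m \<phi> t. integral {0..t} (\<lambda>x. (t - x) ^ m *\<^sub>R \<phi> x)"
    have "((\<lambda>t. t *\<^sub>R ?F (Suc m) \<phi> t - ?F (Suc m) (\<lambda>x. x *\<^sub>R \<phi> x) t) has_vector_derivative
        (t *\<^sub>R (real (Suc m) *\<^sub>R ?F m \<phi> t) + 1 *\<^sub>R ?F (Suc m) \<phi> t) - real (Suc m) *\<^sub>R ?F m (\<lambda>x. x *\<^sub>R \<phi> x) t) (at t within {0..1})"
      by (intro has_vector_derivative_diff has_vector_derivative_scaleR Suc.IH[OF Suc.prems] Suc.IH[OF c1])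
         (auto intro!: derivative_eq_intros)
    also have "(t *\<^sub>R (real (Suc m) *\<^sub>R ?F m \<phi> t) + 1 *\<^sub>R ?F (Suc m) \<phi> t) - real (Suc m) *\<^sub>R ?F m (\<lambda>x. x *\<^sub>R \<phi> x) t
       = real (Suc m) *\<^sub>R (t *\<^sub>R ?F m \<phi> t - ?F m (\<lambda>x. x *\<^sub>R \<phi> x) t) + ?F (Suc m) \<phi> t"
      by (simp add: scaleR_conv_of_real algebra_simps)
    also have "\<dots> = real (Suc m) *\<^sub>R ?F (Suc m) \<phi> t + ?F (Suc m) \<phi> t"
      unfolding rec[OF Suc.prems t, symmetric] ..
    also have "\<dots> = real (Suc (Suc m)) *\<^sub>R ?F (Suc m) \<phi> t"
      by (simp add: scaleR_conv_of_real algebra_simps)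
    finally have "((\<lambda>t. t *\<^sub>R ?F (Suc m) \<phi> t - ?F (Suc m) (\<lambda>x. x *\<^sub>R \<phi> x) t) has_vector_derivative
        real (Suc (Suc m)) *\<^sub>R ?F (Suc m) \<phi> t) (at t within {0..1})" .
    from has_vector_derivative_transform[OF t _ this, of "\<lambda>t. ?F (Suc (Suc m)) \<phi> t"]
    show ?case using rec[OF Suc.prems, of _ "Suc m"] by blast
  }
qed

text \<open>Cauchy's estimate on complex lines bounds the second-order remainder by the sup norm alone; this
  makes the remainder uniform over families of functions.\<close>

lemma holo_remainder_bound:
  fixes f :: "complex^'n \<Rightarrow> complex"
  assumes f: "holo_on S f" and S: "ball x r \<subseteq> S" and r: "0 < r"
    and M: "\<And>y. y \<in> ball x r \<Longrightarrow> cmod (f y) < M"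
    and D: "(f has_derivative D) (at x)" "\<And>c v. D (c *s v) = c * D v"
    and h: "norm h \<le> r / 2"
  shows "cmod (f (x + h) - f x - D h) \<le> 32 * M / r\<^sup>2 * (norm h)\<^sup>2"
proof (cases "h = 0")
  case True
  have "D 0 = 0" using D(2)[of 0 0] by simp
  then show ?thesis using True by simp
next
  case False
  \<comment> \<open>On the complex line through x in direction h the ball becomes the disc of radius
    R, with x at 0 and x + h at 1.\<close>
  define R where "R = r / norm h"
  have hn: "norm h > 0" using False by simp
  have R: "R \<ge> 2" using h hn by (simp add: R_def field_simps)
  define \<phi> where "\<phi> t = f (x + t *s h)" for t
  have in_ball: "x + t *s h \<in> ball x r" if "t \<in> ball 0 R" for t
    using that hn by (simp add: dist_norm norm_vec_scalar_mult R_def field_simps)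
  have hol: "\<phi> holomorphic_on ball 0 R"
    unfolding \<phi>_def
  proof (rule holo_on_curve[OF f open_ball])
    show "(\<lambda>s. (x + s *s h) $ l) holomorphic_on ball 0 R" for l
      by (auto intro!: holomorphic_intros)
  qed (use in_ball S in blast)
  have "(\<phi> has_field_derivative D h) (at 0)"
    unfolding \<phi>_def by (rule holo_curve_derivative) (use D in \<open>auto intro!: derivative_eq_intros\<close>)
  then have d0: "deriv \<phi> 0 = D h" by (rule DERIV_imp_deriv)
  have sub: "cball z (R / 4) \<subseteq> ball 0 R" if "z \<in> cball 0 1" for z :: complex
  proof
    fix y assume "y \<in> cball z (R / 4)"
    then have "norm y \<le> norm z + R / 4"
      using norm_triangle_ineq[of z "y - z"] by (simp add: dist_norm norm_minus_commute)
    then show "y \<in> ball 0 R" using that R by simp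
  qed
  \<comment> \<open>Discs of radius R/4 centred in the closed unit disc stay inside radius R, since
    1 + R/4 < R for R at least 2. Cauchy's estimate on them bounds the second derivative by 2! M /
    (R/4)^2 = 32 M / R^2.\<close>
  have "cmod (\<phi> 1 - (\<Sum>i\<le>1. (deriv ^^ i) \<phi> 0 * (1 - 0) ^ i / fact i)) \<le> 32 * M / R\<^sup>2 * cmod (1 - 0) ^ Suc 1 / fact 1"
  proof (rule complex_Taylor[where S="cball 0 1" and f="\<lambda>i. (deriv ^^ i) \<phi>", simplified funpow_0])
    show "((deriv ^^ i) \<phi> has_field_derivative (deriv ^^ Suc i) \<phi> z) (at z within cball 0 1)"
      if "z \<in> cball 0 1" for i z
    proof -
      have "(deriv ^^ i) \<phi> holomorphic_on ball 0 R" by (rule holomorphic_higher_deriv[OF hol open_ball])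
      moreover have "z \<in> ball 0 R" using that R by simp
      ultimately show ?thesis
        using holomorphic_derivI[OF _ open_ball] by (auto intro: has_field_derivative_at_within)
    qed
    show "cmod ((deriv ^^ Suc 1) \<phi> z) \<le> 32 * M / R\<^sup>2" if z: "z \<in> cball 0 1" for z
    proof -
      have "cmod ((deriv ^^ 2) \<phi> z) \<le> fact 2 * M / (R / 4) ^ 2"
      proof (rule Cauchy_higher_deriv_bound[where y=0])
        show "\<phi> holomorphic_on ball z (R / 4)"
          using hol sub[OF z] ball_subset_cball by (blast intro: holomorphic_on_subset)
        show "continuous_on (cball z (R / 4)) \<phi>"
          using holomorphic_on_imp_continuous_on[OF hol] sub[OF z] by (rule continuous_on_subset)
        show "\<phi> w \<in> ball 0 M" if "w \<in> ball z (R / 4)" for w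
        proof -
          have "w \<in> cball z (R / 4)" using that by simp
          then have "w \<in> ball 0 R" using sub[OF z] by blast
          then show ?thesis using M[OF in_ball] by (simp add: \<phi>_def)
        qed
      qed (use R in auto)
      then show ?thesis by (simp add: power_divide numeral_2_eq_2 field_simps)
    qed
  qed auto
  then have "cmod (f (x + h) - f x - D h) \<le> 32 * M / R\<^sup>2"
    by (simp add: d0 \<phi>_def diff_diff_eq)
  also have "\<dots> = 32 * M / r\<^sup>2 * (norm h)\<^sup>2"
    by (simp add: R_def power_divide)
  finally show ?thesis .
qed

text \<open>Nothing is assumed about how the derivatives depend on s. Local boundedness makes the
  quadratic remainder uniform in s, so difference quotients converge uniformly and
  \<open>D s h\<close> is continuous in s. The same bound then shows that the integral of
  \<open>D s\<close> is the derivative.\<close>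

lemma holo_on_integral:
  fixes f :: "real \<Rightarrow> complex^'n \<Rightarrow> complex"
  assumes f: "\<And>s. s \<in> {0..1} \<Longrightarrow> holo_on S (f s)"
    and cont: "\<And>x. x \<in> S \<Longrightarrow> continuous_on {0..1} (\<lambda>s. f s x)"
    and bound: "\<And>x. x \<in> S \<Longrightarrow> \<exists>r>0. \<exists>M. ball x r \<subseteq> S \<and> (\<forall>s\<in>{0..1}. \<forall>y\<in>ball x r. cmod (f s y) < M)"
  shows "holo_on S (\<lambda>x. integral {0..1} (\<lambda>s. f s x))"
  unfolding holo_on_def
proof
  fix x assume x: "x \<in> S"
  obtain r M where r: "0 < r" and rS: "ball x r \<subseteq> S"
    and M: "\<And>s y. s \<in> {0..1} \<Longrightarrow> y \<in> ball x r \<Longrightarrow> cmod (f s y) < M"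
    using bound[OF x] by blast
  have "\<forall>s\<in>{0..1}. \<exists>D. (f s has_derivative D) (at x) \<and> (\<forall>c v. D (c *s v) = c * D v)"
    using f x by (auto simp: holo_on_def)
  then obtain D where D: "\<And>s. s \<in> {0..1} \<Longrightarrow> (f s has_derivative D s) (at x)"
    "\<And>s c v. s \<in> {0..1} \<Longrightarrow> D s (c *s v) = c * D s v" by metis
  define C where "C = 32 * M / r\<^sup>2"
  have M0: "M > 0" using M[of 0 x] r by (auto intro: le_less_trans[OF norm_ge_zero])
  have C: "C > 0" using M0 r by (simp add: C_def)
  have rem: "cmod (f s (x + h) - f s x - D s h) \<le> C * (norm h)\<^sup>2" if "s \<in> {0..1}" "norm h \<le> r / 2" for s h
    unfolding C_def by (rule holo_remainder_bound[OF f rS r M D]) (use that in auto)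
  have lin: "linear (D s)" if "s \<in> {0..1}" for s
    using D(1)[OF that] has_derivative_linear by blast
  have Dcont: "continuous_on {0..1} (\<lambda>s. D s h)" for h
  proof (rule uniform_limit_theorem)
    define a where "a n = inverse (real (Suc n))" for n
    have a: "a n > 0" for n by (simp add: a_def)
    have a0: "a \<longlonglongrightarrow> 0" unfolding a_def by (rule LIMSEQ_inverse_real_of_nat)
    have small: "\<forall>\<^sub>F n in sequentially. norm (a n *\<^sub>R h) < r / 2"
    proof -
      have "(\<lambda>n. norm (a n *\<^sub>R h)) \<longlonglongrightarrow> 0" using a0 by (auto intro!: tendsto_eq_intros)
      then show ?thesis using r by (auto dest: order_tendstoD(2)[where a="r/2"])
    qed
    show "\<forall>\<^sub>F n in sequentially. continuous_on {0..1} (\<lambda>s. (f s (x + a n *\<^sub>R h) - f s x) /\<^sub>R a n)"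
      using small
    proof eventually_elim
      case (elim n)
      then have "x + a n *\<^sub>R h \<in> S" using rS r by (auto simp: dist_norm)
      then show ?case using x by (intro continuous_intros cont)
    qed
    show "uniform_limit {0..1} (\<lambda>n s. (f s (x + a n *\<^sub>R h) - f s x) /\<^sub>R a n) (\<lambda>s. D s h) sequentially"
    proof (rule uniform_limitI)
      fix e :: real assume e: "e > 0"
      have "(\<lambda>n. C * (norm h)\<^sup>2 * a n) \<longlonglongrightarrow> 0" using a0 by (auto intro!: tendsto_eq_intros)
      then have "\<forall>\<^sub>F n in sequentially. C * (norm h)\<^sup>2 * a n < e" using e by (auto dest: order_tendstoD(2))
      then show "\<forall>\<^sub>F n in sequentially. \<forall>s\<in>{0..1}. dist ((f s (x + a n *\<^sub>R h) - f s x) /\<^sub>R a n) (D s h) < e"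
        using small
      proof eventually_elim
        case (elim n)
        show ?case
        proof
          fix s :: real assume s: "s \<in> {0..1}"
          have "(f s (x + a n *\<^sub>R h) - f s x) /\<^sub>R a n - D s h = (f s (x + a n *\<^sub>R h) - f s x - D s (a n *\<^sub>R h)) /\<^sub>R a n"
            using a[of n] linear_scale[OF lin[OF s], of "a n" h] by (simp add: algebra_simps)
          then have "dist ((f s (x + a n *\<^sub>R h) - f s x) /\<^sub>R a n) (D s h) = cmod (f s (x + a n *\<^sub>R h) - f s x - D s (a n *\<^sub>R h)) / a n"
            using a[of n] by (simp add: dist_norm divide_inverse mult.commute)
          also have "\<dots> \<le> (C * (norm (a n *\<^sub>R h))\<^sup>2) / a n"
            using rem[OF s, of "a n *\<^sub>R h"] elim a[of n] by (intro divide_right_mono) auto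
          also have "\<dots> = C * (norm h)\<^sup>2 * a n" using a[of n] by (simp add: power2_eq_square)
          also have "\<dots> < e" by fact
          finally show "dist ((f s (x + a n *\<^sub>R h) - f s x) /\<^sub>R a n) (D s h) < e" .
        qed
      qed
    qed
  qed simp
  have Dint: "(\<lambda>s. D s h) integrable_on {0..1}" for h by (rule integrable_continuous_real[OF Dcont])
  define E where "E h = integral {0..1} (\<lambda>s. D s h)" for h
  have E_lin: "linear E"
  proof (rule linearI)
    fix a b
    have "E (a + b) = integral {0..1} (\<lambda>s. D s a + D s b)"
      unfolding E_def by (rule integral_cong) (use lin in \<open>simp add: linear_add\<close>)
    then show "E (a + b) = E a + E b" by (simp add: E_def integral_add[OF Dint Dint])
  next
    fix c :: real and b
    have "E (c *\<^sub>R b) = integral {0..1} (\<lambda>s. c *\<^sub>R D s b)"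
      unfolding E_def by (rule integral_cong) (use lin in \<open>simp add: linear_scale\<close>)
    then show "E (c *\<^sub>R b) = c *\<^sub>R E b" by (simp add: E_def integral_cmul)
  qed
  have "((\<lambda>x. integral {0..1} (\<lambda>s. f s x)) has_derivative E) (at x)"
    unfolding has_derivative_at_alt
  proof (intro conjI allI impI)
    show "bounded_linear E" using E_lin linear_conv_bounded_linear by blast
    fix e :: real assume e: "e > 0"
    show "\<exists>d>0. \<forall>y. norm (y - x) < d \<longrightarrow>
        norm (integral {0..1} (\<lambda>s. f s y) - integral {0..1} (\<lambda>s. f s x) - E (y - x)) \<le> e * norm (y - x)"
    proof (intro exI[of _ "min (r / 2) (e / C)"] conjI allI impI)
      show "0 < min (r / 2) (e / C)" using r e C by simp
      fix y assume y: "norm (y - x) < min (r / 2) (e / C)"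
      let ?h = "y - x"
      have "y \<in> S" using y rS r by (auto simp: dist_norm norm_minus_commute)
      note ints = integrable_continuous_real[OF cont[OF \<open>y \<in> S\<close>]] integrable_continuous_real[OF cont[OF x]] Dint[of ?h]
      have "integral {0..1} (\<lambda>s. f s y) - integral {0..1} (\<lambda>s. f s x) - E ?h
          = integral {0..1} (\<lambda>s. f s y - f s x - D s ?h)"
        unfolding E_def by (subst integral_diff; (subst integral_diff)?) (auto intro!: ints integrable_diff)
      also have "norm \<dots> \<le> (C * (norm ?h)\<^sup>2) * (1 - 0)"
      proof (rule integral_bound)
        show "continuous_on {0..1} (\<lambda>s. f s y - f s x - D s ?h)"
          by (intro continuous_intros cont x \<open>y \<in> S\<close> Dcont)
        show "norm (f s y - f s x - D s ?h) \<le> C * (norm ?h)\<^sup>2" if "s \<in> {0..1}" for s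
          using rem[OF that, of ?h] y by simp
      qed simp
      also have "\<dots> = (C * norm ?h) * norm ?h" by (simp add: power2_eq_square)
      also have "\<dots> \<le> e * norm ?h"
        using y C by (intro mult_right_mono) (auto simp: field_simps)
      finally show "norm (integral {0..1} (\<lambda>s. f s y) - integral {0..1} (\<lambda>s. f s x) - E ?h) \<le> e * norm ?h" .
    qed
  qed
  moreover have "E (c *s v) = c * E v" for c v
  proof -
    have "E (c *s v) = integral {0..1} (\<lambda>s. c * D s v)"
      unfolding E_def by (rule integral_cong) (simp add: D(2))
    then show ?thesis by (simp add: E_def)
  qed
  ultimately show "\<exists>D. ((\<lambda>x. integral {0..1} (\<lambda>s. f s x)) has_derivative D) (at x) \<and> (\<forall>c v. D (c *s v) = c * D v)"
    by blast
qed

context hartogs_domain begin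

section \<open>Beta-type integrals along the dilation orbits\<close>

abbreviation weight :: real where "weight \<equiv> \<Sum>j\<in>Z. \<alpha> j"

text \<open>The part of the integrand depending on the orbit. At s = 0 its value is 0 by the
  convention for \<open>powr\<close>; for nonempty \<open>Z\<close> the weight is positive, so this
  is also the limit when \<open>\<kappa>\<close> is continuous.\<close>

definition radial :: "(complex^'d \<Rightarrow> complex) \<Rightarrow> complex^'d \<Rightarrow> real \<Rightarrow> complex" where
  "radial \<kappa> y s = s powr weight *\<^sub>R \<kappa> (dilate s y)"

text \<open>What the first j factors of the operator make of the integral for K_\<Omega>, which is
  the case j = 0 in polar coordinates. At j = k the density has collapsed to a point mass at s = 1.
  The case split is essential: at j = k truncated subtraction would leave an ordinary
  integral.\<close>

definition euler_iterate :: "(complex^'d \<Rightarrow> complex) \<Rightarrow> nat \<Rightarrow> nat \<Rightarrow> complex^'d \<Rightarrow> complex" where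
  "euler_iterate \<kappa> k j y = (if j < k then (pi ^ k / fact (k - 1 - j)) *\<^sub>R
      integral {0..1} (\<lambda>s. (s ^ j * (1 - s) ^ (k - 1 - j)) *\<^sub>R radial \<kappa> y s)
    else pi ^ k *\<^sub>R \<kappa> y)"

lemma continuous_on_dilate:
  assumes "continuous_on S f" "continuous_on S g" "\<And>x. x \<in> S \<Longrightarrow> 0 \<le> f x"
  shows "continuous_on S (\<lambda>x. dilate (f x) (g x))"
  unfolding dilate_def using assms alpha_pos by (intro continuous_intros continuous_on_powr') auto

lemma weight_pos: "Z \<noteq> {} \<Longrightarrow> 0 < weight"
  using alpha_pos by (intro sum_pos) auto

lemma continuous_on_radial:
  assumes Z: "Z \<noteq> {}" and \<kappa>: "continuous_on \<Omega> \<kappa>" and y: "y \<in> \<Omega>"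
  shows "continuous_on {0..1} (radial \<kappa> y)"
  unfolding radial_def using weight_pos[OF Z] dilate_in[OF y]
  by (intro continuous_intros continuous_on_powr' continuous_on_compose2[OF \<kappa>] continuous_on_dilate) auto

text \<open>On the weighted integrand dilating y amounts to the substitution s to t s, so a
  derivative in t can be shifted onto the Beta-type density.\<close>

lemma radial_dilate: "0 \<le> t \<Longrightarrow> 0 \<le> s \<Longrightarrow> t powr weight *\<^sub>R radial \<kappa> (dilate t y) s = radial \<kappa> y (t * s)"
  by (simp add: radial_def dilate_dilate powr_mult mult.commute)

text \<open>Each factor of the operator differentiates the preceding iterate, so all iterates must
  be holomorphic.\<close>

lemma holo_on_euler_iterate:
  assumes Z: "Z \<noteq> {}" and \<kappa>: "holo_on \<Omega> \<kappa>"
  shows "holo_on \<Omega> (euler_iterate \<kappa> k j)"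
proof (cases "j < k")
  case False
  then have "euler_iterate \<kappa> k j = (\<lambda>y. of_real (pi ^ k) * \<kappa> y)"
    by (simp add: fun_eq_iff euler_iterate_def scaleR_conv_of_real)
  then show ?thesis using holo_on_mult[OF holo_on_const \<kappa>] by simp
next
  case True
  let ?m = "k - 1 - j"
  let ?f = "\<lambda>s y. (s ^ j * (1 - s) ^ ?m) *\<^sub>R radial \<kappa> y s"
  note \<kappa>c = holo_on_imp_continuous_on[OF \<kappa>]
  have "holo_on \<Omega> (\<lambda>y. integral {0..1} (\<lambda>s. ?f s y))"
  proof (rule holo_on_integral)
    show "holo_on \<Omega> (?f s)" if "s \<in> {0..1}" for s
    proof -
      have "holo_on \<Omega> (\<lambda>y. of_real (s ^ j * (1 - s) ^ ?m * s powr weight) * \<kappa> (zscale Z (\<lambda>i. of_real (s powr \<alpha> i)) y))"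
        by (intro holo_on_mult holo_on_const holo_on_zscale[OF \<kappa>])
           (use dilate_in[of _ s] that in \<open>auto simp: dilate_def\<close>)
      then show ?thesis by (simp add: radial_def dilate_def scaleR_conv_of_real mult.assoc)
    qed
    show "continuous_on {0..1} (\<lambda>s. ?f s y)" if "y \<in> \<Omega>" for y
      by (intro continuous_intros continuous_on_radial[OF Z \<kappa>c that])
    show "\<exists>r>0. \<exists>M. ball x r \<subseteq> \<Omega> \<and> (\<forall>s\<in>{0..1}. \<forall>y\<in>ball x r. cmod (?f s y) < M)" if x: "x \<in> \<Omega>" for x
    proof -
      obtain r where r: "r > 0" "cball x r \<subseteq> \<Omega>"
        using open_\<Omega> x open_contains_cball by blast
      \<comment> \<open>Joint continuity reaches s = 0 because the exponents are positive.
        Compactness then supplies a bound uniform in s.\<close>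
      have "continuous_on ({0..1} \<times> cball x r) (\<lambda>q. ?f (fst q) (snd q))"
        unfolding radial_def using weight_pos[OF Z] r dilate_in
        by (intro continuous_intros continuous_on_powr' continuous_on_compose2[OF \<kappa>c] continuous_on_dilate) auto
      moreover have "compact ({0..1::real} \<times> cball x r)" by (intro compact_Times) auto
      ultimately have "bounded ((\<lambda>q. ?f (fst q) (snd q)) ` ({0..1} \<times> cball x r))"
        by (intro compact_imp_bounded compact_continuous_image)
      then obtain M where "\<forall>z\<in>(\<lambda>q. ?f (fst q) (snd q)) ` ({0..1} \<times> cball x r). cmod z \<le> M"
        unfolding bounded_iff by blast
      from bspec[OF this imageI]
      have M: "cmod (?f (fst q) (snd q)) \<le> M" if "q \<in> {0..1} \<times> cball x r" for q
        using that by blast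
      have "cmod (?f s y) < M + 1" if "s \<in> {0..1}" "y \<in> ball x r" for s y
        using M[of "(s, y)"] that by auto
      then show ?thesis using r ball_subset_cball by (intro exI[of _ r] conjI exI[of _ "M + 1"]) auto
    qed
  qed
  from holo_on_mult[OF holo_on_const this, of "of_real (pi ^ k / fact ?m)"]
  have "holo_on \<Omega> (\<lambda>y. of_real (pi ^ k / fact ?m) * integral {0..1} (\<lambda>s. ?f s y))" .
  moreover have "euler_iterate \<kappa> k j = (\<lambda>y. of_real (pi ^ k / fact ?m) * integral {0..1} (\<lambda>s. ?f s y))"
    using True by (simp add: fun_eq_iff euler_iterate_def scaleR_conv_of_real)
  ultimately show ?thesis by simp
qed

text \<open>Along the dilation orbit the Euler operator becomes t d/dt, and integration by parts of the
  Beta-type weight raises j.\<close>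

lemma euler_iterate_Suc:
  assumes Z: "Z \<noteq> {}" and \<kappa>: "continuous_on \<Omega> \<kappa>" and y: "y \<in> \<Omega>" and j: "j < k"
    and D: "(euler_iterate \<kappa> k j has_derivative D) (at y)" "\<And>c v. D (c *s v) = c * D v"
  shows "of_nat (Suc j) * euler_iterate \<kappa> k j y
     + (\<Sum>l\<in>Z. of_real (\<alpha> l) * (euler_iterate \<kappa> k j y + y$l * D (axis l 1))) = euler_iterate \<kappa> k (Suc j) y"
proof -
  let ?P = "euler_iterate \<kappa> k j"
  define m where "m = k - 1 - j"
  have mk: "m + j + 1 = k" using j by (simp add: m_def)
  define c where "c = pi ^ k / fact m"
  define A where "A = radial \<kappa> y"
  have A: "continuous_on {0..1} A" unfolding A_def by (rule continuous_on_radial[OF Z \<kappa> y])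
  define \<phi> where "\<phi> x = x ^ j *\<^sub>R A x" for x
  have \<phi>: "continuous_on {0..1} \<phi>" unfolding \<phi>_def by (intro continuous_intros A)
  define C where "C t = integral {0..t} (\<lambda>x. (t - x) ^ m *\<^sub>R \<phi> x)" for t
  \<comment> \<open>The derivative of \<open>C\<close> at 1. For m = 0 the kernel (t-x)^m is
    constant and \<open>C\<close> is a primitive of \<open>\<phi>\<close>, so the boundary value at
    1 appears; this is the case of the last factor of the operator.\<close>
  define C' where "C' = (case m of 0 \<Rightarrow> \<kappa> y | Suc n \<Rightarrow> real m *\<^sub>R integral {0..1} (\<lambda>x. (1 - x) ^ n *\<^sub>R \<phi> x))"
  have A1: "A 1 = \<kappa> y" by (simp add: A_def radial_def)
  have dC: "(C has_vector_derivative C') (at 1 within {0..1})"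
  proof (cases m)
    case 0
    moreover have "\<phi> 1 = \<kappa> y" by (simp add: \<phi>_def A1)
    ultimately show ?thesis
      using integral_has_vector_derivative[OF \<phi>, of 1] by (simp add: C_def[abs_def] C'_def)
  next
    case (Suc n)
    then show ?thesis
      using has_vector_derivative_convolution_power[OF \<phi>, of 1 n] by (simp add: C_def[abs_def] C'_def)
  qed
  \<comment> \<open>The substitution x = t s contributes m + j + 1 = k powers of t: m from the
    kernel, j from x^j and 1 from dx. The range [1/2,1] avoids 0 and stays where continuity of
    \<open>A\<close> is known, so the derivatives at 1 are one-sided.\<close>
  have B_eq: "t powr weight *\<^sub>R ?P (dilate t y) = (c / t ^ k) *\<^sub>R C t" if t: "t \<in> {1/2..1}" for t
  proof -
    have t0: "0 < t" using t by simp
    have "(\<lambda>x. (t - x) ^ m *\<^sub>R \<phi> x) integrable_on {0..t}"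
      using t by (intro integrable_continuous_real continuous_intros continuous_on_subset[OF \<phi>]) auto
    then have "((\<lambda>x. (t - x) ^ m *\<^sub>R \<phi> x) has_integral C t) {0..t}"
      unfolding C_def by (rule integrable_integral)
    from has_integral_stretch_real[OF this, of t]
    have "((\<lambda>s. (t - t * s) ^ m *\<^sub>R \<phi> (t * s)) has_integral (1 / t) *\<^sub>R C t) ((\<lambda>x. x / t) ` {0..t})"
      using t0 by simp
    also have "(\<lambda>x. x / t) ` {0..t} = {0..1}"
      using t0 by (auto simp: image_iff intro!: bexI[of _ "_ * t"])
    finally have "((\<lambda>s. (1 / t ^ (m + j)) *\<^sub>R ((t - t * s) ^ m *\<^sub>R \<phi> (t * s))) has_integral (1 / t ^ (m + j)) *\<^sub>R ((1 / t) *\<^sub>R C t)) {0..1}"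
      by (rule has_integral_cmul)
    moreover have "(1 / t ^ (m + j)) *\<^sub>R ((t - t * s) ^ m *\<^sub>R \<phi> (t * s)) = (s ^ j * (1 - s) ^ m) *\<^sub>R A (t * s)" for s
    proof -
      have "t - t * s = t * (1 - s)" by (simp add: algebra_simps)
      then have "(t - t * s) ^ m = t ^ m * (1 - s) ^ m" by (simp only: power_mult_distrib)
      then show ?thesis using t0 by (simp add: \<phi>_def power_mult_distrib power_add)
    qed
    moreover have "(1 / t ^ (m + j)) *\<^sub>R ((1 / t) *\<^sub>R C t) = (1 / t ^ k) *\<^sub>R C t"
      using mk[symmetric] t0 by (simp add: field_simps)
    ultimately have "((\<lambda>s. (s ^ j * (1 - s) ^ m) *\<^sub>R A (t * s)) has_integral (1 / t ^ k) *\<^sub>R C t) {0..1}"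
      by (simp only:)
    then have I: "integral {0..1} (\<lambda>s. (s ^ j * (1 - s) ^ m) *\<^sub>R A (t * s)) = (1 / t ^ k) *\<^sub>R C t"
      by (rule integral_unique)
    have "t powr weight *\<^sub>R ?P (dilate t y) = c *\<^sub>R (t powr weight *\<^sub>R integral {0..1} (\<lambda>s. (s ^ j * (1 - s) ^ m) *\<^sub>R radial \<kappa> (dilate t y) s))"
      using j by (simp add: euler_iterate_def c_def m_def)
    also have "t powr weight *\<^sub>R integral {0..1} (\<lambda>s. (s ^ j * (1 - s) ^ m) *\<^sub>R radial \<kappa> (dilate t y) s)
        = integral {0..1} (\<lambda>s. t powr weight *\<^sub>R ((s ^ j * (1 - s) ^ m) *\<^sub>R radial \<kappa> (dilate t y) s))"
      by (rule integral_cmul[symmetric])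
    also have "\<dots> = integral {0..1} (\<lambda>s. (s ^ j * (1 - s) ^ m) *\<^sub>R A (t * s))"
    proof (rule integral_cong)
      fix s :: real assume "s \<in> {0..1}"
      then have "A (t * s) = t powr weight *\<^sub>R radial \<kappa> (dilate t y) s"
        using radial_dilate[of t s \<kappa> y] t0 by (simp add: A_def)
      then show "t powr weight *\<^sub>R ((s ^ j * (1 - s) ^ m) *\<^sub>R radial \<kappa> (dilate t y) s) = (s ^ j * (1 - s) ^ m) *\<^sub>R A (t * s)"
        by (simp add: mult.commute)
    qed
    finally show ?thesis unfolding I by simp
  qed
  have C1: "?P y = c *\<^sub>R C 1" using B_eq[of 1] by simp
  have dC2: "(C has_vector_derivative C') (at 1 within {1/2..1})"
    using dC by (rule has_vector_derivative_within_subset) auto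
  have "((\<lambda>t. (c / t ^ k) *\<^sub>R C t) has_vector_derivative (c / 1 ^ k) *\<^sub>R C' + (- (c * real k)) *\<^sub>R C 1) (at 1 within {1/2..1})"
    by (rule has_vector_derivative_scaleR[OF _ dC2]) (auto intro!: derivative_eq_intros)
  then have "((\<lambda>t. (c / t ^ k) *\<^sub>R C t) has_vector_derivative c *\<^sub>R C' - (c * real k) *\<^sub>R C 1) (at 1 within {1/2..1})"
    by simp
  then have d1: "((\<lambda>t. t powr weight *\<^sub>R ?P (dilate t y)) has_vector_derivative c *\<^sub>R C' - (c * real k) *\<^sub>R C 1) (at 1 within {1/2..1})"
    by (rule has_vector_derivative_transform[rotated 2]) (auto simp: B_eq)
  \<comment> \<open>The velocity of the orbit at t = 1, so that \<open>D V\<close> is the weighted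
    Euler field applied to the iterate.\<close>
  define V where "V = (\<chi> l. if l \<in> Z then of_real (\<alpha> l) * y$l else 0)"
  have dd: "((\<lambda>t. dilate t y) has_vector_derivative V) (at 1)"
    unfolding has_vector_derivative_def
  proof (rule has_derivative_vecI)
    fix l
    have "((\<lambda>t. t powr \<alpha> l) has_real_derivative \<alpha> l) (at 1)"
      by (auto intro!: derivative_eq_intros)
    then have "((\<lambda>t. t powr \<alpha> l) has_vector_derivative \<alpha> l) (at 1)"
      by (simp add: has_real_derivative_iff_has_vector_derivative)
    then have "((\<lambda>t. (t powr \<alpha> l) *\<^sub>R y$l) has_vector_derivative \<alpha> l *\<^sub>R y$l) (at 1)"
      by (rule bounded_linear.has_vector_derivative[OF bounded_linear_scaleR_left])
    then have "((\<lambda>t. of_real (t powr \<alpha> l) * y$l) has_derivative (\<lambda>h. h *\<^sub>R (of_real (\<alpha> l) * y$l))) (at 1)"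
      by (simp add: has_vector_derivative_def scaleR_conv_of_real)
    then show "((\<lambda>t. dilate t y $ l) has_derivative (\<lambda>h. (h *\<^sub>R V) $ l)) (at 1)"
      by (cases "l \<in> Z") (simp_all add: dilate_def zscale_nth V_def)
  qed
  have "(?P \<circ> (\<lambda>t. dilate t y) has_vector_derivative D V) (at 1)"
  proof -
    have "(?P has_derivative D) (at (dilate 1 y))" using D(1) by simp
    from diff_chain_at[OF dd[unfolded has_vector_derivative_def] this]
    have "(?P \<circ> (\<lambda>t. dilate t y) has_derivative (\<lambda>h. D (h *\<^sub>R V))) (at 1)" by (simp add: o_def)
    moreover have "D (h *\<^sub>R V) = h *\<^sub>R D V" for h
      using has_derivative_linear[OF D(1)] by (simp add: linear_scale)
    ultimately show ?thesis by (simp add: has_vector_derivative_def)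
  qed
  then have d2: "((\<lambda>t. ?P (dilate t y)) has_vector_derivative D V) (at 1 within {1/2..1})"
    by (simp add: o_def has_vector_derivative_at_within)
  have "((\<lambda>t. t powr weight *\<^sub>R ?P (dilate t y)) has_vector_derivative (1 powr weight) *\<^sub>R D V + weight *\<^sub>R ?P (dilate 1 y)) (at 1 within {1/2..1})"
    by (rule has_vector_derivative_scaleR[OF _ d2]) (auto intro!: derivative_eq_intros)
  then have "((\<lambda>t. t powr weight *\<^sub>R ?P (dilate t y)) has_vector_derivative D V + weight *\<^sub>R ?P y) (at 1 within {1/2..1})"
    by simp
  with d1 have eq: "D V + weight *\<^sub>R ?P y = c *\<^sub>R C' - (c * real k) *\<^sub>R C 1"
    using vector_derivative_unique_within_closed_interval[of "1/2" 1 1] by (simp add: cbox_interval)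
  have DV: "D V = (\<Sum>l\<in>Z. of_real (\<alpha> l) * (y$l * D (axis l 1)))"
  proof -
    have "V = (\<Sum>l\<in>Z. (of_real (\<alpha> l) * y$l) *s axis l 1)"
      by (simp add: vec_eq_iff V_def axis_def if_distrib cong: if_cong)
    then have "D V = (\<Sum>l\<in>Z. D ((of_real (\<alpha> l) * y$l) *s axis l 1))"
      using linear_sum[OF has_derivative_linear[OF D(1)]] by simp
    then show ?thesis by (simp add: D(2) mult.assoc)
  qed
  have "(\<Sum>l\<in>Z. of_real (\<alpha> l) * (?P y + y$l * D (axis l 1))) = weight *\<^sub>R ?P y + D V"
    by (simp add: DV distrib_left sum.distrib scaleR_conv_of_real sum_distrib_right)
  then have "of_nat (Suc j) * ?P y + (\<Sum>l\<in>Z. of_real (\<alpha> l) * (?P y + y$l * D (axis l 1)))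
      = real (Suc j) *\<^sub>R ?P y + (c *\<^sub>R C' - (c * real k) *\<^sub>R C 1)"
    using eq by (simp add: scaleR_conv_of_real add_ac)
  \<comment> \<open>Since m + j + 1 = k, the coefficients j + 1 and -k combine to -m.\<close>
  also have "\<dots> = c *\<^sub>R (C' - real m *\<^sub>R C 1)"
    unfolding C1 by (simp add: mk[symmetric] scaleR_conv_of_real algebra_simps)
  also have "\<dots> = euler_iterate \<kappa> k (Suc j) y"
  proof (cases m)
    case 0
    then show ?thesis using mk by (simp add: C'_def euler_iterate_def c_def)
  next
    case (Suc n)
    have int: "(\<lambda>x. (1 - x) ^ i *\<^sub>R \<phi> x) integrable_on {0..1}" for i
      by (intro integrable_continuous_real continuous_intros \<phi>)
    \<comment> \<open>The identity (1-x)^n - (1-x)^(n+1) = x (1-x)^n moves one power from 1-x to x,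
      which raises j by one.\<close>
    have "integral {0..1} (\<lambda>x. (1 - x) ^ n *\<^sub>R \<phi> x) - C 1 = integral {0..1} (\<lambda>x. (1 - x) ^ n *\<^sub>R \<phi> x - (1 - x) ^ m *\<^sub>R \<phi> x)"
      unfolding C_def integral_diff[OF int int] ..
    also have "\<dots> = integral {0..1} (\<lambda>s. (s ^ Suc j * (1 - s) ^ n) *\<^sub>R radial \<kappa> y s)"
      by (rule integral_cong) (simp add: Suc \<phi>_def A_def scaleR_conv_of_real algebra_simps)
    finally have "c *\<^sub>R (C' - real m *\<^sub>R C 1) = (c * real m) *\<^sub>R integral {0..1} (\<lambda>s. (s ^ Suc j * (1 - s) ^ n) *\<^sub>R radial \<kappa> y s)"
      using Suc by (simp add: C'_def scaleR_diff_right[symmetric])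
    moreover have "c * real m = pi ^ k / fact n"
    proof -
      have "real m \<noteq> 0" "fact m = real m * fact n" using Suc by (simp_all only: fact_Suc)
      then show ?thesis by (simp add: c_def)
    qed
    moreover have "k - 1 - Suc j = n" "Suc j < k" using Suc mk by auto
    ultimately show ?thesis by (simp add: euler_iterate_def)
  qed
  finally show ?thesis .
qed

lemma kernel_base_eq_euler_iterate:
  fixes KU :: "complex^('d + 'k::finite) \<Rightarrow> complex^('d + 'k) \<Rightarrow> complex"
  assumes Z: "Z \<noteq> {}" and KU: "is_bergman_kernel (Ualpha \<alpha> Z \<Omega>) KU" and K0: "is_bergman_kernel \<Omega> K0"
    and x: "x \<in> \<Omega>" and v: "v \<in> \<Omega>"
  shows "K0 x v = euler_iterate (\<lambda>u. KU (pt u 0) (pt v 0)) CARD('k) 0 x"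
proof -
  let ?\<kappa> = "\<lambda>u. KU (pt u 0) (pt v 0)"
  have "holo_on (Ualpha \<alpha> Z \<Omega>) (\<lambda>p. KU p (pt v 0))"
    using bergman_kernel_in_space[OF KU, of "pt v 0"] v by (simp add: mem_Ualpha_0 bergman_space_def)
  then have "holo_on \<Omega> ?\<kappa>" by (rule holo_on_pt) (simp add: mem_Ualpha_0)
  then have c: "continuous_on {0..1} (radial ?\<kappa> x)"
    by (intro continuous_on_radial[OF Z _ x] holo_on_imp_continuous_on)
  have "K0 x v = (LINT w:ball 0 1|(lborel :: (complex^'k) measure). radial ?\<kappa> x (1 - (norm w)\<^sup>2))"
    unfolding radial_def by (rule kernel_base_integral[OF KU K0 x v])
  also have "\<dots> = euler_iterate ?\<kappa> CARD('k) 0 x"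
    unfolding set_integral_ball_radial[OF c] by (simp add: euler_iterate_def)
  finally show ?thesis .
qed

end

subsection \<open>Automorphisms along the axes of the ball\<close>

lemma Re_pos_imp_nonpos_Reals: "0 < Re z \<Longrightarrow> z \<notin> \<real>\<^sub>\<le>\<^sub>0"
  by (auto simp: complex_nonpos_Reals_iff)

text \<open>Both arguments lie in (-pi/2, pi/2), so their sum stays in (-pi, pi) and the principal
  logarithm is additive. This is why real parts are shown positive throughout.\<close>

lemma powr_mult_Re_pos:
  fixes a b s :: complex
  assumes "0 < Re a" "0 < Re b"
  shows "(a * b) powr s = a powr s * b powr s"
proof -
  have "a \<noteq> 0" "b \<noteq> 0" using assms by auto
  moreover have "\<bar>Im (Ln a)\<bar> < pi / 2" "\<bar>Im (Ln b)\<bar> < pi / 2"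
    using assms Re_Ln_pos_lt_imp by blast+
  ultimately have "Ln (a * b) = Ln a + Ln b" by (intro Ln_times_simple) auto
  then show ?thesis using \<open>a \<noteq> 0\<close> \<open>b \<noteq> 0\<close> by (simp add: powr_def distrib_left exp_add)
qed

lemma Re_inverse_pos: "0 < Re z \<Longrightarrow> 0 < Re (inverse z)"
  by (auto simp: sum_power2_gt_zero_iff intro!: divide_pos_pos)

lemma Re_of_real_divide_pos: "0 < r \<Longrightarrow> 0 < Re z \<Longrightarrow> 0 < Re (complex_of_real r / z)"
  using Re_inverse_pos[of z] by (simp add: divide_inverse)

lemma Re_one_minus_pos: "cmod z < 1 \<Longrightarrow> 0 < Re (1 - z)"
  using complex_Re_le_cmod[of z] by simp

lemma cinner_self: "cinner w w = of_real ((norm w)\<^sup>2)"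
proof -
  have "(norm w)\<^sup>2 = (\<Sum>i\<in>UNIV. (cmod (w$i))\<^sup>2)"
    by (simp add: norm_vec_def L2_set_def sum_nonneg)
  then show ?thesis by (simp add: cinner_def complex_norm_square del: of_real_power)
qed

lemma norm_cinner_le: "cmod (cinner w \<eta>) \<le> norm w * norm \<eta>"
proof -
  have "cmod (cinner w \<eta>) \<le> (\<Sum>i\<in>UNIV. \<bar>cmod (w$i)\<bar> * \<bar>cmod (\<eta>$i)\<bar>)"
    unfolding cinner_def by (rule order.trans[OF norm_sum]) (simp add: norm_mult)
  also have "\<dots> \<le> norm w * norm \<eta>"
    unfolding norm_vec_def by (rule L2_set_mult_ineq)
  finally show ?thesis .
qed

lemma norm_cinner_less: "norm w < 1 \<Longrightarrow> norm \<eta> < 1 \<Longrightarrow> cmod (cinner w \<eta>) < 1"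
  using norm_cinner_le[of w \<eta>] mult_strict_mono'[of "norm w" 1 "norm \<eta>" 1] by simp

text \<open>Cauchy-Schwarz combined with (1-x^2)(1-y^2) <= (1-xy)^2, which amounts to (x-y)^2 >= 0.
  It keeps a point moved to the centre of the ball inside the domain.\<close>

lemma one_minus_cinner_bound:
  assumes "norm w < 1" "norm \<eta> < 1"
  shows "(1 - (norm w)\<^sup>2) * (1 - (norm \<eta>)\<^sup>2) \<le> (cmod (1 - cinner w \<eta>))\<^sup>2"
proof -
  let ?x = "norm w" and ?y = "norm \<eta>"
  have "?x * ?y \<le> 1" using assms by (simp add: mult_le_one)
  have "0 \<le> (?x - ?y)\<^sup>2" by simp
  then have "(1 - ?x\<^sup>2) * (1 - ?y\<^sup>2) \<le> (1 - ?x * ?y)\<^sup>2"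
    by (simp add: power2_eq_square algebra_simps)
  also have "\<dots> \<le> (cmod (1 - cinner w \<eta>))\<^sup>2"
  proof (rule power_mono)
    show "1 - ?x * ?y \<le> cmod (1 - cinner w \<eta>)"
      using norm_cinner_le[of w \<eta>] norm_triangle_ineq2[of 1 "cinner w \<eta>"] by simp
  qed (use \<open>?x * ?y \<le> 1\<close> in simp)
  finally show ?thesis .
qed

section \<open>Moebius maps of the unit disc\<close>

definition moebius :: "complex \<Rightarrow> complex \<Rightarrow> complex" where
  "moebius a t = (t - a) / (1 - cnj a * t)"

text \<open>A square root of the derivative of \<open>moebius a\<close>. For |a| < 1 it has positive
  real part on the disc, so its principal powers are holomorphic there. It is also the multiplier of
  the other ball coordinates.\<close>

definition moebius_factor :: "complex \<Rightarrow> complex \<Rightarrow> complex" where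
  "moebius_factor a t = of_real (sqrt (1 - (cmod a)\<^sup>2)) / (1 - cnj a * t)"

context
  fixes a :: complex assumes a: "cmod a < 1"
begin

lemma moebius_denom_Re: "cmod t < 1 \<Longrightarrow> 0 < Re (1 - cnj a * t)"
  using a mult_strict_mono'[of "cmod a" 1 "cmod t" 1] by (intro Re_one_minus_pos) (simp add: norm_mult)

lemma moebius_denom_nonzero: "cmod t < 1 \<Longrightarrow> 1 - cnj a * t \<noteq> 0"
  using moebius_denom_Re by (metis less_irrefl zero_complex.simps(1))

lemma moebius_factor_Re: "cmod t < 1 \<Longrightarrow> 0 < Re (moebius_factor a t)"
  unfolding moebius_factor_def using a norm_less_1_square[of a]
  by (intro Re_of_real_divide_pos moebius_denom_Re) auto

lemma moebius_factor_nonzero: "cmod t < 1 \<Longrightarrow> moebius_factor a t \<noteq> 0"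
  using moebius_factor_Re by (metis less_irrefl zero_complex.simps(1))

lemma sqrt_one_minus_square: "(complex_of_real (sqrt (1 - (cmod a)\<^sup>2)))\<^sup>2 = 1 - a * cnj a"
  using norm_less_1_square[OF a]
  by (simp add: complex_norm_square[symmetric] flip: of_real_power) 

text \<open>The polarised form of the transformation rule for 1 - |t|^2; two different points are
  needed to transform 1 - <w,\<eta>>.\<close>

lemma moebius_identity:
  assumes "cmod t < 1" "cmod s < 1"
  shows "1 - moebius a t * cnj (moebius a s) = moebius_factor a t * cnj (moebius_factor a s) * (1 - t * cnj s)"
proof -
  let ?q = "complex_of_real (sqrt (1 - (cmod a)\<^sup>2))"
  have nz: "1 - cnj a * t \<noteq> 0" "1 - a * cnj s \<noteq> 0"
    using moebius_denom_nonzero[OF assms(1)] moebius_denom_nonzero[OF assms(2)] by (auto simp: complex_eq_iff)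
  have "moebius_factor a t * cnj (moebius_factor a s) * (1 - t * cnj s) = ?q\<^sup>2 * (1 - t * cnj s) / ((1 - cnj a * t) * (1 - a * cnj s))"
    by (simp add: moebius_factor_def power2_eq_square)
  also have "\<dots> = 1 - moebius a t * cnj (moebius a s)"
    unfolding sqrt_one_minus_square moebius_def using nz by (simp add: divide_simps) (simp add: algebra_simps)
  finally show ?thesis by simp
qed

lemma norm_moebius_less_1: 
  assumes "cmod t < 1" shows "cmod (moebius a t) < 1"
proof -
  have "1 - moebius a t * cnj (moebius a t) = moebius_factor a t * cnj (moebius_factor a t) * (1 - t * cnj t)"
    by (rule moebius_identity[OF assms assms])
  then have "complex_of_real (1 - (cmod (moebius a t))\<^sup>2) = complex_of_real ((cmod (moebius_factor a t))\<^sup>2 * (1 - (cmod t)\<^sup>2))"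
    by (simp add: complex_norm_square del: of_real_power)
  then have "1 - (cmod (moebius a t))\<^sup>2 = (cmod (moebius_factor a t))\<^sup>2 * (1 - (cmod t)\<^sup>2)"
    unfolding of_real_eq_iff .
  also have "\<dots> > 0" using moebius_factor_nonzero[OF assms] norm_less_1_square[OF assms] by simp
  finally have "(cmod (moebius a t))\<^sup>2 < 1\<^sup>2" by simp
  then show ?thesis by (rule power2_less_imp_less) simp
qed

lemma moebius_has_derivative:
  "cmod t < 1 \<Longrightarrow> (moebius a has_field_derivative (moebius_factor a t)\<^sup>2) (at t)"
  using moebius_denom_nonzero[of t]
  unfolding moebius_def[abs_def] moebius_factor_def power_divide sqrt_one_minus_square
  by (auto intro!: derivative_eq_intros simp: field_simps power2_eq_square)

lemma moebius_factor_holomorphic: "moebius_factor a holomorphic_on ball 0 1"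
  unfolding moebius_factor_def[abs_def] using moebius_denom_nonzero by (intro holomorphic_intros) auto

lemma moebius_holomorphic: "moebius a holomorphic_on ball 0 1"
  unfolding moebius_def[abs_def] using moebius_denom_nonzero by (intro holomorphic_intros) auto

lemma moebius_factor_powr_holomorphic: "(\<lambda>t. moebius_factor a t powr s) holomorphic_on ball 0 1"
  using moebius_factor_Re by (intro holomorphic_intros moebius_factor_holomorphic) (auto intro!: Re_pos_imp_nonpos_Reals)

end

lemma moebius_inverse:
  assumes a: "cmod a < 1" and t: "cmod t < 1"
  shows "moebius (- a) (moebius a t) = t" "moebius_factor (- a) (moebius a t) = inverse (moebius_factor a t)"
proof -
  let ?q = "complex_of_real (sqrt (1 - (cmod a)\<^sup>2))"
  have nz: "1 - cnj a * t \<noteq> 0" by (rule moebius_denom_nonzero[OF a t])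
  have q0: "?q \<noteq> 0" using norm_less_1_square[OF a] by auto
  have qq: "1 - a * cnj a \<noteq> 0" using sqrt_one_minus_square[OF a] q0 by (metis power_eq_0_iff)
  have 1: "1 + cnj a * moebius a t = (1 - a * cnj a) / (1 - cnj a * t)"
    using nz by (simp add: moebius_def field_simps)
  have 2: "moebius a t + a = t * (1 - a * cnj a) / (1 - cnj a * t)"
    using nz by (simp add: moebius_def field_simps)
  show "moebius (- a) (moebius a t) = t"
    using 1 2 nz qq by (simp add: moebius_def[of "- a"])
  have "moebius_factor (- a) (moebius a t) = ?q * (1 - cnj a * t) / ?q\<^sup>2"
    using 1 nz by (simp add: moebius_factor_def sqrt_one_minus_square[OF a])
  also have "\<dots> = inverse (moebius_factor a t)"
    using q0 nz by (simp add: moebius_factor_def power2_eq_square)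
  finally show "moebius_factor (- a) (moebius a t) = inverse (moebius_factor a t)" .
qed

lemma powr_inverse_mult:
  assumes "0 < Re z"
  shows "inverse z powr s * z powr s = (1::complex)"
proof -
  have "z \<noteq> 0" using assms by auto
  then show ?thesis
    using powr_mult_Re_pos[OF Re_inverse_pos[OF assms] assms, of s] by simp
qed

section \<open>Lifting the axis automorphisms from the ball to U\<close>

context hartogs_domain begin

text \<open>The power \<open>\<alpha> i\<close> is forced: the automorphism multiplies 1 - |w|^2 by
  the squared modulus of \<open>moebius_factor\<close>, so exactly this power preserves |z_i| / (1 -
  |w|^2)^(\<alpha>_i/2).\<close>

definition aut_factor :: "complex \<Rightarrow> 'd + 'k \<Rightarrow> complex \<Rightarrow> complex" where
  "aut_factor a l t = (case l of Inl i \<Rightarrow> (if i \<in> Z then moebius_factor a t powr of_real (\<alpha> i) else 1) | Inr _ \<Rightarrow> moebius_factor a t)"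

text \<open>A Moebius map in coordinate i and a scaling in the others. With a the i-th coordinate of
  a point, it makes that coordinate 0 and creates no new nonzero ones.\<close>

definition ball_aut :: "complex \<Rightarrow> 'k::finite \<Rightarrow> complex^'k \<Rightarrow> complex^'k" where
  "ball_aut a i w = (\<chi> l. if l = i then moebius a (w$i) else moebius_factor a (w$i) * w$l)"

definition domain_aut :: "complex \<Rightarrow> 'k::finite \<Rightarrow> complex^('d + 'k::finite) \<Rightarrow> complex^('d + 'k)" where
  "domain_aut a i p = (\<chi> l. if l = Inr i then moebius a (p $ Inr i) else aut_factor a l (p $ Inr i) * p$l)"

lemma domain_aut_pt: "domain_aut a i (pt u w) = pt (zscale Z (\<lambda>l. moebius_factor a (w$i) powr of_real (\<alpha> l)) u) (ball_aut a i w)"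
  by (auto simp: vec_eq_iff domain_aut_def aut_factor_def ball_aut_def pt_def zscale_nth split: sum.splits)

lemma norm_nth_less: "norm w < 1 \<Longrightarrow> cmod ((w::complex^'k)$i) < 1"
  using Finite_Cartesian_Product.norm_nth_le[of w i] by simp

lemma ball_aut_identity:
  fixes w \<eta> :: "complex^'k::finite"
  assumes a: "cmod a < 1" and w: "cmod (w$i) < 1" and \<eta>: "cmod (\<eta>$i) < 1"
  shows "1 - cinner (ball_aut a i w) (ball_aut a i \<eta>) = moebius_factor a (w$i) * cnj (moebius_factor a (\<eta>$i)) * (1 - cinner w \<eta>)"
proof -
  have split: "cinner x y = x$i * cnj (y$i) + (\<Sum>l\<in>UNIV-{i}. x$l * cnj (y$l))" for x y :: "complex^'k"
    unfolding cinner_def by (rule sum.remove) auto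
  have "(\<Sum>l\<in>UNIV-{i}. ball_aut a i w $ l * cnj (ball_aut a i \<eta> $ l)) = moebius_factor a (w$i) * cnj (moebius_factor a (\<eta>$i)) * (\<Sum>l\<in>UNIV-{i}. w$l * cnj (\<eta>$l))"
    unfolding sum_distrib_left by (rule sum.cong) (auto simp: ball_aut_def)
  moreover have "ball_aut a i w $ i * cnj (ball_aut a i \<eta> $ i) = moebius a (w$i) * cnj (moebius a (\<eta>$i))"
    by (simp add: ball_aut_def)
  ultimately show ?thesis
    using moebius_identity[OF a w \<eta>] by (simp add: split[of "ball_aut a i w"] split[of w] algebra_simps)
qed

lemma ball_aut_norm:
  fixes w :: "complex^'k::finite"
  assumes a: "cmod a < 1" and w: "norm w < 1"
  shows "1 - (norm (ball_aut a i w))\<^sup>2 = (cmod (moebius_factor a (w$i)))\<^sup>2 * (1 - (norm w)\<^sup>2)" "norm (ball_aut a i w) < 1"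
proof -
  have wi: "cmod (w$i) < 1" by (rule norm_nth_less[OF w])
  have "complex_of_real (1 - (norm (ball_aut a i w))\<^sup>2) = complex_of_real ((cmod (moebius_factor a (w$i)))\<^sup>2 * (1 - (norm w)\<^sup>2))"
    using ball_aut_identity[OF a wi wi] by (simp add: cinner_self complex_norm_square[of "moebius_factor a (w$i)"] del: of_real_power)
  then show 1: "1 - (norm (ball_aut a i w))\<^sup>2 = (cmod (moebius_factor a (w$i)))\<^sup>2 * (1 - (norm w)\<^sup>2)"
    unfolding of_real_eq_iff .
  have "\<dots> > 0" using moebius_factor_nonzero[OF a wi] norm_less_1_square[OF w] by simp
  then have "(norm (ball_aut a i w))\<^sup>2 < 1\<^sup>2" using 1 by simp
  then show "norm (ball_aut a i w) < 1" by (rule power2_less_imp_less) simp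
qed

lemma Ualpha_nth: "p \<in> Ualpha \<alpha> Z \<Omega> \<Longrightarrow> cmod ((p :: complex^('d + 'k::finite)) $ Inr i) < 1"
  by (metis mem_Ualpha norm_nth_less pt_nth(2) pt_zpart_wpart)

text \<open>The multipliers on u balance the change of 1 - |w|^2, so the inequality asked for by
  \<open>Ualpha_mono\<close> holds with equality.\<close>

lemma domain_aut_in:
  fixes p :: "complex^('d + 'k::finite)"
  assumes a: "cmod a < 1" and p: "p \<in> Ualpha \<alpha> Z \<Omega>"
  shows "domain_aut a i p \<in> Ualpha \<alpha> Z \<Omega>"
proof -
  obtain u w where puw: "p = pt u w" by (metis pt_zpart_wpart)
  have w: "norm w < 1" using p by (simp add: puw mem_Ualpha)
  have wi: "cmod (w$i) < 1" by (rule norm_nth_less[OF w])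
  show ?thesis
    unfolding puw domain_aut_pt
  proof (rule Ualpha_mono[OF p[unfolded puw] ball_aut_norm(2)[OF a w]])
    fix l
    let ?e = "cmod (moebius_factor a (w$i))"
    have "((?e)\<^sup>2 * (1 - (norm w)\<^sup>2)) powr (\<alpha> l / 2) = ?e powr \<alpha> l * (1 - (norm w)\<^sup>2) powr (\<alpha> l / 2)"
      using norm_less_1_square[OF w] moebius_factor_nonzero[OF a wi]
      by (simp add: powr_mult powr_powr flip: powr_numeral)
    then show "cmod (moebius_factor a (w$i) powr of_real (\<alpha> l)) * (1 - (norm w)\<^sup>2) powr (\<alpha> l / 2)
       \<le> (1 - (norm (ball_aut a i w))\<^sup>2) powr (\<alpha> l / 2)"
      unfolding ball_aut_norm(1)[OF a w] by (simp add: norm_powr_real_powr')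
  qed
qed

lemma domain_aut_nth: "domain_aut a i p $ Inr i = moebius a (p $ Inr i)"
  by (simp add: domain_aut_def)

lemma aut_factor_nonzero: "cmod a < 1 \<Longrightarrow> cmod t < 1 \<Longrightarrow> aut_factor a l t \<noteq> 0"
  using moebius_factor_nonzero[of a t] by (simp add: aut_factor_def split: sum.split)

lemma aut_factor_holomorphic:
  assumes "cmod a < 1"
  shows "aut_factor a l holomorphic_on ball 0 1"
proof (cases l)
  case (Inl i)
  then show ?thesis
    using moebius_factor_powr_holomorphic[OF assms] by (cases "i \<in> Z") (simp_all add: aut_factor_def[abs_def])
next
  case (Inr i)
  then show ?thesis
    using moebius_factor_holomorphic[OF assms] by (simp add: aut_factor_def[abs_def])
qed

lemma aut_factor_inverse:
  assumes "cmod a < 1" "cmod t < 1"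
  shows "aut_factor (- a) l (moebius a t) * aut_factor a l t = 1"
  using moebius_factor_nonzero[OF assms] powr_inverse_mult[OF moebius_factor_Re[OF assms]]
  by (simp add: aut_factor_def moebius_inverse[OF assms] split: sum.split)

lemma domain_aut_inverse:
  fixes p :: "complex^('d + 'k::finite)"
  assumes "cmod a < 1" "cmod (p $ Inr i) < 1"
  shows "domain_aut (- a) i (domain_aut a i p) = p"
  unfolding vec_eq_iff
proof
  fix l
  show "domain_aut (- a) i (domain_aut a i p) $ l = p $ l"
    using moebius_inverse(1)[OF assms] aut_factor_inverse[OF assms, of l]
    by (cases "l = Inr i") (simp_all add: domain_aut_def mult.assoc[symmetric])
qed

text \<open>The exponent counts 2 for the derivative in coordinate i, CARD('k) - 1 for the other
  ball coordinates, and \<open>\<alpha> l\<close> for each l in \<open>Z\<close>. It becomes the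
  exponent of 1 - <w,\<eta>> in the formula.\<close>

definition aut_jacobian :: "complex \<Rightarrow> 'k::finite \<Rightarrow> complex^('d + 'k) \<Rightarrow> complex" where
  "aut_jacobian a i p = moebius_factor a (p $ Inr i) powr of_real (real CARD('k) + 1 + weight)"

lemma aut_jacobian_eq:
  fixes i :: "'k::finite"
  assumes a: "cmod a < 1" and t: "cmod t < 1"
  shows "moebius_factor a t powr of_real (real CARD('k) + 1 + weight) = (moebius_factor a t)\<^sup>2 * (\<Prod>l\<in>(UNIV - {Inr i} :: ('d + 'k) set). aut_factor a l t)"
proof -
  let ?e = "moebius_factor a t"
  have e: "?e \<noteq> 0" by (rule moebius_factor_nonzero[OF a t])
  have un: "UNIV - {Inr i} = (Inl ` UNIV :: ('d + 'k) set) \<union> Inr ` (UNIV - {i})"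
  proof (rule set_eqI)
    fix l :: "'d + 'k"
    show "l \<in> UNIV - {Inr i} \<longleftrightarrow> l \<in> Inl ` UNIV \<union> Inr ` (UNIV - {i})" by (cases l) auto
  qed
  have "(\<Prod>l\<in>(UNIV - {Inr i} :: ('d + 'k) set). aut_factor a l t) = (\<Prod>l\<in>(Inl ` UNIV :: ('d + 'k) set). aut_factor a l t) * (\<Prod>l\<in>(Inr ` (UNIV - {i}) :: ('d + 'k) set). aut_factor a l t)"
    unfolding un by (rule prod.union_disjoint) auto
  also have "(\<Prod>l\<in>(Inr ` (UNIV - {i}) :: ('d + 'k) set). aut_factor a l t) = ?e ^ (CARD('k) - 1)"
    by (subst prod.reindex) (auto simp: aut_factor_def inj_on_def)
  also have "(\<Prod>l\<in>(Inl ` UNIV :: ('d + 'k) set). aut_factor a l t) = (\<Prod>l\<in>UNIV. if l \<in> Z then ?e powr of_real (\<alpha> l) else 1)"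
    by (subst prod.reindex) (auto simp: aut_factor_def inj_on_def)
  also have "\<dots> = (\<Prod>l\<in>Z. ?e powr of_real (\<alpha> l))" by (simp add: prod.If_cases)
  also have "\<dots> = ?e powr of_real weight"
    using e by (simp add: powr_def exp_sum sum_distrib_right)
  finally have "?e\<^sup>2 * (\<Prod>l\<in>(UNIV - {Inr i} :: ('d + 'k) set). aut_factor a l t) = ?e powr of_real weight * (?e\<^sup>2 * ?e ^ (CARD('k) - 1))"
    by simp
  also have "?e\<^sup>2 * ?e ^ (CARD('k) - 1) = ?e ^ (CARD('k) + 1)"
    by (simp flip: power_add)
  also have "\<dots> = ?e powr of_nat (CARD('k) + 1)" by (rule powr_complexpow[OF e, symmetric])
  also have "?e powr of_real weight * \<dots> = ?e powr of_real (real CARD('k) + 1 + weight)"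
    by (simp flip: powr_add add: add_ac)
  finally show ?thesis by simp
qed

text \<open>\<open>nn_integral_fibred_map\<close> restricts coordinate i to the disc and leaves the
  others free. U itself is carried as an indicator in the integrand, which the automorphism
  preserves.\<close>

lemma domain_aut_nn_integral:
  fixes F :: "complex^('d + 'k::finite) \<Rightarrow> ennreal"
  assumes a: "cmod a < 1" and F [measurable]: "F \<in> borel_measurable borel"
  shows "(\<integral>\<^sup>+p. indicator (Ualpha \<alpha> Z \<Omega>) p * ennreal ((cmod (aut_jacobian a i p))\<^sup>2) * F (domain_aut a i p) \<partial>lborel)
      = (\<integral>\<^sup>+p. indicator (Ualpha \<alpha> Z \<Omega>) p * F p \<partial>lborel)"
proof -
  let ?U = "Ualpha \<alpha> Z \<Omega> :: (complex^('d + 'k)) set" and ?S = "ball 0 1 :: complex set"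
  have [measurable]: "?U \<in> sets borel" by (rule borel_open[OF open_Ualpha])
  have S [measurable]: "?S \<in> sets borel" by simp
  \<comment> \<open>Total measurable versions, since the integrals run over the whole space.\<close>
  define m where "m t = (if t \<in> ?S then moebius a t else 0)" for t
  define m' where "m' t = (if t \<in> ?S then (moebius_factor a t)\<^sup>2 else 0)" for t
  define c where "c l t = (if t \<in> ?S then aut_factor a l t else 1)" for l :: "'d + 'k" and t
  have cont: "continuous_on ?S (moebius a)" "continuous_on ?S (\<lambda>t. (moebius_factor a t)\<^sup>2)" "continuous_on ?S (aut_factor a l)" for l
  proof -
    show "continuous_on ?S (moebius a)" by (intro holomorphic_on_imp_continuous_on moebius_holomorphic a)
    show "continuous_on ?S (\<lambda>t. (moebius_factor a t)\<^sup>2)"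
      by (intro continuous_intros holomorphic_on_imp_continuous_on[OF moebius_factor_holomorphic[OF a]])
    show "continuous_on ?S (aut_factor a l)" by (intro holomorphic_on_imp_continuous_on aut_factor_holomorphic a)
  qed
  have mp: "m p = moebius a p" "m' p = (moebius_factor a p)\<^sup>2" "c l p = aut_factor a l p" if "p \<in> ?S" for p l
    using that by (simp_all add: m_def m'_def c_def)
  have aut_mem: "domain_aut a i p \<in> ?U \<longleftrightarrow> p \<in> ?U" if "p $ Inr i \<in> ?S" for p
    using domain_aut_in[OF a, of p i] domain_aut_in[of "- a" "domain_aut a i p" i] domain_aut_inverse[OF a, of p i] a that by auto
  have "(\<integral>\<^sup>+p. indicator ?U p * ennreal ((cmod (aut_jacobian a i p))\<^sup>2) * F (domain_aut a i p) \<partial>lborel) =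
     (\<integral>\<^sup>+p. indicator ?S (p $ Inr i) * ennreal ((cmod (m' (p $ Inr i)))\<^sup>2 * (\<Prod>l\<in>UNIV - {Inr i}. (cmod (c l (p $ Inr i)))\<^sup>2)) *
       (\<lambda>p. indicator ?U p * F p) (\<chi> l. if l = Inr i then m (p $ Inr i) else c l (p $ Inr i) * p$l) \<partial>lborel)"
  proof (rule nn_integral_cong)
    fix p :: "complex^('d + 'k)"
    show "indicator ?U p * ennreal ((cmod (aut_jacobian a i p))\<^sup>2) * F (domain_aut a i p) =
      indicator ?S (p $ Inr i) * ennreal ((cmod (m' (p $ Inr i)))\<^sup>2 * (\<Prod>l\<in>UNIV - {Inr i}. (cmod (c l (p $ Inr i)))\<^sup>2)) *
       (\<lambda>p. indicator ?U p * F p) (\<chi> l. if l = Inr i then m (p $ Inr i) else c l (p $ Inr i) * p$l)"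
    proof (cases "p $ Inr i \<in> ?S")
      case True
      let ?t = "p $ Inr i"
      have "(cmod (aut_jacobian a i p))\<^sup>2 = (cmod (m' ?t))\<^sup>2 * (\<Prod>l\<in>UNIV - {Inr i}. (cmod (c l ?t))\<^sup>2)"
        using aut_jacobian_eq[OF a, of ?t i] True
        by (simp add: aut_jacobian_def mp norm_mult power_mult_distrib prod_norm[symmetric] prod_power_distrib)
      moreover have "(\<chi> l. if l = Inr i then m ?t else c l ?t * p$l) = domain_aut a i p"
        using True by (simp add: vec_eq_iff domain_aut_def mp)
      ultimately show ?thesis using True aut_mem[OF True] by (simp add: indicator_def)
    next
      case False
      then have "p \<notin> ?U" using Ualpha_nth[of p i] by auto
      then show ?thesis using False by simp
    qed
  qed
  also have "\<dots> = (\<integral>\<^sup>+p. indicator ?S (p $ Inr i) * (\<lambda>p. indicator ?U p * F p) p \<partial>lborel)"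
  proof (rule nn_integral_fibred_map)
    show "m ` ?S = ?S"
    proof (intro equalityI subsetI)
      fix t assume "t \<in> ?S"
      then have "cmod (moebius (- a) t) < 1" "moebius a (moebius (- a) t) = t"
        using norm_moebius_less_1[of "- a" t] moebius_inverse(1)[of "- a" t] a by auto
      then show "t \<in> m ` ?S" by (intro image_eqI[of _ _ "moebius (- a) t"]) (auto simp: m_def)
    qed (use norm_moebius_less_1[OF a] in \<open>auto simp: m_def\<close>)
    show "inj_on m ?S"
      using moebius_inverse(1)[OF a] by (intro inj_on_inverseI[of _ "moebius (- a)"]) (auto simp: m_def)
    show "(m has_field_derivative m' t) (at t)" if "t \<in> ?S" for t
    proof -
      have "(moebius a has_field_derivative (moebius_factor a t)\<^sup>2) (at t)" by (rule moebius_has_derivative[OF a]) (use that in simp)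
      then have "(m has_field_derivative (moebius_factor a t)\<^sup>2) (at t)"
        by (rule has_field_derivative_transform_within_open[OF _ open_ball that]) (simp add: m_def)
      then show ?thesis using that by (simp add: mp)
    qed
    show "continuous_on ?S m'"
      using cont(2) by (rule continuous_on_eq) (simp add: mp)
    show "c l t \<noteq> 0" if "t \<in> ?S" for l t
      using that aut_factor_nonzero[OF a, of t l] by (simp add: c_def)
    show "m \<in> borel_measurable borel" "m' \<in> borel_measurable borel" "c l \<in> borel_measurable borel" for l
      unfolding m_def[abs_def] m'_def[abs_def] c_def[abs_def]
      by (rule borel_measurable_continuous_on_if[OF S _ continuous_on_const] cont)+
  qed auto
  also have "\<dots> = (\<integral>\<^sup>+p. indicator ?U p * F p \<partial>lborel)"
    by (rule nn_integral_cong) (use Ualpha_nth in \<open>auto simp: indicator_def\<close>)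
  finally show ?thesis .
qed

lemma kernel_domain_aut:
  fixes K :: "complex^('d + 'k::finite) \<Rightarrow> complex^('d + 'k) \<Rightarrow> complex"
  assumes a: "cmod a < 1" and K: "is_bergman_kernel (Ualpha \<alpha> Z \<Omega>) K"
    and p: "p \<in> Ualpha \<alpha> Z \<Omega>" and q: "q \<in> Ualpha \<alpha> Z \<Omega>"
  shows "K p q = aut_jacobian a i p * K (domain_aut a i p) (domain_aut a i q) * cnj (aut_jacobian a i q)"
proof -
  let ?U = "Ualpha \<alpha> Z \<Omega> :: (complex^('d + 'k)) set"
  have hol: "holo_on ?U (\<lambda>p. g (p $ Inr i))" if "g holomorphic_on ball 0 1" for g
    by (rule holo_on_compose_holomorphic[OF holo_on_nth that open_ball]) (use Ualpha_nth in auto)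
  have hol_aut: "holo_on ?U (\<lambda>p. domain_aut b i p $ l)" if b: "cmod b < 1" for b l
  proof (cases "l = Inr i")
    case True
    then show ?thesis using hol[OF moebius_holomorphic[OF b]] by (simp add: domain_aut_def)
  next
    case False
    from holo_on_mult[OF hol[OF aut_factor_holomorphic[OF b]] holo_on_nth] show ?thesis using False by (simp add: domain_aut_def)
  qed
  have hol_jac: "holo_on ?U (aut_jacobian b i)" if b: "cmod b < 1" for b
    unfolding aut_jacobian_def[abs_def] by (rule hol[OF moebius_factor_powr_holomorphic[OF b]])
  have a': "cmod (- a) < 1" using a by simp
  show ?thesis
  proof (rule bergman_kernel_transform[OF open_Ualpha open_Ualpha hol_aut[OF a] hol_jac[OF a] domain_aut_in[OF a] hol_aut[OF a'] hol_jac[OF a'] domain_aut_in[OF a'] _ _ _ K K p q])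
    show "domain_aut (- a) i (domain_aut a i p) = p" if "p \<in> ?U" for p
      by (rule domain_aut_inverse[OF a Ualpha_nth[OF that]])
    show "aut_jacobian a i p * aut_jacobian (- a) i (domain_aut a i p) = 1" if "p \<in> ?U" for p
      using powr_inverse_mult[OF moebius_factor_Re[OF a Ualpha_nth[OF that]]] moebius_inverse(2)[OF a Ualpha_nth[OF that]]
      by (simp add: aut_jacobian_def domain_aut_nth mult.commute)
  qed (use domain_aut_nn_integral[OF a] in auto)
qed

end

section \<open>Reduction to the centre and the action of the differential operator\<close>

context hartogs_domain begin

lemma moebius_factor_self: "cmod a < 1 \<Longrightarrow> moebius_factor a a = of_real (1 / sqrt (1 - (cmod a)\<^sup>2))"
proof -
  assume a: "cmod a < 1"
  have "1 - cnj a * a = (complex_of_real (sqrt (1 - (cmod a)\<^sup>2)))\<^sup>2"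
    unfolding sqrt_one_minus_square[OF a] by (simp add: mult.commute)
  then show ?thesis unfolding moebius_factor_def by (simp add: power2_eq_square)
qed

text \<open>Moves the second point to the centre of the ball by Moebius maps along one coordinate axis at a time.\<close>

lemma kernel_at_centre:
  fixes K :: "complex^('d + 'k::finite) \<Rightarrow> complex^('d + 'k) \<Rightarrow> complex"
  assumes K: "is_bergman_kernel (Ualpha \<alpha> Z \<Omega>) K"
  shows "pt u w \<in> Ualpha \<alpha> Z \<Omega> \<Longrightarrow> pt v \<eta> \<in> Ualpha \<alpha> Z \<Omega> \<Longrightarrow>
    K (pt u w) (pt v \<eta>) =
      K (pt (zscale Z (\<lambda>i. (of_real (sqrt (1 - (norm \<eta>)\<^sup>2)) / (1 - cinner w \<eta>)) powr of_real (\<alpha> i)) u) 0)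
        (pt (zscale Z (\<lambda>i. of_real ((1 - (norm \<eta>)\<^sup>2) powr (- (\<alpha> i / 2)))) v) 0)
      / (1 - cinner w \<eta>) powr of_real (real CARD('k) + 1 + weight)"
\<comment> \<open>Each step kills one nonzero coordinate of \<eta> without creating others. It also
  changes u, w and v, which are therefore generalised.\<close>
proof (induction "card {i. \<eta>$i \<noteq> 0}" arbitrary: u w v \<eta> rule: less_induct)
  case less
  show ?case
  proof (cases "\<eta> = 0")
    case True
    have "v \<in> \<Omega>" using less.prems(2) by (rule Ualpha_zpart)
    have "cinner w 0 = 0" by (simp add: cinner_def)
    then show ?thesis
      using kernel_independent_of_w[OF K less.prems(1) \<open>v \<in> \<Omega>\<close>] True by (simp add: zscale_1)
  next
    case False
    then obtain i where i: "\<eta>$i \<noteq> 0" by (auto simp: vec_eq_iff)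
    let ?N = "complex_of_real (real CARD('k) + 1 + weight)"
    have w: "norm w < 1" and \<eta>: "norm \<eta> < 1" using less.prems by (auto simp: mem_Ualpha)
    define a where "a = \<eta>$i"
    have a: "cmod a < 1" unfolding a_def by (rule norm_nth_less[OF \<eta>])
    define q where "q = 1 - (cmod a)\<^sup>2"
    have q: "q > 0" unfolding q_def by (rule norm_less_1_square[OF a])
    define e where "e = moebius_factor a (w$i)"
    define Y where "Y = 1 - (norm \<eta>)\<^sup>2"
    define X where "X = 1 - cinner w \<eta>"
    define w' where "w' = ball_aut a i w"
    define \<eta>' where "\<eta>' = ball_aut a i \<eta>"
    have e: "0 < Re e" unfolding e_def by (rule moebius_factor_Re[OF a norm_nth_less[OF w]])
    have X: "0 < Re X" unfolding X_def by (rule Re_one_minus_pos[OF norm_cinner_less[OF w \<eta>]])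
    have nz: "e \<noteq> 0" "X \<noteq> 0" using e X by auto
    have Y: "Y > 0" unfolding Y_def by (rule norm_less_1_square[OF \<eta>])
    have ee: "moebius_factor a (\<eta>$i) = of_real (1 / sqrt q)"
      using moebius_factor_self[OF a] by (simp add: a_def q_def)
    \<comment> \<open>Together with \<open>Y'\<close> this shows that the asserted form is stable:
      in sqrt(Y/q) divided by the new 1 - <w,\<eta>> the roots of q cancel, and the remaining 1/e is
      absorbed by the factor e in \<open>u'\<close>.\<close>
    have X': "1 - cinner w' \<eta>' = e * of_real (1 / sqrt q) * X"
      using ball_aut_identity[OF a norm_nth_less[OF w, of i] norm_nth_less[OF \<eta>, of i]] ee
      by (simp add: w'_def \<eta>'_def e_def X_def)
    have Y': "1 - (norm \<eta>')\<^sup>2 = Y / q"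
      using ball_aut_norm(1)[OF a \<eta>, of i] ee q by (simp add: \<eta>'_def Y_def norm_divide power_divide)
    have eq: "0 < Re (e * of_real (1 / sqrt q))" using e q by simp
    have card: "card {l. \<eta>'$l \<noteq> 0} < card {l. \<eta>$l \<noteq> 0}"
    proof (rule psubset_card_mono)
      have "\<eta>'$i = 0" by (simp add: \<eta>'_def ball_aut_def moebius_def a_def)
      moreover have "\<eta>'$l = 0" if "\<eta>$l = 0" for l
        using that \<open>\<eta>'$i = 0\<close> by (cases "l = i") (auto simp: \<eta>'_def ball_aut_def)
      ultimately show "{l. \<eta>'$l \<noteq> 0} \<subset> {l. \<eta>$l \<noteq> 0}" using i by auto
    qed simp
    define u' where "u' = zscale Z (\<lambda>l. e powr of_real (\<alpha> l)) u"
    define v' where "v' = zscale Z (\<lambda>l. of_real (1 / sqrt q) powr of_real (\<alpha> l)) v"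
    have au: "domain_aut a i (pt u w) = pt u' w'" and av: "domain_aut a i (pt v \<eta>) = pt v' \<eta>'"
      by (simp_all only: domain_aut_pt u'_def v'_def w'_def \<eta>'_def e_def ee)
    have in': "pt u' w' \<in> Ualpha \<alpha> Z \<Omega>" "pt v' \<eta>' \<in> Ualpha \<alpha> Z \<Omega>"
      unfolding au[symmetric] av[symmetric] by (intro domain_aut_in[OF a] less.prems)+
    have su: "zscale Z (\<lambda>l. (of_real (sqrt (Y / q)) / (e * of_real (1 / sqrt q) * X)) powr of_real (\<alpha> l)) u'
        = zscale Z (\<lambda>l. (of_real (sqrt Y) / X) powr of_real (\<alpha> l)) u"
      unfolding u'_def zscale_zscale
    proof (rule zscale_cong)
      fix l
      let ?r = "of_real (sqrt (Y / q)) / (e * of_real (1 / sqrt q) * X)"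
      have r: "?r = of_real (sqrt Y) / (e * X)"
        using q nz by (simp add: real_sqrt_divide)
      \<comment> \<open>A product of numbers in the right half-plane may leave it. Here the product
        is 1 - <w',\<eta>'> for two points of the ball, which settles the sign.\<close>
      have "0 < Re (1 - cinner w' \<eta>')"
        unfolding w'_def \<eta>'_def by (intro Re_one_minus_pos norm_cinner_less ball_aut_norm(2)[OF a] w \<eta>)
      then have "0 < Re ?r"
        unfolding X' using Y q by (intro Re_of_real_divide_pos) auto
      from powr_mult_Re_pos[OF this e, of "of_real (\<alpha> l)"]
      show "?r powr of_real (\<alpha> l) * e powr of_real (\<alpha> l) = (of_real (sqrt Y) / X) powr of_real (\<alpha> l)"
        unfolding r using nz by simp
    qed
    have sv: "zscale Z (\<lambda>l. of_real ((Y / q) powr (- (\<alpha> l / 2)))) v' = zscale Z (\<lambda>l. of_real (Y powr (- (\<alpha> l / 2)))) v"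
      unfolding v'_def zscale_zscale
    proof (rule zscale_cong)
      fix l
      have "1 / sqrt q = q powr (- (1 / 2))" using q by (simp add: powr_half_sqrt powr_minus_divide)
      then have "(Y / q) powr (- (\<alpha> l / 2)) * (1 / sqrt q) powr \<alpha> l = Y powr (- (\<alpha> l / 2))"
        using q Y by (simp add: powr_divide powr_powr)
      then show "complex_of_real ((Y / q) powr (- (\<alpha> l / 2))) * of_real (1 / sqrt q) powr of_real (\<alpha> l)
          = of_real (Y powr (- (\<alpha> l / 2)))"
        using q by (subst powr_of_real) (simp_all flip: of_real_mult)
    qed
    \<comment> \<open>The powers of e and of 1 / sqrt q cancel against the Jacobian factors at the
      first and at the second point.\<close>
    have pN: "(e * of_real (1 / sqrt q) * X) powr ?N = e powr ?N * of_real ((1 / sqrt q) powr (real CARD('k) + 1 + weight)) * X powr ?N"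
      unfolding powr_mult_Re_pos[OF eq X] using q
      by (subst powr_mult_Re_pos[OF e]) (simp_all add: powr_of_real del: of_real_divide of_real_add)
    have "K (pt u w) (pt v \<eta>) = aut_jacobian a i (pt u w) * K (pt u' w') (pt v' \<eta>') * cnj (aut_jacobian a i (pt v \<eta>))"
      using kernel_domain_aut[OF a K less.prems, of i] unfolding au av .
    also have "aut_jacobian a i (pt u w) = e powr ?N" by (simp add: aut_jacobian_def e_def)
    also have "cnj (aut_jacobian a i (pt v \<eta>)) = of_real ((1 / sqrt q) powr (real CARD('k) + 1 + weight))"
      unfolding aut_jacobian_def pt_nth ee using q by (subst powr_of_real) auto
    also have "K (pt u' w') (pt v' \<eta>') =
        K (pt (zscale Z (\<lambda>l. (of_real (sqrt Y) / X) powr of_real (\<alpha> l)) u) 0)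
          (pt (zscale Z (\<lambda>l. of_real (Y powr (- (\<alpha> l / 2)))) v) 0) / (e * of_real (1 / sqrt q) * X) powr ?N"
      using less.hyps[OF card in'] unfolding X' Y' su sv .
    finally show ?thesis
      unfolding pN using nz q by (simp add: X_def Y_def)
  qed
qed

text \<open>By \<open>one_minus_cinner_bound\<close> these factors are no larger in modulus than the
  ones in \<open>falpha\<close>. This is needed on all of U, as the operator differentiates
  functions of the moved point.\<close>

lemma centre_in:
  assumes p: "pt u w \<in> Ualpha \<alpha> Z \<Omega>" and \<eta>: "norm \<eta> < 1"
  shows "zscale Z (\<lambda>i. (of_real (sqrt (1 - (norm \<eta>)\<^sup>2)) / (1 - cinner w \<eta>)) powr of_real (\<alpha> i)) u \<in> \<Omega>"
proof -
  have w: "norm w < 1" using p by (simp add: mem_Ualpha)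
  define s where "s = 1 - (norm w)\<^sup>2"
  define Y where "Y = 1 - (norm \<eta>)\<^sup>2"
  define X where "X = 1 - cinner w \<eta>"
  have s: "s > 0" and Y: "Y > 0" unfolding s_def Y_def by (intro norm_less_1_square w \<eta>)+
  have X: "cmod X > 0" using Re_one_minus_pos[OF norm_cinner_less[OF w \<eta>]] unfolding X_def by auto
  have "s * Y \<le> (cmod X)\<^sup>2" unfolding s_def Y_def X_def by (rule one_minus_cinner_bound[OF w \<eta>])
  then have "sqrt (s * Y) \<le> cmod X" by (simp add: real_le_lsqrt)
  then have "sqrt Y / cmod X \<le> 1 / sqrt s"
    using s X by (simp add: real_sqrt_mult field_simps)
  also have "1 / sqrt s = s powr (- (1 / 2))" using s by (simp add: powr_half_sqrt powr_minus_divide)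
  finally have le: "sqrt Y / cmod X \<le> s powr (- (1 / 2))" .
  show ?thesis
  proof (rule zscale_mono[where \<tau>="\<lambda>i. of_real (s powr (- (\<alpha> i / 2)))"])
    show "zscale Z (\<lambda>i. of_real (s powr (- (\<alpha> i / 2)))) u \<in> \<Omega>"
      using p by (simp add: mem_Ualpha s_def)
    fix i assume i: "i \<in> Z"
    have "cmod ((of_real (sqrt Y) / X) powr of_real (\<alpha> i)) = (sqrt Y / cmod X) powr \<alpha> i"
      using Y by (simp add: norm_powr_real_powr' norm_divide)
    also have "\<dots> \<le> (s powr (- (1 / 2))) powr \<alpha> i"
      using le alpha_pos[OF i] X Y by (intro powr_mono2) auto
    also have "\<dots> = s powr (- (\<alpha> i / 2))" by (simp add: powr_powr)
    finally show "cmod ((of_real (sqrt (1 - (norm \<eta>)\<^sup>2)) / (1 - cinner w \<eta>)) powr of_real (\<alpha> i))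
       \<le> cmod (complex_of_real (s powr (- (\<alpha> i / 2))))"
      by (simp add: X_def Y_def)
  qed
qed

text \<open>For fixed w the inner map is diagonal in z, and Euler fields commute with diagonal maps:
  z_l d/dz_l of f o H is (y_l d/dy_l f) o H. The identity is carried on the whole open set U because
  a derivative at p involves nearby points.\<close>

lemma Pop_eq_euler_iterate:
  fixes \<sigma> :: "complex^'k::finite \<Rightarrow> 'd \<Rightarrow> complex"
  assumes Z: "Z \<noteq> {}" and \<kappa>: "holo_on \<Omega> \<kappa>"
    and in_\<Omega>: "\<And>p. p \<in> Ualpha \<alpha> Z \<Omega> \<Longrightarrow> zscale Z (\<sigma> (wpart p)) (zpart p) \<in> \<Omega>"
    and g: "\<And>p. p \<in> Ualpha \<alpha> Z \<Omega> \<Longrightarrow> g p = C * euler_iterate \<kappa> k 0 (zscale Z (\<sigma> (wpart p)) (zpart p))"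
  shows "j \<le> k \<Longrightarrow> p \<in> Ualpha \<alpha> Z \<Omega> \<Longrightarrow>
    Pop \<alpha> Z j g p = C * euler_iterate \<kappa> k j (zscale Z (\<sigma> (wpart p)) (zpart p))"
proof (induction j arbitrary: p)
  case 0
  then show ?case using g by simp
next
  case (Suc j)
  let ?U = "Ualpha \<alpha> Z \<Omega> :: (complex^('d + 'k)) set"
  define H where "H p = zscale Z (\<sigma> (wpart p)) (zpart p)" for p :: "complex^('d + 'k)"
  have IH: "Pop \<alpha> Z j g p = C * euler_iterate \<kappa> k j (H p)" if "p \<in> ?U" for p
    unfolding H_def by (rule Suc.IH) (use that Suc.prems in auto)
  have p: "p \<in> ?U" by fact
  have Hp: "H p \<in> \<Omega>" unfolding H_def by (rule in_\<Omega>[OF p])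
  obtain D where D: "(euler_iterate \<kappa> k j has_derivative D) (at (H p))" "\<And>c v. D (c *s v) = c * D v"
    using holo_onE[OF holo_on_euler_iterate[OF Z \<kappa>] Hp] by metis
  have pd: "pdz (Pop \<alpha> Z j g) l p = C * (\<sigma> (wpart p) l * D (axis l 1))" if l: "l \<in> Z" for l
  proof -
    define P where "P t = (\<chi> i. if i = Inl l then t else p$i)" for t
    define \<gamma> where "\<gamma> t = H (P t)" for t
    have P0: "P (p $ Inl l) = p" by (simp add: P_def vec_eq_iff)
    have "open (P -` ?U)"
    proof (rule open_vimage[OF open_Ualpha])
      show "continuous_on UNIV P" unfolding P_def
        by (rule continuous_on_vec_lambda, rename_tac i, case_tac "i = Inl l") (auto intro!: continuous_intros)
    qed
    moreover have "p $ Inl l \<in> P -` ?U" using p P0 by simp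
    moreover have "((\<lambda>t. C * euler_iterate \<kappa> k j (\<gamma> t)) has_field_derivative C * D (\<sigma> (wpart p) l *s axis l 1)) (at (p $ Inl l))"
    proof (rule DERIV_cmult, rule holo_curve_derivative)
      show "(euler_iterate \<kappa> k j has_derivative D) (at (\<gamma> (p $ Inl l)))"
        using D(1) P0 by (simp add: \<gamma>_def)
      fix i
      have "wpart (P t) = wpart p" for t by (simp add: P_def wpart_def vec_eq_iff)
      then have "\<gamma> t $ i = (if i = l then \<sigma> (wpart p) l * t else H p $ i)" for t
        using l by (auto simp: \<gamma>_def H_def zscale_nth P_def zpart_def)
      then show "((\<lambda>t. \<gamma> t $ i) has_field_derivative (\<sigma> (wpart p) l *s axis l 1) $ i) (at (p $ Inl l))"
        by (cases "i = l") (auto simp: axis_def intro!: derivative_eq_intros)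
    qed (rule D(2))
    ultimately have "((\<lambda>t. Pop \<alpha> Z j g (P t)) has_field_derivative C * D (\<sigma> (wpart p) l *s axis l 1)) (at (p $ Inl l))"
      using IH by (elim has_field_derivative_transform_within_open) (auto simp: \<gamma>_def)
    then show ?thesis
      unfolding pdz_def P_def by (simp add: DERIV_imp_deriv D(2))
  qed
  have "Pop \<alpha> Z (Suc j) g p = of_nat (Suc j) * (C * euler_iterate \<kappa> k j (H p))
     + (\<Sum>l\<in>Z. of_real (\<alpha> l) * (C * euler_iterate \<kappa> k j (H p) + p $ Inl l * (C * (\<sigma> (wpart p) l * D (axis l 1)))))"
    by (simp add: Eop_def IH[OF p] pd)
  also have "\<dots> = C * (of_nat (Suc j) * euler_iterate \<kappa> k j (H p)
     + (\<Sum>l\<in>Z. of_real (\<alpha> l) * (euler_iterate \<kappa> k j (H p) + H p $ l * D (axis l 1))))"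
    by (simp add: distrib_left sum_distrib_left H_def zscale_nth zpart_def mult_ac cong: sum.cong)
  also have "\<dots> = C * euler_iterate \<kappa> k (Suc j) (H p)"
    using euler_iterate_Suc[OF Z holo_on_imp_continuous_on[OF \<kappa>] Hp _ D] Suc.prems by simp
  finally show ?case by (simp add: H_def)
qed

end

section \<open>Combination of the reductions\<close>

theorem theorem6:
  fixes Z :: "'d::finite set"
    and \<Omega> :: "(complex^'d) set"
    and \<alpha> :: "'d \<Rightarrow> real"
    and KU :: "complex^('d + 'k::finite) \<Rightarrow> complex^('d + 'k) \<Rightarrow> complex"
    and Keta :: "complex^'k \<Rightarrow> complex^'d \<Rightarrow> complex^'d \<Rightarrow> complex"
  assumes Z_ne: "Z \<noteq> {}"
    and dom: "is_domain \<Omega>"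
    and hart: "hartogs_star Z \<Omega>"
    and alpha_pos: "\<forall>j\<in>Z. \<alpha> j > 0"
    and KU: "is_bergman_kernel (Ualpha \<alpha> Z \<Omega>) KU"
    and Keta: "\<forall>\<eta>::complex^'k. norm \<eta> < 1 \<longrightarrow> is_bergman_kernel (Ueta \<alpha> Z \<Omega> \<eta>) (Keta \<eta>)"
    and p1: "pt u w \<in> Ualpha \<alpha> Z \<Omega>"
    and p2: "pt v \<eta> \<in> Ualpha \<alpha> Z \<Omega>"
  shows "KU (pt u w) (pt v \<eta>) =
     complex_of_real ((1 - (norm \<eta>)^2) powr (\<Sum>j\<in>Z. \<alpha> j))
       / (complex_of_real (pi ^ CARD('k))
          * (1 - cinner w \<eta>) powr complex_of_real (real CARD('k) + 1 + (\<Sum>j\<in>Z. \<alpha> j)))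
     * Pop \<alpha> Z CARD('k)
         (\<lambda>p. Keta \<eta> (hmap \<alpha> Z (zpart p) (wpart p) \<eta>) v) (pt u w)"
proof -
  interpret hartogs_domain Z \<Omega> \<alpha>
    by standard (use dom hart alpha_pos in \<open>auto simp: is_domain_def\<close>)
  have \<eta>: "norm \<eta> < 1" using p2 by (simp add: mem_Ualpha)
  define Y where "Y = 1 - (norm \<eta>)\<^sup>2"
  have Y: "Y > 0" unfolding Y_def by (rule norm_less_1_square[OF \<eta>])
  define v' where "v' = zscale Z (\<lambda>i. of_real (Y powr (- (\<alpha> i / 2)))) v"
  have v': "v' \<in> \<Omega>" using p2 by (simp add: mem_Ualpha v'_def Y_def)
  have K0: "is_bergman_kernel \<Omega> (Keta 0)" using Keta[rule_format, of 0] by (simp add: Ueta_0)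
  have K\<eta>: "is_bergman_kernel (Ueta \<alpha> Z \<Omega> \<eta>) (Keta \<eta>)" using Keta \<eta> by blast
  define \<kappa> where "\<kappa> y = KU (pt y 0) (pt v' 0)" for y
  have \<kappa>: "holo_on \<Omega> \<kappa>"
  proof -
    have "holo_on (Ualpha \<alpha> Z \<Omega>) (\<lambda>p. KU p (pt v' 0))"
      using bergman_kernel_in_space[OF KU, of "pt v' 0"] v' by (simp add: mem_Ualpha_0 bergman_space_def)
    then show ?thesis unfolding \<kappa>_def by (rule holo_on_pt) (simp add: mem_Ualpha_0)
  qed
  \<comment> \<open>It has sqrt Y where \<open>hmap\<close> has Y: the other half of the power is
    spent on the dilation of \<open>Ueta\<close> onto \<open>\<Omega>\<close>.\<close>
  define \<sigma> where "\<sigma> x i = (of_real (sqrt Y) / (1 - cinner x \<eta>)) powr complex_of_real (\<alpha> i)" for x i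
  define H where "H p = zscale Z (\<sigma> (wpart p)) (zpart p)" for p :: "complex^('d + 'k)"
  have H: "H p \<in> \<Omega>" if "p \<in> Ualpha \<alpha> Z \<Omega>" for p
    unfolding H_def \<sigma>_def Y_def by (rule centre_in[OF _ \<eta>]) (use that in simp)
  have opU: "open (Ueta \<alpha> Z \<Omega> \<eta>)"
  proof -
    have "continuous_on UNIV (\<lambda>u. pt u \<eta>)" by (intro continuous_intros)
    then have "open ((\<lambda>u. pt u \<eta>) -` Ualpha \<alpha> Z \<Omega>)" by (rule open_vimage[OF open_Ualpha])
    then show ?thesis by (simp add: Ueta_def vimage_def)
  qed
  define c where "c i = (if i \<in> Z then complex_of_real (Y powr (- (\<alpha> i / 2))) else 1)" for i
  have c_eq: "(\<chi> i. c i * y$i) = zscale Z (\<lambda>i. of_real (Y powr (- (\<alpha> i / 2)))) y" for y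
    by (simp add: c_def zscale_eq)
  have c_norm: "(cmod (\<Prod>i\<in>UNIV. c i))\<^sup>2 = Y powr (- weight)"
  proof -
    have "cmod (\<Prod>i\<in>UNIV. c i) = (\<Prod>i\<in>UNIV. if i \<in> Z then Y powr (- (\<alpha> i / 2)) else 1)"
      by (simp add: prod_norm[symmetric] c_def if_distrib cong: if_cong)
    also have "\<dots> = (\<Prod>i\<in>Z. Y powr (- (\<alpha> i / 2)))" by (simp add: prod.If_cases)
    also have "\<dots> = Y powr (- (weight / 2))"
      using Y by (simp add: powr_sum[symmetric] sum_negf sum_divide_distrib)
    finally show ?thesis using Y by (simp add: power2_eq_square flip: powr_add)
  qed
  \<comment> \<open>\<open>Ueta\<close> is a dilate of \<open>\<Omega>\<close>, so its kernel is
    that of \<open>\<Omega>\<close> up to the Jacobian \<open>Y powr (- weight)\<close>. The power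
    of 1 - |\<eta>|^2 in front of the operator cancels it at the end.\<close>
  have g: "Keta \<eta> (hmap \<alpha> Z (zpart p) (wpart p) \<eta>) v = of_real (Y powr (- weight)) * euler_iterate \<kappa> CARD('k) 0 (H p)"
    if p: "p \<in> Ualpha \<alpha> Z \<Omega>" for p :: "complex^('d + 'k)"
  proof -
    let ?h = "hmap \<alpha> Z (zpart p) (wpart p) \<eta>"
    have wp: "norm (wpart p) < 1" using mem_Ualpha[of "zpart p" "wpart p"] p by simp
    have eq: "zscale Z (\<lambda>i. of_real (Y powr (- (\<alpha> i / 2)))) ?h = H p"
      unfolding hmap_eq_zscale zscale_zscale H_def
    proof (rule zscale_cong)
      fix i
      let ?X = "1 - cinner (wpart p) \<eta>"
      have X: "0 < Re ?X" by (rule Re_one_minus_pos[OF norm_cinner_less[OF wp \<eta>]])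
      have "0 < Re (of_real (sqrt Y) / ?X)" "0 < Re (complex_of_real (sqrt Y))"
        using Re_of_real_divide_pos[OF _ X, of "sqrt Y"] Y by auto
      note mult = powr_mult_Re_pos[OF this]
      have "of_real Y / ?X = of_real (sqrt Y) / ?X * of_real (sqrt Y)"
        using Y by (simp flip: of_real_mult)
      then have "(of_real Y / ?X) powr of_real (\<alpha> i) = \<sigma> (wpart p) i * of_real (sqrt Y) powr of_real (\<alpha> i)"
        unfolding \<sigma>_def by (simp only: mult)
      also have "complex_of_real (sqrt Y) powr of_real (\<alpha> i) = of_real (Y powr (\<alpha> i / 2))"
        using Y by (subst powr_of_real) (simp_all add: powr_half_sqrt[symmetric] powr_powr)
      finally show "complex_of_real (Y powr (- (\<alpha> i / 2))) * (complex_of_real (1 - (norm \<eta>)\<^sup>2) / ?X) powr of_real (\<alpha> i) = \<sigma> (wpart p) i"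
        using Y by (simp add: Y_def[symmetric] powr_minus del: of_real_diff of_real_power)
    qed
    have mem: "y \<in> Ueta \<alpha> Z \<Omega> \<eta> \<longleftrightarrow> (\<chi> i. c i * y$i) \<in> \<Omega>" for y
      unfolding c_eq Y_def by (rule mem_Ueta[OF \<eta>])
    have c0: "c i \<noteq> 0" for i using Y by (simp add: c_def)
    have h_in: "?h \<in> Ueta \<alpha> Z \<Omega> \<eta>" unfolding mem c_eq eq by (rule H[OF p])
    have v_in: "v \<in> Ueta \<alpha> Z \<Omega> \<eta>" using p2 by (simp add: Ueta_def)
    have "Keta \<eta> ?h v = of_real (Y powr (- weight)) * Keta 0 (H p) v'"
      using bergman_kernel_diagonal[OF opU open_\<Omega> c0 mem K\<eta> K0 h_in v_in]
      unfolding c_norm c_eq eq v'_def .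
    then show ?thesis
      using kernel_base_eq_euler_iterate[OF Z_ne KU K0 H[OF p] v'] by (simp add: \<kappa>_def[abs_def])
  qed
  have "Pop \<alpha> Z CARD('k) (\<lambda>p. Keta \<eta> (hmap \<alpha> Z (zpart p) (wpart p) \<eta>) v) (pt u w)
      = of_real (Y powr (- weight)) * euler_iterate \<kappa> CARD('k) CARD('k) (H (pt u w))"
    unfolding H_def
    by (rule Pop_eq_euler_iterate[OF Z_ne \<kappa> _ _ _ p1]) (use H g in \<open>auto simp: H_def\<close>)
  also have "\<dots> = of_real (Y powr (- weight)) * (of_real (pi ^ CARD('k)) * KU (pt (H (pt u w)) 0) (pt v' 0))"
    by (simp add: euler_iterate_def \<kappa>_def scaleR_conv_of_real)
  finally have "complex_of_real (Y powr weight)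
       / (complex_of_real (pi ^ CARD('k)) * (1 - cinner w \<eta>) powr of_real (real CARD('k) + 1 + weight))
     * Pop \<alpha> Z CARD('k) (\<lambda>p. Keta \<eta> (hmap \<alpha> Z (zpart p) (wpart p) \<eta>) v) (pt u w)
     = KU (pt (H (pt u w)) 0) (pt v' 0) / (1 - cinner w \<eta>) powr of_real (real CARD('k) + 1 + weight)"
    using Y by (simp add: powr_minus)
  also have "\<dots> = KU (pt u w) (pt v \<eta>)"
    using kernel_at_centre[OF KU p1 p2] by (simp add: H_def \<sigma>_def[abs_def] v'_def Y_def)
  finally show ?thesis by (simp add: Y_def)
qed

end
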